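(* Let $\mathbf Y=\mathbf H(\mathcal Z,\mathbf Y)$ be a well-founded system, $\mathbf H=(\mathcal H_1,\dots,\mathcal H_m)$. Define the combinatorial Newton operator $$\mathbf N_{\mathbf H}(\mathcal Z,\mathbf Y)=\mathbf Y+\Big(\sum_{k\ge0}\Big(\frac{\partial\mathbf H}{\partial\mathbf Y}(\mathcal Z,\mathbf Y)\Big)^k\Big)\cdot\big(\mathbf H(\mathcal Z,\mathbf Y)-\mathbf Y\big).$$ The sequence $\mathbf Y^{[0]}=\mathbf 0$, $\mathbf Y^{[n+1]}=\mathbf N_{\mathbf H}(\mathcal Z,\mathbf Y^{[n]})$ ($n\ge0$) is well defined (that is, $\mathbf Y^{[n]}\subset\mathbf H(\mathcal Z,\mathbf Y^{[n]})$ for all $n$, so all subtractions are defined) and converges quadratically to the solution $\mathbf S$ of the system with $\mathbf S(\mathbf 0)=\mathbf H^m(\mathbf 0,\mathbf 0)$.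
   Context: Species (multisort) are functorial assignments of finite sets of structures to tuples of finite sets, up to isomorphism, with standard sum (disjoint union), product, composition, and partial derivative $\frac{\partial\mathcal F}{\partial\mathcal Y_i}[U]=\mathcal F[\dots,U_i\sqcup\{\star\},\dots]$; the Jacobian matrix has entries $\partial\mathcal H_i/\partial\mathcal Y_j$, with matrix powers computed using species sums and products, the $0$-th power being the identity matrix (species $1$ on the diagonal, $0$ elsewhere). $\mathcal F\subset\mathcal G$ means subspecies, and then $\mathcal G-\mathcal F$ is the species with $\mathcal G=\mathcal F+(\mathcal G-\mathcal F)$. Composition with species having structures on the empty set is defined for species polynomial (finitely many structures of each size in the other sorts) in the relevant sorts. Contact of order $p$: isomorphism of restrictions to size $\le p$; convergence: eventual contact of every order; convergence is \emph{quadratic} if whenever $\mathbf F^{[n]}$ has contact of order $k$ with the limit, $\mathbf F^{[n+1]}$ has contact of order $2k+1$ with it. The system is \emph{well founded} if the iteration $\mathbf Z^{[0]}=\mathbf 0$, $\mathbf Z^{[n+1]}=\mathbf H(\mathcal Z,\mathbf Z^{[n]})$ is well defined (for each $i$, $\mathbf H$ is polynomial in $\mathcal Y_i$ or all iterates have empty $i$-th coordinate at size $0$), converges, and its limit has no coordinate equal to $0$. $\mathbf H^m(\mathbf 0,\mathbf 0)$ is the $m$-th iterate of $\mathbf Y\mapsto\mathbf H(\mathbf 0,\mathbf Y)$ from $\mathbf 0$; the solution with this value at $\mathbf 0$ exists and is unique up to isomorphism. *)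

theory Defs
  imports Complex_Main "HOL-Library.FSet" "HOL-Library.Countable" "HOL-Library.Cardinality"
begin

section \<open>Multisort species\<close>

text \<open>
  A species with sorts in \<^typ>\<open>'s\<close> is a functor from families, indexed by \<^typ>\<open>'s\<close>, of finite
  sets of labels, with families of bijections, to finite sets. Labels are natural numbers: the
  finite sets of naturals with their bijections are equivalent to all finite sets with theirs.
  A morphism out of \<open>U\<close> is a family of functions injective on \<open>U\<close>; its target is the image.
\<close>

type_synonym 's labels = "'s \<Rightarrow> nat fset"

record ('s, 'a) species =
  structs :: "'s labels \<Rightarrow> 'a set"
  transport :: "'s labels \<Rightarrow> ('s \<Rightarrow> nat \<Rightarrow> nat) \<Rightarrow> 'a \<Rightarrow> 'a"

definition no_labels :: "'s labels" where
  "no_labels = (\<lambda>s. {||})"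

definition label_size :: "('s::finite) labels \<Rightarrow> nat" where
  "label_size U = (\<Sum>s\<in>UNIV. fcard (U s))"

definition relabel :: "('s \<Rightarrow> nat \<Rightarrow> nat) \<Rightarrow> 's labels \<Rightarrow> 's labels" where
  "relabel \<sigma> U = (\<lambda>s. \<sigma> s |`| U s)"

definition relabelling :: "('s \<Rightarrow> nat \<Rightarrow> nat) \<Rightarrow> 's labels \<Rightarrow> bool" where
  "relabelling \<sigma> U \<longleftrightarrow> (\<forall>s. inj_on (\<sigma> s) (fset (U s)))"

definition is_species :: "('s, 'a) species \<Rightarrow> bool" where
  "is_species F \<longleftrightarrow>
     (\<forall>U. finite (structs F U)) \<and>
     (\<forall>U \<sigma>. relabelling \<sigma> U \<longrightarrow>
        (\<forall>x\<in>structs F U. transport F U \<sigma> x \<in> structs F (relabel \<sigma> U))) \<and>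
     (\<forall>U \<sigma> \<sigma>'. relabelling \<sigma> U \<and> (\<forall>s a. a |\<in>| U s \<longrightarrow> \<sigma> s a = \<sigma>' s a) \<longrightarrow>
        (\<forall>x\<in>structs F U. transport F U \<sigma> x = transport F U \<sigma>' x)) \<and>
     (\<forall>U. \<forall>x\<in>structs F U. transport F U (\<lambda>s. id) x = x) \<and>
     (\<forall>U \<sigma> \<tau>. relabelling \<sigma> U \<and> relabelling \<tau> (relabel \<sigma> U) \<longrightarrow>
        (\<forall>x\<in>structs F U. transport F U (\<lambda>s. \<tau> s \<circ> \<sigma> s) x
                         = transport F (relabel \<sigma> U) \<tau> (transport F U \<sigma> x)))"

definition natural :: "('s, 'a) species \<Rightarrow> ('s, 'b) species \<Rightarrow> ('s labels \<Rightarrow> 'a \<Rightarrow> 'b) \<Rightarrow> bool" where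
  "natural F G \<phi> \<longleftrightarrow>
     (\<forall>U \<sigma>. relabelling \<sigma> U \<longrightarrow>
        (\<forall>x\<in>structs F U. \<phi> (relabel \<sigma> U) (transport F U \<sigma> x) = transport G U \<sigma> (\<phi> U x)))"

definition species_iso :: "('s, 'a) species \<Rightarrow> ('s, 'b) species \<Rightarrow> bool" where
  "species_iso F G \<longleftrightarrow>
     (\<exists>\<phi>. natural F G \<phi> \<and> (\<forall>U. bij_betw (\<phi> U) (structs F U) (structs G U)))"

text \<open>Species are considered up to isomorphism, so a subspecies is given by an embedding.\<close>

definition subspecies :: "('s, 'a) species \<Rightarrow> ('s, 'b) species \<Rightarrow> bool" where
  "subspecies F G \<longleftrightarrow>
     (\<exists>\<phi>. natural F G \<phi> \<and>
        (\<forall>U. inj_on (\<phi> U) (structs F U) \<and> \<phi> U ` structs F U \<subseteq> structs G U))"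


section \<open>Operations on species\<close>

definition species_zero :: "('s, nat) species" where
  "species_zero = \<lparr>structs = (\<lambda>U. {}), transport = (\<lambda>U \<sigma> x. x)\<rparr>"

definition species_one :: "('s, nat) species" where
  "species_one = \<lparr>structs = (\<lambda>U. if U = no_labels then {0} else {}), transport = (\<lambda>U \<sigma> x. x)\<rparr>"

definition species_atom :: "'s \<Rightarrow> ('s, nat) species" where
  "species_atom s =
     \<lparr>structs = (\<lambda>U. if \<exists>a. U = no_labels(s := {|a|}) then {0} else {}),
      transport = (\<lambda>U \<sigma> x. x)\<rparr>"

definition species_add :: "('s, 'a) species \<Rightarrow> ('s, 'b) species \<Rightarrow> ('s, 'a + 'b) species" where
  "species_add F G =
     \<lparr>structs = (\<lambda>U. structs F U <+> structs G U),
      transport = (\<lambda>U \<sigma>. map_sum (transport F U \<sigma>) (transport G U \<sigma>))\<rparr>"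

definition species_Sum :: "('i \<Rightarrow> ('s, 'a) species) \<Rightarrow> ('s, 'i \<times> 'a) species" where
  "species_Sum F =
     \<lparr>structs = (\<lambda>U. SIGMA i:UNIV. structs (F i) U),
      transport = (\<lambda>U \<sigma> (i, x). (i, transport (F i) U \<sigma> x))\<rparr>"

text \<open>The condition under which an infinite sum of species is a species.\<close>

definition species_summable :: "('i \<Rightarrow> ('s, 'a) species) \<Rightarrow> bool" where
  "species_summable F \<longleftrightarrow> (\<forall>U. finite {i. structs (F i) U \<noteq> {}})"

definition species_mult :: "('s, 'a) species \<Rightarrow> ('s, 'b) species
    \<Rightarrow> ('s, ('s labels \<times> 'a) \<times> ('s labels \<times> 'b)) species" where
  "species_mult F G =
     \<lparr>structs = (\<lambda>U. {((A, x), (B, y)).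
        (\<forall>s. A s |\<union>| B s = U s \<and> A s |\<inter>| B s = {||}) \<and> x \<in> structs F A \<and> y \<in> structs G B}),
      transport = (\<lambda>U \<sigma> ((A, x), (B, y)).
        ((relabel \<sigma> A, transport F A \<sigma> x), (relabel \<sigma> B, transport G B \<sigma> y)))\<rparr>"

text \<open>
  In the derivative, \<open>U \<squnion> {\<star>}\<close> is realised by taking \<open>0\<close> as \<open>\<star>\<close> and the successors of the
  elements of \<open>U\<close> as their copies.
\<close>

definition add_star :: "'s \<Rightarrow> 's labels \<Rightarrow> 's labels" where
  "add_star s U = U(s := finsert 0 (Suc |`| U s))"

definition lift_star :: "'s \<Rightarrow> ('s \<Rightarrow> nat \<Rightarrow> nat) \<Rightarrow> 's \<Rightarrow> nat \<Rightarrow> nat" where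
  "lift_star s \<sigma> = \<sigma>(s := case_nat 0 (\<lambda>a. Suc (\<sigma> s a)))"

definition species_deriv :: "'s \<Rightarrow> ('s, 'a) species \<Rightarrow> ('s, 'a) species" where
  "species_deriv s F =
     \<lparr>structs = (\<lambda>U. structs F (add_star s U)),
      transport = (\<lambda>U \<sigma>. transport F (add_star s U) (lift_star s \<sigma>))\<rparr>"

text \<open>
  The difference is the species, unique up to isomorphism, that added to \<open>F\<close> gives \<open>G\<close>; it is
  meaningful only when \<open>F\<close> is a subspecies of \<open>G\<close>.
\<close>

definition species_diff :: "('s, 'b) species \<Rightarrow> ('s, 'a) species \<Rightarrow> ('s, 'b) species" where
  "species_diff G F = (SOME D. is_species D \<and> species_iso G (species_add F D))"

definition species_restrict :: "nat \<Rightarrow> ('s::finite, 'a) species \<Rightarrow> ('s, 'a) species" where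
  "species_restrict p F = F\<lparr>structs := (\<lambda>U. if label_size U \<le> p then structs F U else {})\<rparr>"


section \<open>Composition\<close>

definition standard_labels :: "('t \<Rightarrow> nat) \<Rightarrow> 't labels" where
  "standard_labels n = (\<lambda>t. fset_of_list [0..<n t])"

text \<open>
  An assembly on \<open>U\<close> splits \<open>U\<close> into blocks, each carrying a sort \<open>t\<close> and a \<open>G t\<close>-structure,
  and puts an \<open>F\<close>-structure on the blocks. The blocks of sort \<open>t\<close> are listed, so that they
  are labelled by their positions; a structure of the composition is an assembly up to the order
  of the lists. Blocks may be empty when \<open>G t\<close> has structures on the empty set. If no
  \<open>G t\<close> has any, the blocks form a partition of \<open>U\<close>, and this is the usual composition.
\<close>

type_synonym ('s, 't, 'a, 'b) assembly = "'a \<times> ('t \<Rightarrow> ('s labels \<times> 'b) list)"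

definition block_labels :: "('t \<Rightarrow> 'c list) \<Rightarrow> 't labels" where
  "block_labels bl = standard_labels (\<lambda>t. length (bl t))"

definition assemblies :: "('t, 'a) species \<Rightarrow> ('t \<Rightarrow> ('s, 'b) species) \<Rightarrow> 's labels
    \<Rightarrow> ('s, 't, 'a, 'b) assembly set" where
  "assemblies F G U = {(f, bl).
     f \<in> structs F (block_labels bl) \<and>
     (\<forall>t. \<forall>(B, g)\<in>set (bl t). g \<in> structs (G t) B \<and> (\<forall>s. B s |\<subseteq>| U s)) \<and>
     (\<forall>s a. a |\<in>| U s \<longrightarrow> (\<exists>!(t, j). j < length (bl t) \<and> a |\<in>| fst (bl t ! j) s))}"

definition reorderings :: "('t, 'a) species \<Rightarrow> ('s, 't, 'a, 'b) assembly
    \<Rightarrow> ('s, 't, 'a, 'b) assembly set" where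
  "reorderings F = (\<lambda>(f, bl). {(f', bl'). \<exists>\<pi>.
     (\<forall>t. bij_betw (\<pi> t) {..<length (bl t)} {..<length (bl t)} \<and>
          length (bl' t) = length (bl t) \<and>
          (\<forall>j<length (bl t). bl' t ! \<pi> t j = bl t ! j)) \<and>
     f' = transport F (block_labels bl) \<pi> f})"

definition assembly_relabel :: "('t \<Rightarrow> ('s, 'b) species) \<Rightarrow> ('s \<Rightarrow> nat \<Rightarrow> nat)
    \<Rightarrow> ('s, 't, 'a, 'b) assembly \<Rightarrow> ('s, 't, 'a, 'b) assembly" where
  "assembly_relabel G \<sigma> = (\<lambda>(f, bl).
     (f, \<lambda>t. map (\<lambda>(B, g). (relabel \<sigma> B, transport (G t) B \<sigma> g)) (bl t)))"

definition species_comp :: "('t::finite, 'a) species \<Rightarrow> ('t \<Rightarrow> ('s, 'b) species)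
    \<Rightarrow> ('s, ('s, 't, 'a, 'b) assembly fset) species" where
  "species_comp F G =
     \<lparr>structs = (\<lambda>U. (\<lambda>p. Abs_fset (reorderings F p)) ` assemblies F G U),
      transport = (\<lambda>U \<sigma> c. assembly_relabel G \<sigma> |`| c)\<rparr>"

text \<open>
  Polynomial in the sorts of \<open>J\<close>, jointly: for each total size in the sorts outside \<open>J\<close> there are
  finitely many structures, counted on standard label sets.
\<close>

definition polynomial_in :: "('t::finite, 'a) species \<Rightarrow> 't set \<Rightarrow> bool" where
  "polynomial_in F J \<longleftrightarrow>
     (\<forall>k. finite {(n, f). (\<Sum>t\<in>-J. n t) = k \<and> f \<in> structs F (standard_labels n)})"

definition composable :: "('t::finite, 'a) species \<Rightarrow> ('t \<Rightarrow> ('s, 'b) species) \<Rightarrow> bool" where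
  "composable F G \<longleftrightarrow> polynomial_in F {t. structs (G t) no_labels \<noteq> {}}"


section \<open>Systems\<close>

text \<open>
  Each operation above builds a new type of structures. To iterate them, structures are coded as
  natural numbers, which replaces a species by an isomorphic one.
\<close>

definition coded :: "('s, 'a::countable) species \<Rightarrow> ('s, nat) species" where
  "coded F =
     \<lparr>structs = (\<lambda>U. to_nat ` structs F U),
      transport = (\<lambda>U \<sigma> c. to_nat (transport F U \<sigma> (from_nat c)))\<rparr>"

text \<open>
  The sorts of \<open>\<Z>\<close> are the elements of \<^typ>\<open>'z\<close>, and the coordinates of a system, as well as the
  sorts of \<open>Y\<close>, those of \<^typ>\<open>'m\<close>.
\<close>

type_synonym ('z, 'm) species_vec = "'m \<Rightarrow> ('z, nat) species"
type_synonym ('z, 'm) species_mat = "'m \<Rightarrow> 'm \<Rightarrow> ('z, nat) species"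
type_synonym ('z, 'm) system = "'m \<Rightarrow> ('z + 'm, nat) species"

definition vec_zero :: "('z, 'm) species_vec" where
  "vec_zero = (\<lambda>i. species_zero)"

definition at_ZY :: "('z, 'm) species_vec \<Rightarrow> 'z + 'm \<Rightarrow> ('z, nat) species" where
  "at_ZY Y = case_sum species_atom Y"

definition at_0Y :: "('z, 'm) species_vec \<Rightarrow> 'z + 'm \<Rightarrow> ('z, nat) species" where
  "at_0Y Y = case_sum (\<lambda>z. species_zero) Y"

definition system_apply :: "('z::finite, 'm::finite) system \<Rightarrow> ('z, 'm) species_vec
    \<Rightarrow> ('z, 'm) species_vec" where
  "system_apply H Y = (\<lambda>i. coded (species_comp (H i) (at_ZY Y)))"

definition system_apply0 :: "('z::finite, 'm::finite) system \<Rightarrow> ('z, 'm) species_vec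
    \<Rightarrow> ('z, 'm) species_vec" where
  "system_apply0 H Y = (\<lambda>i. coded (species_comp (H i) (at_0Y Y)))"

definition contact :: "nat \<Rightarrow> ('z::finite, 'm) species_vec \<Rightarrow> ('z, 'm) species_vec \<Rightarrow> bool" where
  "contact p F G \<longleftrightarrow> (\<forall>i. species_iso (species_restrict p (F i)) (species_restrict p (G i)))"

definition converges_to :: "(nat \<Rightarrow> ('z::finite, 'm) species_vec) \<Rightarrow> ('z, 'm) species_vec \<Rightarrow> bool"
  where
  "converges_to F S \<longleftrightarrow> (\<forall>p. \<exists>N. \<forall>n\<ge>N. contact p (F n) S)"

definition converges_quadratically_to ::
    "(nat \<Rightarrow> ('z::finite, 'm) species_vec) \<Rightarrow> ('z, 'm) species_vec \<Rightarrow> bool" where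
  "converges_quadratically_to F S \<longleftrightarrow>
     converges_to F S \<and> (\<forall>n k. contact k (F n) S \<longrightarrow> contact (2 * k + 1) (F (Suc n)) S)"

definition iterate :: "('z::finite, 'm::finite) system \<Rightarrow> nat \<Rightarrow> ('z, 'm) species_vec" where
  "iterate H n = (system_apply H ^^ n) vec_zero"

definition iteration_well_defined :: "('z::finite, 'm::finite) system \<Rightarrow> bool" where
  "iteration_well_defined H \<longleftrightarrow>
     (\<forall>i. polynomial_in (H i) (Inr ` {j. \<exists>n. structs (iterate H n j) no_labels \<noteq> {}}))"

definition well_founded :: "('z::finite, 'm::finite) system \<Rightarrow> bool" where
  "well_founded H \<longleftrightarrow>
     iteration_well_defined H \<and>
     (\<exists>S. (\<forall>i. is_species (S i)) \<and> converges_to (iterate H) S \<and>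
          (\<forall>i. \<not> species_iso (S i) (species_zero :: ('z, nat) species)))"

definition is_solution :: "('z::finite, 'm::finite) system \<Rightarrow> ('z, 'm) species_vec \<Rightarrow> bool" where
  "is_solution H S \<longleftrightarrow>
     (\<forall>i. is_species (S i)) \<and> (\<forall>i. composable (H i) (at_ZY S)) \<and>
     (\<forall>i. species_iso (S i) (system_apply H S i))"

text \<open>The condition \<open>S(0) = H\<^sup>m(0, 0)\<close>, where \<open>m\<close> is the number of coordinates.\<close>

definition has_initial_value :: "('z::finite, 'm::finite) system \<Rightarrow> ('z, 'm) species_vec \<Rightarrow> bool"
  where
  "has_initial_value H S \<longleftrightarrow>
     (\<forall>i. species_iso (species_comp (S i) (\<lambda>z. species_zero :: ('z, nat) species))
                      ((system_apply0 H ^^ CARD('m)) vec_zero i))"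


section \<open>The combinatorial Newton operator\<close>

definition mat_one :: "('z, 'm) species_mat" where
  "mat_one = (\<lambda>i j. if i = j then species_one else species_zero)"

definition mat_mult :: "('z::finite, 'm::finite) species_mat \<Rightarrow> ('z, 'm) species_mat
    \<Rightarrow> ('z, 'm) species_mat" where
  "mat_mult A B = (\<lambda>i k. coded (species_Sum (\<lambda>j. species_mult (A i j) (B j k))))"

definition mat_vec_mult :: "('z::finite, 'm::finite) species_mat \<Rightarrow> ('z, 'm) species_vec
    \<Rightarrow> ('z, 'm) species_vec" where
  "mat_vec_mult A v = (\<lambda>i. coded (species_Sum (\<lambda>j. species_mult (A i j) (v j))))"

definition mat_power :: "('z::finite, 'm::finite) species_mat \<Rightarrow> nat \<Rightarrow> ('z, 'm) species_mat" where
  "mat_power A k = (mat_mult A ^^ k) mat_one"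

definition mat_power_sum :: "('z::finite, 'm::finite) species_mat \<Rightarrow> ('z, 'm) species_mat" where
  "mat_power_sum A = (\<lambda>i j. coded (species_Sum (\<lambda>k. mat_power A k i j)))"

definition jacobian :: "('z::finite, 'm::finite) system \<Rightarrow> ('z, 'm) species_vec
    \<Rightarrow> ('z, 'm) species_mat" where
  "jacobian H Y = (\<lambda>i j. coded (species_comp (species_deriv (Inr j) (H i)) (at_ZY Y)))"

definition newton :: "('z::finite, 'm::finite) system \<Rightarrow> ('z, 'm) species_vec
    \<Rightarrow> ('z, 'm) species_vec" where
  "newton H Y = (\<lambda>i. coded (species_add (Y i)
     (mat_vec_mult (mat_power_sum (jacobian H Y)) (\<lambda>j. species_diff (system_apply H Y j) (Y j)) i)))"

definition newton_defined :: "('z::finite, 'm::finite) system \<Rightarrow> ('z, 'm) species_vec \<Rightarrow> bool" where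
  "newton_defined H Y \<longleftrightarrow>
     (\<forall>i. is_species (Y i)) \<and>
     (\<forall>i. composable (H i) (at_ZY Y)) \<and>
     (\<forall>i j. composable (species_deriv (Inr j) (H i)) (at_ZY Y)) \<and>
     (\<forall>i j. species_summable (\<lambda>k. mat_power (jacobian H Y) k i j)) \<and>
     (\<forall>i. subspecies (Y i) (system_apply H Y i))"

definition newton_iterate :: "('z::finite, 'm::finite) system \<Rightarrow> nat \<Rightarrow> ('z, 'm) species_vec" where
  "newton_iterate H n = (newton H ^^ n) vec_zero"

end

theory Submission
  imports Defs "HOL-Library.FuncSet"
begin

text \<open>
  The solution is a species of finite trees: a tree is an assembly of the system whose blocks carry
  atoms and smaller trees. Every Newton iterate is isomorphic to a set \<open>P\<close> of trees closed under taking
  children, and the Newton operator adds to \<open>P\<close> the trees with a path from the root along which each node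
  has exactly one child outside \<open>P\<close>, ending in a node with all children in \<open>P\<close>. If \<open>P\<close> has all trees of
  size at most \<open>k\<close>, then a tree of size at most \<open>2k + 1\<close> has at most one child outside \<open>P\<close>, which by
  induction on the height gives quadratic convergence. The powers of the Jacobian are summable because a
  path of length \<open>k\<close> can be completed, no coordinate being zero, to a tree of height more than \<open>k\<close> on a
  label set that does not depend on \<open>k\<close>, and there are finitely many trees on it. The same argument
  excludes cycles of dependencies that use no labels, which gives the initial value and uniqueness.
\<close>

text \<open>Three obstacles shape the proof. \<open>species_diff\<close> is a choice, so a
  difference is known only once cancellation in sums has been proved, and cancellation must be
  natural: counting structures is not enough. Next, every operation recodes its structures, so the
  Newton iterates do not lie inside the solution; each of them is compared with a family of subsets
  of \<open>S\<close>, where sums become disjoint unions and where a child outside \<open>P\<close>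
  makes the marked block of a derivative recoverable. Finally, blocks may be empty, so a child may
  carry all the labels of its parent and induction on size alone does not close; the height takes
  over. The constant \<open>2 * k + 1\<close> appears because two children larger than
  \<open>k\<close> would require \<open>2 * k + 2\<close> labels. Contact supplies one isomorphism
  for each order, and these need not fit together; existence is therefore obtained from the union of
  the iterates, which are literally nested. Uniqueness takes the form that every solution with the
  given initial value is exhausted by its trees, of bounded height at each size, so the convergence
  argument applies to it directly.\<close>

definition functorial :: "('s, 'a) species \<Rightarrow> bool" where
  "functorial F \<longleftrightarrow>
     (\<forall>U \<sigma>. relabelling \<sigma> U \<longrightarrow>
        (\<forall>x\<in>structs F U. transport F U \<sigma> x \<in> structs F (relabel \<sigma> U))) \<and>
     (\<forall>U \<sigma> \<sigma>'. relabelling \<sigma> U \<and> (\<forall>s a. a |\<in>| U s \<longrightarrow> \<sigma> s a = \<sigma>' s a) \<longrightarrow>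
        (\<forall>x\<in>structs F U. transport F U \<sigma> x = transport F U \<sigma>' x)) \<and>
     (\<forall>U. \<forall>x\<in>structs F U. transport F U (\<lambda>s. id) x = x) \<and>
     (\<forall>U \<sigma> \<tau>. relabelling \<sigma> U \<and> relabelling \<tau> (relabel \<sigma> U) \<longrightarrow>
        (\<forall>x\<in>structs F U. transport F U (\<lambda>s. \<tau> s \<circ> \<sigma> s) x
                         = transport F (relabel \<sigma> U) \<tau> (transport F U \<sigma> x)))"

text \<open>Finiteness is kept apart from functoriality because compositions and infinite sums are
  functors before they are known to be finite; for the Newton operator finiteness comes last, from
  an isomorphism with a part of \<open>S\<close>.\<close>

lemma is_species_iff_functorial:
  "is_species F \<longleftrightarrow> functorial F \<and> (\<forall>U. finite (structs F U))"
  unfolding is_species_def functorial_def by blast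

lemma functorial_closed:
  "functorial F \<Longrightarrow> relabelling \<sigma> U \<Longrightarrow> x \<in> structs F U \<Longrightarrow> transport F U \<sigma> x \<in> structs F (relabel \<sigma> U)"
  unfolding functorial_def by blast

lemma functorial_cong:
  "functorial F \<Longrightarrow> relabelling \<sigma> U \<Longrightarrow> \<forall>s a. a |\<in>| U s \<longrightarrow> \<sigma> s a = \<sigma>' s a \<Longrightarrow> x \<in> structs F U
    \<Longrightarrow> transport F U \<sigma> x = transport F U \<sigma>' x"
  unfolding functorial_def by blast

lemma functorial_id: "functorial F \<Longrightarrow> x \<in> structs F U \<Longrightarrow> transport F U (\<lambda>s. id) x = x"
  unfolding functorial_def by blast

lemma functorial_comp:
  "functorial F \<Longrightarrow> relabelling \<sigma> U \<Longrightarrow> relabelling \<tau> (relabel \<sigma> U) \<Longrightarrow> x \<in> structs F U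
    \<Longrightarrow> transport F U (\<lambda>s. \<tau> s \<circ> \<sigma> s) x = transport F (relabel \<sigma> U) \<tau> (transport F U \<sigma> x)"
  unfolding functorial_def by blast

lemma functorialI:
  assumes "\<And>U \<sigma> x. relabelling \<sigma> U \<Longrightarrow> x \<in> structs F U \<Longrightarrow> transport F U \<sigma> x \<in> structs F (relabel \<sigma> U)"
    and "\<And>U \<sigma> \<sigma>' x. relabelling \<sigma> U \<Longrightarrow> \<forall>s a. a |\<in>| U s \<longrightarrow> \<sigma> s a = \<sigma>' s a \<Longrightarrow> x \<in> structs F U
      \<Longrightarrow> transport F U \<sigma> x = transport F U \<sigma>' x"
    and "\<And>U x. x \<in> structs F U \<Longrightarrow> transport F U (\<lambda>s. id) x = x"
    and "\<And>U \<sigma> \<tau> x. relabelling \<sigma> U \<Longrightarrow> relabelling \<tau> (relabel \<sigma> U) \<Longrightarrow> x \<in> structs F U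
      \<Longrightarrow> transport F U (\<lambda>s. \<tau> s \<circ> \<sigma> s) x = transport F (relabel \<sigma> U) \<tau> (transport F U \<sigma> x)"
  shows "functorial F"
  unfolding functorial_def using assms by blast

section \<open>Relabellings and the size of label sets\<close>

lemma relabel_id [simp]: "relabel (\<lambda>s. id) U = U"
  by (simp add: relabel_def)

lemma relabel_relabel: "relabel \<tau> (relabel \<sigma> U) = relabel (\<lambda>s. \<tau> s \<circ> \<sigma> s) U"
  by (simp add: relabel_def fset.map_comp)

lemma relabel_cong: "\<forall>s a. a |\<in>| U s \<longrightarrow> \<sigma> s a = \<sigma>' s a \<Longrightarrow> relabel \<sigma> U = relabel \<sigma>' U"
  by (auto simp: relabel_def fun_eq_iff intro!: fset.map_cong)

lemma relabelling_compose:
  "relabelling \<sigma> U \<Longrightarrow> relabelling \<tau> (relabel \<sigma> U) \<Longrightarrow> relabelling (\<lambda>s. \<tau> s \<circ> \<sigma> s) U"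
  by (auto simp: relabelling_def relabel_def intro!: comp_inj_on)

lemma relabelling_subset: "relabelling \<sigma> U \<Longrightarrow> (\<And>s. A s |\<subseteq>| U s) \<Longrightarrow> relabelling \<sigma> A"
  unfolding relabelling_def by (meson inj_on_subset less_eq_fset.rep_eq)

lemma relabel_no_labels [simp]: "relabel \<sigma> no_labels = no_labels"
  by (simp add: relabel_def no_labels_def)

lemma relabelling_no_labels [simp]: "relabelling \<sigma> no_labels"
  by (simp add: relabelling_def no_labels_def)

lemma label_size_eq_0_iff: "label_size U = 0 \<longleftrightarrow> U = no_labels"
  by (auto simp: label_size_def no_labels_def fun_eq_iff fcard.rep_eq)

text \<open>With no label to move, every family of functions agrees with the identity.\<close>

lemma transport_no_labels:
  assumes "functorial F" "x \<in> structs F no_labels"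
  shows "transport F no_labels \<sigma> x = x"
proof -
  have "transport F no_labels \<sigma> x = transport F no_labels (\<lambda>s. id) x"
    by (rule functorial_cong[OF assms(1)]) (use assms(2) in \<open>auto simp: no_labels_def relabelling_def\<close>)
  then show ?thesis using functorial_id[OF assms] by simp
qed

section \<open>Splitting a label set in two\<close>

definition label_split :: "'s labels \<Rightarrow> 's labels \<Rightarrow> 's labels \<Rightarrow> bool" where
  "label_split U A B \<longleftrightarrow> (\<forall>s. A s |\<union>| B s = U s \<and> A s |\<inter>| B s = {||})"

lemma label_split_subset:
  assumes "label_split U A B" shows "A s |\<subseteq>| U s" "B s |\<subseteq>| U s"
  using assms unfolding label_split_def by blast+

lemma label_split_relabel:
  assumes "label_split U A B" "relabelling \<sigma> U"
  shows "label_split (relabel \<sigma> U) (relabel \<sigma> A) (relabel \<sigma> B)" "relabelling \<sigma> A" "relabelling \<sigma> B"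
proof -
  show "relabelling \<sigma> A" "relabelling \<sigma> B"
    using relabelling_subset[OF assms(2)] label_split_subset[OF assms(1)] by blast+
  show "label_split (relabel \<sigma> U) (relabel \<sigma> A) (relabel \<sigma> B)"
    unfolding label_split_def relabel_def
  proof (intro allI conjI)
    fix s
    have u: "A s |\<union>| B s = U s" "A s |\<inter>| B s = {||}" using assms(1) by (auto simp: label_split_def)
    show "\<sigma> s |`| A s |\<union>| \<sigma> s |`| B s = \<sigma> s |`| U s" using u by (metis fimage_funion)
    have "inj_on (\<sigma> s) (fset (U s))" using assms(2) by (simp add: relabelling_def)
    moreover have "fset (A s) \<subseteq> fset (U s)" "fset (B s) \<subseteq> fset (U s)"
      using label_split_subset[OF assms(1)] by (simp_all add: less_eq_fset.rep_eq)
    ultimately have "\<sigma> s ` fset (A s) \<inter> \<sigma> s ` fset (B s) = \<sigma> s ` (fset (A s) \<inter> fset (B s))"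
      using inj_on_image_Int by metis
    also have "fset (A s) \<inter> fset (B s) = {}" using u(2) by (metis bot_fset.rep_eq inf_fset.rep_eq)
    finally have "fset (\<sigma> s |`| A s |\<inter>| \<sigma> s |`| B s) = {}" by simp
    then show "\<sigma> s |`| A s |\<inter>| \<sigma> s |`| B s = {||}" by (metis bot_fset.rep_eq fset_inject)
  qed
qed

lemma label_split_iff:
  "label_split U A B \<longleftrightarrow>
    (\<forall>s a. (a |\<in>| U s \<longleftrightarrow> a |\<in>| A s \<or> a |\<in>| B s) \<and> \<not> (a |\<in>| A s \<and> a |\<in>| B s))"
  unfolding label_split_def fset_eq_iff by auto

lemma label_split_no_labels [simp]: "label_split U no_labels B \<longleftrightarrow> B = U"
  by (auto simp: label_split_def no_labels_def fun_eq_iff)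

lemma label_split_assoc:
  "label_split U AB C \<Longrightarrow> label_split AB A B \<Longrightarrow> label_split U A (\<lambda>s. B s |\<union>| C s)"
  "label_split U AB C \<Longrightarrow> label_split AB A B \<Longrightarrow> label_split (\<lambda>s. B s |\<union>| C s) B C"
  "label_split U A BC \<Longrightarrow> label_split BC B C \<Longrightarrow> label_split U (\<lambda>s. A s |\<union>| B s) C"
  "label_split U A BC \<Longrightarrow> label_split BC B C \<Longrightarrow> label_split (\<lambda>s. A s |\<union>| B s) A B"
  unfolding label_split_iff funion_iff by metis+

lemma label_split_eq_left: "label_split U A B \<Longrightarrow> label_split U A' B \<Longrightarrow> A = A'"
  unfolding label_split_def by (rule ext) blast

lemma label_size_split: "label_split U A B \<Longrightarrow> label_size U = label_size A + label_size B"
  unfolding label_split_def label_size_def sum.distrib[symmetric]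
  by (intro sum.cong refl) (metis fcard_funion_finter fcard_fempty add_0_right)

section \<open>Isomorphisms\<close>

lemma species_isoI:
  assumes "\<And>U \<sigma> x. relabelling \<sigma> U \<Longrightarrow> x \<in> structs F U
      \<Longrightarrow> \<phi> (relabel \<sigma> U) (transport F U \<sigma> x) = transport G U \<sigma> (\<phi> U x)"
    and "\<And>U. bij_betw (\<phi> U) (structs F U) (structs G U)"
  shows "species_iso F G"
  unfolding species_iso_def natural_def using assms by blast

lemma species_isoE:
  assumes "species_iso F G"
  obtains \<phi> where "natural F G \<phi>" "\<forall>U. bij_betw (\<phi> U) (structs F U) (structs G U)"
  using assms unfolding species_iso_def by blast

lemma naturalD:
  "natural F G \<phi> \<Longrightarrow> relabelling \<sigma> U \<Longrightarrow> x \<in> structs F U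
    \<Longrightarrow> \<phi> (relabel \<sigma> U) (transport F U \<sigma> x) = transport G U \<sigma> (\<phi> U x)"
  unfolding natural_def by blast

lemma species_iso_refl: "species_iso F F"
  by (rule species_isoI[where \<phi> = "\<lambda>U x. x"]) (auto simp: bij_betw_def)

lemma species_iso_trans [trans]:
  assumes "species_iso F G" "species_iso G K" shows "species_iso F K"
proof -
  obtain \<phi> where n\<phi>: "natural F G \<phi>" and b\<phi>: "\<forall>U. bij_betw (\<phi> U) (structs F U) (structs G U)"
    using species_isoE[OF assms(1)] .
  note \<phi> = naturalD[OF n\<phi>] b\<phi>[rule_format] b\<phi>[rule_format, THEN bij_betwE, rule_format]
  obtain \<psi> where n\<psi>: "natural G K \<psi>" and b\<psi>: "\<forall>U. bij_betw (\<psi> U) (structs G U) (structs K U)"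
    using species_isoE[OF assms(2)] .
  note \<psi> = naturalD[OF n\<psi>] b\<psi>[rule_format] b\<psi>[rule_format, THEN bij_betwE, rule_format]
  show ?thesis
  proof (rule species_isoI[where \<phi> = "\<lambda>U. \<psi> U \<circ> \<phi> U"])
    show "bij_betw (\<psi> U \<circ> \<phi> U) (structs F U) (structs K U)" for U
      using \<phi>(2) \<psi>(2) by (rule bij_betw_trans)
  qed (simp add: \<phi> \<psi>)
qed

text \<open>Naturality of the inverse at \<open>\<phi> U x\<close> requires the transport of
  \<open>x\<close> to be an \<open>F\<close>-structure again; this is where \<open>F\<close> has to
  be functorial.\<close>

lemma species_iso_sym:
  assumes "species_iso F G" "functorial F" shows "species_iso G F"
proof -
  obtain \<phi> where n\<phi>: "natural F G \<phi>" and b\<phi>: "\<forall>U. bij_betw (\<phi> U) (structs F U) (structs G U)"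
    using species_isoE[OF assms(1)] .
  note \<phi> = naturalD[OF n\<phi>] b\<phi>[rule_format] b\<phi>[rule_format, THEN bij_betwE, rule_format]
  show ?thesis
  proof (rule species_isoI[where \<phi> = "\<lambda>U. inv_into (structs F U) (\<phi> U)"])
    fix U \<sigma> y assume \<sigma>: "relabelling \<sigma> U" and y: "y \<in> structs G U"
    define x where "x = inv_into (structs F U) (\<phi> U) y"
    have x: "x \<in> structs F U" "\<phi> U x = y"
      using y \<phi>(2)[of U] unfolding x_def bij_betw_def by (auto intro: inv_into_into f_inv_into_f)
    have "transport G U \<sigma> y = \<phi> (relabel \<sigma> U) (transport F U \<sigma> x)" using \<phi>(1)[OF \<sigma> x(1)] x(2) by simp
    then show "inv_into (structs F (relabel \<sigma> U)) (\<phi> (relabel \<sigma> U)) (transport G U \<sigma> y)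
        = transport F U \<sigma> (inv_into (structs F U) (\<phi> U) y)"
      using functorial_closed[OF assms(2) \<sigma> x(1)] \<phi>(2)[of "relabel \<sigma> U"]
      unfolding x_def[symmetric] bij_betw_def by (simp add: inv_into_f_f)
  qed (rule bij_betw_inv_into[OF \<phi>(2)])
qed

lemma species_iso_bij: "species_iso F G \<Longrightarrow> \<exists>\<phi>. bij_betw \<phi> (structs F U) (structs G U)"
  unfolding species_iso_def by blast

lemma species_iso_card: "species_iso F G \<Longrightarrow> card (structs F U) = card (structs G U)"
  using species_iso_bij bij_betw_same_card by metis

lemma species_iso_finite: "species_iso F G \<Longrightarrow> finite (structs F U) \<longleftrightarrow> finite (structs G U)"
  using species_iso_bij bij_betw_finite by metis

lemma species_iso_empty: "species_iso F G \<Longrightarrow> structs F U = {} \<longleftrightarrow> structs G U = {}"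
  using species_iso_bij[of F G U] by (auto simp: bij_betw_def)

lemma species_iso_restrict:
  fixes F :: "('s::finite, 'a) species"
  assumes "species_iso F G"
  shows "species_iso (species_restrict p F) (species_restrict p G)"
proof -
  obtain \<phi> where n\<phi>: "natural F G \<phi>" and b\<phi>: "\<forall>U. bij_betw (\<phi> U) (structs F U) (structs G U)"
    using species_isoE[OF assms] .
  note \<phi> = naturalD[OF n\<phi>] b\<phi>[rule_format] b\<phi>[rule_format, THEN bij_betwE, rule_format]
  show ?thesis
    by (rule species_isoI[where \<phi> = \<phi>])
      (use \<phi> in \<open>auto simp: species_restrict_def bij_betw_def split: if_splits\<close>)
qed

lemma species_iso_identity:
  assumes "\<And>U. structs F U = structs G U"
    and "\<And>U \<sigma> x. relabelling \<sigma> U \<Longrightarrow> x \<in> structs F U \<Longrightarrow> transport F U \<sigma> x = transport G U \<sigma> x"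
  shows "species_iso F G"
  by (rule species_isoI[where \<phi> = "\<lambda>U x. x"]) (use assms in \<open>auto simp: bij_betw_def\<close>)

lemma contact_card: "contact p F G \<Longrightarrow> label_size U \<le> p \<Longrightarrow> card (structs (F i) U) = card (structs (G i) U)"
  using species_iso_card[of "species_restrict p (F i)" "species_restrict p (G i)" U]
  by (simp add: contact_def species_restrict_def)

lemma contact_finite:
  "contact p F G \<Longrightarrow> label_size U \<le> p \<Longrightarrow> finite (structs (F i) U) \<longleftrightarrow> finite (structs (G i) U)"
  using species_iso_finite[of "species_restrict p (F i)" "species_restrict p (G i)" U]
  by (simp add: contact_def species_restrict_def)

section \<open>Operations\<close>

lemma coded_iso: "species_iso (coded F) F" "species_iso F (coded F)"
proof -
  show "species_iso (coded F) F"
    by (rule species_isoI[where \<phi> = "\<lambda>U. from_nat"])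
      (auto simp: coded_def bij_betw_def inj_on_def image_image)
  show "species_iso F (coded F)"
    by (rule species_isoI[where \<phi> = "\<lambda>U. to_nat"])
      (auto simp: coded_def bij_betw_def inj_on_def)
qed

lemma functorial_coded: "functorial F \<Longrightarrow> functorial (coded F)"
  by (rule functorialI)
    (auto simp: coded_def functorial_closed functorial_id functorial_comp dest: functorial_cong)

lemma functorial_zero: "functorial species_zero"
  by (rule functorialI) (auto simp: species_zero_def)

lemma functorial_one: "functorial species_one"
  by (rule functorialI) (auto simp: species_one_def split: if_splits)

lemma functorial_atom: "functorial (species_atom s)"
proof (rule functorialI)
  fix U :: "'a labels" and \<sigma> x
  assume "x \<in> structs (species_atom s) U"
  then obtain a where "U = no_labels(s := {|a|})" "x = 0" by (auto simp: species_atom_def split: if_splits)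
  then have "relabel \<sigma> U = no_labels(s := {|\<sigma> s a|})"
    by (auto simp: relabel_def no_labels_def fun_eq_iff)
  then show "transport (species_atom s) U \<sigma> x \<in> structs (species_atom s) (relabel \<sigma> U)"
    using \<open>x = 0\<close> by (auto simp: species_atom_def)
qed (auto simp: species_atom_def)

lemma functorial_add: "functorial F \<Longrightarrow> functorial G \<Longrightarrow> functorial (species_add F G)"
  by (rule functorialI)
    (auto simp: species_add_def functorial_closed functorial_id functorial_comp elim!: PlusE intro: functorial_cong)

lemma functorial_Sum: "(\<And>i. functorial (F i)) \<Longrightarrow> functorial (species_Sum F)"
  by (rule functorialI)
    (auto simp: species_Sum_def functorial_closed functorial_id functorial_comp intro: functorial_cong)

lemma structs_mult:
  "structs (species_mult F G) U
   = {((A, x), (B, y)). label_split U A B \<and> x \<in> structs F A \<and> y \<in> structs G B}"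
  by (simp add: species_mult_def label_split_def)

lemma transport_mult [simp]:
  "transport (species_mult F G) U \<sigma> ((A, x), (B, y))
   = ((relabel \<sigma> A, transport F A \<sigma> x), (relabel \<sigma> B, transport G B \<sigma> y))"
  by (simp add: species_mult_def)

lemma functorial_mult:
  assumes F: "functorial F" and G: "functorial G"
  shows "functorial (species_mult F G)"
proof (rule functorialI)
  fix U \<sigma> p assume \<sigma>: "relabelling \<sigma> U" and p: "p \<in> structs (species_mult F G) U"
  then obtain A x B y where p: "p = ((A, x), (B, y))" "label_split U A B" "x \<in> structs F A" "y \<in> structs G B"
    by (auto simp: structs_mult)
  note sp = label_split_relabel[OF p(2) \<sigma>]
  show "transport (species_mult F G) U \<sigma> p \<in> structs (species_mult F G) (relabel \<sigma> U)"
    using p sp F G by (auto simp: structs_mult functorial_closed)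
  show "transport (species_mult F G) U \<sigma> p = transport (species_mult F G) U \<sigma>' p"
    if e: "\<forall>s a. a |\<in>| U s \<longrightarrow> \<sigma> s a = \<sigma>' s a" for \<sigma>'
  proof -
    have e': "\<forall>s a. a |\<in>| A s \<longrightarrow> \<sigma> s a = \<sigma>' s a" "\<forall>s a. a |\<in>| B s \<longrightarrow> \<sigma> s a = \<sigma>' s a"
      using e label_split_subset[OF p(2)] by blast+
    show ?thesis
      using p sp functorial_cong[OF F sp(2) e'(1)] functorial_cong[OF G sp(3) e'(2)]
        relabel_cong[OF e'(1)] relabel_cong[OF e'(2)] by simp
  qed
  show "transport (species_mult F G) U (\<lambda>s. \<tau> s \<circ> \<sigma> s) p
      = transport (species_mult F G) (relabel \<sigma> U) \<tau> (transport (species_mult F G) U \<sigma> p)"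
    if \<tau>: "relabelling \<tau> (relabel \<sigma> U)" for \<tau>
    using p sp label_split_relabel[OF sp(1) \<tau>]
    by (simp add: functorial_comp[OF F] functorial_comp[OF G] relabel_relabel)
qed (auto simp: structs_mult functorial_id[OF F] functorial_id[OF G])

lemma species_add_cong:
  assumes "species_iso F F'" "species_iso G G'"
  shows "species_iso (species_add F G) (species_add F' G')"
proof -
  obtain \<phi> where n\<phi>: "natural F F' \<phi>" and b\<phi>: "\<forall>U. bij_betw (\<phi> U) (structs F U) (structs F' U)"
    using species_isoE[OF assms(1)] .
  note \<phi> = naturalD[OF n\<phi>] b\<phi>[rule_format] b\<phi>[rule_format, THEN bij_betwE, rule_format]
  obtain \<psi> where n\<psi>: "natural G G' \<psi>" and b\<psi>: "\<forall>U. bij_betw (\<psi> U) (structs G U) (structs G' U)"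
    using species_isoE[OF assms(2)] .
  note \<psi> = naturalD[OF n\<psi>] b\<psi>[rule_format] b\<psi>[rule_format, THEN bij_betwE, rule_format]
  show ?thesis
  proof (rule species_isoI[where \<phi> = "\<lambda>U. map_sum (\<phi> U) (\<psi> U)"])
    show "bij_betw (map_sum (\<phi> U) (\<psi> U)) (structs (species_add F G) U) (structs (species_add F' G') U)" for U
    proof (rule bij_betw_byWitness[where f' = "map_sum (inv_into (structs F U) (\<phi> U)) (inv_into (structs G U) (\<psi> U))"])
    qed (use \<phi>(2)[THEN bij_betwE] \<phi>(2)[THEN bij_betw_inv_into, THEN bij_betwE]
        \<psi>(2)[THEN bij_betwE] \<psi>(2)[THEN bij_betw_inv_into, THEN bij_betwE]
        in \<open>auto simp: species_add_def bij_betw_inv_into_left[OF \<phi>(2)] bij_betw_inv_into_right[OF \<phi>(2)]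
          bij_betw_inv_into_left[OF \<psi>(2)] bij_betw_inv_into_right[OF \<psi>(2)]\<close>)
  qed (use \<phi>(1) \<psi>(1) in \<open>auto simp: species_add_def\<close>)
qed

lemma species_Sum_cong:
  assumes "\<And>i. species_iso (F i) (F' i)"
  shows "species_iso (species_Sum F) (species_Sum F')"
proof -
  have "\<forall>i. \<exists>\<phi>. natural (F i) (F' i) \<phi> \<and> (\<forall>U. bij_betw (\<phi> U) (structs (F i) U) (structs (F' i) U))"
    using assms unfolding species_iso_def by blast
  then obtain \<phi> where \<phi>: "\<And>i. natural (F i) (F' i) (\<phi> i)"
    "\<And>i U. bij_betw (\<phi> i U) (structs (F i) U) (structs (F' i) U)" by metis
  show ?thesis
  proof (rule species_isoI[where \<phi> = "\<lambda>U (i, x). (i, \<phi> i U x)"])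
    show "bij_betw (\<lambda>(i, x). (i, \<phi> i U x)) (structs (species_Sum F) U) (structs (species_Sum F') U)" for U
    proof (rule bij_betw_byWitness[where f' = "\<lambda>(i, x). (i, inv_into (structs (F i) U) (\<phi> i U) x)"])
    qed (use \<phi>(2)[THEN bij_betwE] \<phi>(2)[THEN bij_betw_inv_into, THEN bij_betwE]
        in \<open>auto simp: species_Sum_def bij_betw_inv_into_left[OF \<phi>(2)] bij_betw_inv_into_right[OF \<phi>(2)]\<close>)
  qed (use \<phi>(1) in \<open>auto simp: species_Sum_def natural_def\<close>)
qed

lemma species_mult_cong:
  assumes "species_iso F F'" "species_iso G G'"
  shows "species_iso (species_mult F G) (species_mult F' G')"
proof -
  obtain \<phi> where n\<phi>: "natural F F' \<phi>" and b\<phi>: "\<forall>U. bij_betw (\<phi> U) (structs F U) (structs F' U)"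
    using species_isoE[OF assms(1)] .
  note \<phi> = naturalD[OF n\<phi>] b\<phi>[rule_format] b\<phi>[rule_format, THEN bij_betwE, rule_format]
  obtain \<psi> where n\<psi>: "natural G G' \<psi>" and b\<psi>: "\<forall>U. bij_betw (\<psi> U) (structs G U) (structs G' U)"
    using species_isoE[OF assms(2)] .
  note \<psi> = naturalD[OF n\<psi>] b\<psi>[rule_format] b\<psi>[rule_format, THEN bij_betwE, rule_format]
  show ?thesis
  proof (rule species_isoI[where \<phi> = "\<lambda>U ((A, x), (B, y)). ((A, \<phi> A x), (B, \<psi> B y))"])
    show "bij_betw (\<lambda>((A, x), (B, y)). ((A, \<phi> A x), (B, \<psi> B y)))
        (structs (species_mult F G) U) (structs (species_mult F' G') U)" for U
    proof (rule bij_betw_byWitness[where f' = "\<lambda>((A, x), (B, y)).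
          ((A, inv_into (structs F A) (\<phi> A) x), (B, inv_into (structs G B) (\<psi> B) y))"])
    qed (use \<phi>(2)[THEN bij_betwE] \<phi>(2)[THEN bij_betw_inv_into, THEN bij_betwE]
        \<psi>(2)[THEN bij_betwE] \<psi>(2)[THEN bij_betw_inv_into, THEN bij_betwE]
        in \<open>auto simp: structs_mult bij_betw_inv_into_left[OF \<phi>(2)] bij_betw_inv_into_right[OF \<phi>(2)]
          bij_betw_inv_into_left[OF \<psi>(2)] bij_betw_inv_into_right[OF \<psi>(2)]\<close>)
  qed (auto simp: structs_mult dest: label_split_relabel intro!: \<phi>(1) \<psi>(1))
qed

text \<open>Associativity for row times matrix times column. Distributivity and the exchange of the
  two sums are absorbed into one bijection, which loses nothing because an intermediate label set is
  the union of its two parts.\<close>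

lemma species_mult_Sum_assoc:
  fixes A :: "'j \<Rightarrow> ('s, 'a) species" and B :: "'j \<Rightarrow> 'l \<Rightarrow> ('s, 'b) species" and C :: "'l \<Rightarrow> ('s, 'c) species"
  shows "species_iso (species_Sum (\<lambda>l. species_mult (species_Sum (\<lambda>j. species_mult (A j) (B j l))) (C l)))
     (species_Sum (\<lambda>j. species_mult (A j) (species_Sum (\<lambda>l. species_mult (B j l) (C l)))))"
proof (rule species_isoI[where \<phi> = "\<lambda>U (l, ((AB, (j, ((A, a), (B, b)))), (C, c))).
    (j, ((A, a), ((\<lambda>s. B s |\<union>| C s), (l, ((B, b), (C, c))))))"])
  let ?L = "species_Sum (\<lambda>l. species_mult (species_Sum (\<lambda>j. species_mult (A j) (B j l))) (C l))"
  let ?R = "species_Sum (\<lambda>j. species_mult (A j) (species_Sum (\<lambda>l. species_mult (B j l) (C l))))"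
  show "bij_betw (\<lambda>(l, ((AB, (j, ((A, a), (B, b)))), (C, c))).
      (j, ((A, a), ((\<lambda>s. B s |\<union>| C s), (l, ((B, b), (C, c)))))))
      (structs ?L U) (structs ?R U)" for U
  proof (rule bij_betw_byWitness[where f' = "\<lambda>(j, ((A, a), (BC, (l, ((B, b), (C, c)))))).
      (l, (((\<lambda>s. A s |\<union>| B s), (j, ((A, a), (B, b)))), (C, c)))"])
    show "\<forall>x\<in>structs ?L U. (\<lambda>(j, ((A, a), (BC, (l, ((B, b), (C, c)))))).
        (l, (((\<lambda>s. A s |\<union>| B s), (j, ((A, a), (B, b)))), (C, c))))
        ((\<lambda>(l, ((AB, (j, ((A, a), (B, b)))), (C, c))).
        (j, ((A, a), ((\<lambda>s. B s |\<union>| C s), (l, ((B, b), (C, c))))))) x) = x"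
      by (auto simp: species_Sum_def structs_mult label_split_def fun_eq_iff)
    show "\<forall>x\<in>structs ?R U. (\<lambda>(l, ((AB, (j, ((A, a), (B, b)))), (C, c))).
        (j, ((A, a), ((\<lambda>s. B s |\<union>| C s), (l, ((B, b), (C, c)))))))
        ((\<lambda>(j, ((A, a), (BC, (l, ((B, b), (C, c)))))).
        (l, (((\<lambda>s. A s |\<union>| B s), (j, ((A, a), (B, b)))), (C, c)))) x) = x"
      by (auto simp: species_Sum_def structs_mult label_split_def fun_eq_iff)
  qed (auto simp: species_Sum_def structs_mult dest: label_split_assoc)
next
  fix U \<sigma> x
  show "(\<lambda>(l, ((AB, (j, ((A, a), (B, b)))), (C, c))).
      (j, ((A, a), ((\<lambda>s. B s |\<union>| C s), (l, ((B, b), (C, c)))))))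
      (transport (species_Sum (\<lambda>l. species_mult (species_Sum (\<lambda>j. species_mult (A j) (B j l))) (C l))) U \<sigma> x)
    = transport (species_Sum (\<lambda>j. species_mult (A j) (species_Sum (\<lambda>l. species_mult (B j l) (C l))))) U \<sigma>
      ((\<lambda>(l, ((AB, (j, ((A, a), (B, b)))), (C, c))).
      (j, ((A, a), ((\<lambda>s. B s |\<union>| C s), (l, ((B, b), (C, c))))))) x)"
    by (auto simp: species_Sum_def relabel_def fimage_funion split: prod.split)
qed

text \<open>A product distributes over a sum of any index type, since a structure of the sum carries
  its index. This turns the sum of the Jacobian powers, applied to a vector, into the sum of the
  powers applied to it.\<close>

lemma species_mult_Sum_swap:
  fixes A :: "'j \<Rightarrow> 'k \<Rightarrow> ('s, 'a) species" and C :: "'j \<Rightarrow> ('s, 'c) species"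
  shows "species_iso (species_Sum (\<lambda>j. species_mult (species_Sum (A j)) (C j)))
     (species_Sum (\<lambda>k. species_Sum (\<lambda>j. species_mult (A j k) (C j))))"
proof (rule species_isoI[where \<phi> = "\<lambda>U (j, ((A, (k, a)), (C, c))). (k, (j, ((A, a), (C, c))))"])
  show "bij_betw (\<lambda>(j, ((A, (k, a)), (C, c))). (k, (j, ((A, a), (C, c)))))
      (structs (species_Sum (\<lambda>j. species_mult (species_Sum (A j)) (C j))) U)
      (structs (species_Sum (\<lambda>k. species_Sum (\<lambda>j. species_mult (A j k) (C j)))) U)" for U
  proof (rule bij_betw_byWitness[where f' = "\<lambda>(k, (j, ((A, a), (C, c)))). (j, ((A, (k, a)), (C, c)))"])
  qed (auto simp: species_Sum_def structs_mult)
qed (auto simp: species_Sum_def structs_mult)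

lemma species_mult_one_Sum:
  "species_iso (species_Sum (\<lambda>j. species_mult (mat_one i j) (C j))) (C i)"
proof (rule species_isoI[where \<phi> = "\<lambda>U (j, ((A, a), (B, b))). b"])
  have *: "(j, ((A, a), (B, b))) \<in> structs (species_Sum (\<lambda>j. species_mult (mat_one i j) (C j))) U
      \<longleftrightarrow> j = i \<and> A = no_labels \<and> a = 0 \<and> B = U \<and> b \<in> structs (C i) U" for U j A a B b
    by (auto simp: species_Sum_def structs_mult mat_one_def species_one_def species_zero_def
        split: if_splits)
  show "bij_betw (\<lambda>(j, ((A, a), (B, b))). b)
      (structs (species_Sum (\<lambda>j. species_mult (mat_one i j) (C j))) U) (structs (C i) U)" for U
    by (rule bij_betw_byWitness[where f' = "\<lambda>b. (i, ((no_labels, 0), (U, b)))"]) (auto simp: *)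
  fix U \<sigma> x assume x: "x \<in> structs (species_Sum (\<lambda>j. species_mult (mat_one i j) (C j))) U"
  obtain j A a B b where "x = (j, ((A, a), (B, b)))" by (metis surj_pair)
  with x show "(\<lambda>(j, ((A, a), (B, b))). b)
      (transport (species_Sum (\<lambda>j. species_mult (mat_one i j) (C j))) U \<sigma> x)
      = transport (C i) U \<sigma> ((\<lambda>(j, ((A, a), (B, b))). b) x)"
    by (simp add: *) (simp add: species_Sum_def)
qed

section \<open>Cancellation and differences\<close>

text \<open>
  From \<open>d\<close>, follow \<open>\<alpha>\<close> through \<open>F\<close> until it leaves \<open>F\<close>. This cancels \<open>F\<close> without any choice, hence
  compatibly with relabelling.
\<close>

definition chase :: "('a + 'b \<Rightarrow> 'a + 'c) \<Rightarrow> 'a set \<Rightarrow> 'b \<Rightarrow> 'c \<Rightarrow> bool" where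
  "chase \<alpha> F d d' \<longleftrightarrow> \<alpha> (Inr d) = Inr d' \<or>
     (\<exists>z z'. \<alpha> (Inr d) = Inl z \<and> (z, z') \<in> {(z, z'). z \<in> F \<and> \<alpha> (Inl z) = Inl z'}\<^sup>* \<and> z' \<in> F \<and> \<alpha> (Inl z') = Inr d')"

text \<open>A chain that starts at an element of \<open>D\<close> cannot come back to its first
  point in \<open>F\<close>, whose preimage is already taken by that element; as \<open>F\<close> is
  finite, the chain has to leave it. Read backwards, the same remark shows that two chains with a
  common exit have a common start.\<close>

lemma chase_bij:
  assumes \<alpha>: "bij_betw \<alpha> (F <+> D) (F <+> D')" and F: "finite F"
  shows "\<forall>d\<in>D. \<exists>!d'. chase \<alpha> F d d'"
    and "\<And>d d'. d \<in> D \<Longrightarrow> chase \<alpha> F d d' \<Longrightarrow> d' \<in> D'"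
    and "\<And>d\<^sub>1 d\<^sub>2 d'. d\<^sub>1 \<in> D \<Longrightarrow> d\<^sub>2 \<in> D \<Longrightarrow> chase \<alpha> F d\<^sub>1 d' \<Longrightarrow> chase \<alpha> F d\<^sub>2 d' \<Longrightarrow> d\<^sub>1 = d\<^sub>2"
proof -
  define R where "R = {(z, z'). z \<in> F \<and> \<alpha> (Inl z) = Inl z'}"
  have chase: "chase \<alpha> F d d' \<longleftrightarrow> \<alpha> (Inr d) = Inr d' \<or>
     (\<exists>z z'. \<alpha> (Inr d) = Inl z \<and> (z, z') \<in> R\<^sup>* \<and> z' \<in> F \<and> \<alpha> (Inl z') = Inr d')" for d d'
    unfolding chase_def R_def ..
  have inj: "inj_on \<alpha> (F <+> D)" and im: "\<And>x. x \<in> F <+> D \<Longrightarrow> \<alpha> x \<in> F <+> D'"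
    using \<alpha> by (auto simp: bij_betw_def)
  have injL: "z = w" if "z \<in> F" "w \<in> F" "\<alpha> (Inl z) = \<alpha> (Inl w)" for z w
    using inj that by (auto simp: inj_on_def)
  have injR: "d = e" if "d \<in> D" "e \<in> D" "\<alpha> (Inr d) = \<alpha> (Inr e)" for d e
    using inj that by (auto simp: inj_on_def)
  have injLR: False if "z \<in> F" "d \<in> D" "\<alpha> (Inl z) = \<alpha> (Inr d)" for z d
    using inj_onD[OF inj that(3)] that by auto
  have sv: "single_valued R" and svc: "single_valued (R\<inverse>)"
    using injL by (auto simp: single_valued_def R_def)
  have RF: "z' \<in> F" if "(z, z') \<in> R\<^sup>*" "z \<in> F" for z z'
    using that by (induction) (use im in \<open>force simp: R_def\<close>)+
  have start: "z \<in> F" if "d \<in> D" "\<alpha> (Inr d) = Inl z" for d z using im[of "Inr d"] that by auto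
  have no_pred: "(w, z) \<notin> R" if "d \<in> D" "\<alpha> (Inr d) = Inl z" for d w z
    using injLR[OF _ that(1)] that(2) by (auto simp: R_def)
  have exits_unique: "z\<^sub>1 = z\<^sub>2"
    if "(z, z\<^sub>1) \<in> R\<^sup>*" "(z, z\<^sub>2) \<in> R\<^sup>*" "\<alpha> (Inl z\<^sub>1) = Inr d\<^sub>1" "\<alpha> (Inl z\<^sub>2) = Inr d\<^sub>2" for z z\<^sub>1 z\<^sub>2 d\<^sub>1 d\<^sub>2
  proof -
    have stop: "a = b" if "(a, b) \<in> R\<^sup>*" "\<alpha> (Inl a) = Inr e" for a b e
      using that by (auto simp: R_def elim: converse_rtranclE)
    show ?thesis
      using single_valued_confluent[OF sv that(1,2)] stop that(3,4) by metis
  qed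
  show "\<forall>d\<in>D. \<exists>!d'. chase \<alpha> F d d'"
  proof
    fix d assume d: "d \<in> D"
    have ex: "\<exists>d'. chase \<alpha> F d d'"
    proof (cases "\<alpha> (Inr d)")
      case (Inl z)
      show ?thesis
      proof (rule ccontr)
        assume no: "\<not> ?thesis"
        \<comment> \<open>If the chain never left \<open>F\<close>, then \<alpha> would map its
          orbit \<open>Z\<close> injectively into itself, hence onto itself, and the first point
          would have a predecessor in \<open>F\<close>.\<close>
        define Z where "Z = {w. (z, w) \<in> R\<^sup>*}"
        have ZF: "Z \<subseteq> F" using RF start[OF d Inl] by (auto simp: Z_def)
        have "\<exists>w'. \<alpha> (Inl w) = Inl w'" if "w \<in> Z" for w
          using no Inl that ZF unfolding chase Z_def by (cases "\<alpha> (Inl w)") auto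
        then obtain g where g: "\<And>w. w \<in> Z \<Longrightarrow> \<alpha> (Inl w) = Inl (g w)" by metis
        have gZ: "g ` Z \<subseteq> Z"
          using g ZF by (auto simp: Z_def R_def intro: rtrancl_into_rtrancl)
        have "inj_on g Z" by (intro inj_onI) (metis g injL ZF subsetD)
        then have "g ` Z = Z" using gZ finite_subset[OF ZF F] by (simp add: endo_inj_surj)
        moreover have "z \<in> Z" by (simp add: Z_def)
        ultimately have "z \<in> g ` Z" by simp
        then obtain w where "w \<in> Z" "g w = z" by blast
        then show False using g[of w] ZF no_pred[OF d Inl, of w] by (auto simp: R_def)
      qed
    qed (auto simp: chase)
    have "d\<^sub>1 = d\<^sub>2" if "chase \<alpha> F d d\<^sub>1" "chase \<alpha> F d d\<^sub>2" for d\<^sub>1 d\<^sub>2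
      using that exits_unique unfolding chase by (metis Inl_Inr_False Inl_inject Inr_inject)
    with ex show "\<exists>!d'. chase \<alpha> F d d'" by blast
  qed
  show "d' \<in> D'" if "d \<in> D" "chase \<alpha> F d d'" for d d'
    using that(2) unfolding chase
  proof
    assume "\<alpha> (Inr d) = Inr d'" then show ?thesis using im[of "Inr d"] that(1) by auto
  next
    assume "\<exists>z z'. \<alpha> (Inr d) = Inl z \<and> (z, z') \<in> R\<^sup>* \<and> z' \<in> F \<and> \<alpha> (Inl z') = Inr d'"
    then obtain z' where "z' \<in> F" "\<alpha> (Inl z') = Inr d'" by blast
    then show ?thesis using im[of "Inl z'"] by auto
  qed
  show "d\<^sub>1 = d\<^sub>2" if d: "d\<^sub>1 \<in> D" "d\<^sub>2 \<in> D" and c: "chase \<alpha> F d\<^sub>1 d'" "chase \<alpha> F d\<^sub>2 d'" for d\<^sub>1 d\<^sub>2 d'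
  proof (cases "\<alpha> (Inr d\<^sub>1) = Inr d' \<or> \<alpha> (Inr d\<^sub>2) = Inr d'")
    case True
    then show ?thesis using c injR[OF d] injLR[OF _ d(1)] injLR[OF _ d(2)] unfolding chase by metis
  next
    case False
    then obtain z\<^sub>1 z\<^sub>2 w\<^sub>1 w\<^sub>2 where z: "\<alpha> (Inr d\<^sub>1) = Inl z\<^sub>1" "\<alpha> (Inr d\<^sub>2) = Inl z\<^sub>2" "(z\<^sub>1, w\<^sub>1) \<in> R\<^sup>*" "(z\<^sub>2, w\<^sub>2) \<in> R\<^sup>*"
      "w\<^sub>1 \<in> F" "w\<^sub>2 \<in> F" "\<alpha> (Inl w\<^sub>1) = Inr d'" "\<alpha> (Inl w\<^sub>2) = Inr d'"
      using c unfolding chase by metis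
    then have w: "w\<^sub>2 = w\<^sub>1" using injL by metis
    \<comment> \<open>The converse relation is single-valued too, so of the two starting points one
      lies behind the other; neither has a predecessor, so they coincide.\<close>
    then have "(w\<^sub>1, z\<^sub>1) \<in> (R\<inverse>)\<^sup>*" "(w\<^sub>1, z\<^sub>2) \<in> (R\<inverse>)\<^sup>*" using z by (auto simp: rtrancl_converse)
    then have "(z\<^sub>1, z\<^sub>2) \<in> (R\<inverse>)\<^sup>* \<or> (z\<^sub>2, z\<^sub>1) \<in> (R\<inverse>)\<^sup>*" by (rule single_valued_confluent[OF svc])
    then have "z\<^sub>1 = z\<^sub>2"
      by (metis converse_iff converse_rtranclE no_pred d z(1,2))
    then show ?thesis using z injR[OF d] by metis
  qed
qed

text \<open>The chase is determined by \<alpha>, so it inherits the naturality of \<alpha>.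
  Arbitrary bijections between the equinumerous sets \<open>structs D U\<close> and
  \<open>structs D' U\<close> would not commute with relabelling.\<close>

lemma species_add_cancel:
  assumes iso: "species_iso (species_add F D) (species_add F D')"
    and F: "is_species F" and D: "is_species D"
  shows "species_iso D D'"
proof -
  obtain \<alpha> where n\<alpha>: "natural (species_add F D) (species_add F D') \<alpha>"
    and b\<alpha>: "\<forall>U. bij_betw (\<alpha> U) (structs (species_add F D) U) (structs (species_add F D') U)"
    using species_isoE[OF iso] .
  have fin: "finite (structs F U)" "finite (structs D U)" for U
    using F D by (auto simp: is_species_iff_functorial)
  have fct: "functorial F" "functorial D" using F D by (auto simp: is_species_iff_functorial)
  have bij: "bij_betw (\<alpha> U) (structs F U <+> structs D U) (structs F U <+> structs D' U)" for U
    using b\<alpha> by (simp add: species_add_def)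
  have nL: "\<alpha> (relabel \<sigma> U) (Inl (transport F U \<sigma> x)) = map_sum (transport F U \<sigma>) (transport D' U \<sigma>) (\<alpha> U (Inl x))"
    if "relabelling \<sigma> U" "x \<in> structs F U" for U \<sigma> x
    using naturalD[OF n\<alpha> that(1), of "Inl x"] that(2) by (auto simp: species_add_def)
  have nR: "\<alpha> (relabel \<sigma> U) (Inr (transport D U \<sigma> x)) = map_sum (transport F U \<sigma>) (transport D' U \<sigma>) (\<alpha> U (Inr x))"
    if "relabelling \<sigma> U" "x \<in> structs D U" for U \<sigma> x
    using naturalD[OF n\<alpha> that(1), of "Inr x"] that(2) by (auto simp: species_add_def)
  define \<phi> where "\<phi> U d = (THE d'. chase (\<alpha> U) (structs F U) d d')" for U d
  have \<phi>: "chase (\<alpha> U) (structs F U) d (\<phi> U d)" if "d \<in> structs D U" for U d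
    using chase_bij(1)[OF bij fin(1), of U] that unfolding \<phi>_def by (metis theI')
  have \<phi>_eq: "\<phi> U d = d'" if "d \<in> structs D U" "chase (\<alpha> U) (structs F U) d d'" for U d d'
    using chase_bij(1)[OF bij fin(1), of U] that \<phi> by metis
  show ?thesis
  proof (rule species_isoI[where \<phi> = \<phi>])
    fix U
    have "inj_on (\<phi> U) (structs D U)"
      using chase_bij(3)[OF bij fin(1), of _ U] \<phi> by (metis inj_onI)
    moreover have sub: "\<phi> U ` structs D U \<subseteq> structs D' U"
      using chase_bij(2)[OF bij fin(1), of _ U] \<phi> by blast
    \<comment> \<open>Surjectivity follows by counting: the two sums have the same finite
      cardinality and the summand \<open>F\<close> in common.\<close>
    moreover have "card (structs D' U) = card (structs D U)" "finite (structs D' U)"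
    proof -
      have "finite (structs F U <+> structs D U)" using fin by simp
      then have f: "finite (structs F U <+> structs D' U)" using bij_betw_finite[OF bij] by blast
      then show "finite (structs D' U)" by (simp add: finite_Plus_iff)
      then show "card (structs D' U) = card (structs D U)"
        using bij_betw_same_card[OF bij, of U] fin[of U] by (simp add: card_Plus)
    qed
    ultimately show "bij_betw (\<phi> U) (structs D U) (structs D' U)"
      unfolding bij_betw_def by (metis card_image card_subset_eq)
  next
    fix U \<sigma> d assume \<sigma>: "relabelling \<sigma> U" and d: "d \<in> structs D U"
    \<comment> \<open>Relabelling carries a chain of \<alpha> at \<open>U\<close> to a chain of
      \<alpha> at the relabelled set, with the corresponding exit.\<close>
    have step: "(transport F U \<sigma> z, transport F U \<sigma> z') \<in>
        {(z, z'). z \<in> structs F (relabel \<sigma> U) \<and> \<alpha> (relabel \<sigma> U) (Inl z) = Inl z'}\<^sup>*"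
      if "(z, z') \<in> {(z, z'). z \<in> structs F U \<and> \<alpha> U (Inl z) = Inl z'}\<^sup>*" for z z'
      using that
    proof induction
      case (step y w)
      then have "(transport F U \<sigma> y, transport F U \<sigma> w) \<in>
          {(z, z'). z \<in> structs F (relabel \<sigma> U) \<and> \<alpha> (relabel \<sigma> U) (Inl z) = Inl z'}"
        using nL[OF \<sigma>, of y] functorial_closed[OF fct(1) \<sigma>] by auto
      with step.IH show ?case by (rule rtrancl_into_rtrancl)
    qed simp
    have "chase (\<alpha> (relabel \<sigma> U)) (structs F (relabel \<sigma> U)) (transport D U \<sigma> d) (transport D' U \<sigma> (\<phi> U d))"
    proof -
      consider "\<alpha> U (Inr d) = Inr (\<phi> U d)"
        | z z' where "\<alpha> U (Inr d) = Inl z" "(z, z') \<in> {(z, z'). z \<in> structs F U \<and> \<alpha> U (Inl z) = Inl z'}\<^sup>*"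
          "z' \<in> structs F U" "\<alpha> U (Inl z') = Inr (\<phi> U d)"
        using \<phi>[OF d] unfolding chase_def by blast
      then show ?thesis
      proof cases
        case 1
        then show ?thesis using nR[OF \<sigma> d] by (simp add: chase_def)
      next
        case 2
        then show ?thesis
          unfolding chase_def
          using nR[OF \<sigma> d] nL[OF \<sigma>, of z'] step[of z z'] functorial_closed[OF fct(1) \<sigma>, of z']
          by (intro disjI2 exI[of _ "transport F U \<sigma> z"] exI[of _ "transport F U \<sigma> z'"]) simp
      qed
    qed
    then show "\<phi> (relabel \<sigma> U) (transport D U \<sigma> d) = transport D' U \<sigma> (\<phi> U d)"
      using \<phi>_eq functorial_closed[OF fct(2) \<sigma> d] by blast
  qed
qed

text \<open>By cancellation any two complements of \<open>F\<close> in \<open>G\<close> are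
  isomorphic, so one known complement identifies the chosen one. \<open>D\<close> has structures of
  the type of those of \<open>G\<close>, since that is the type over which the choice
  ranges.\<close>

lemma species_diff_iso:
  fixes G :: "('s, 'b) species"
  assumes iso: "species_iso G (species_add F D)" and D: "is_species (D :: ('s, 'b) species)"
    and F: "is_species F" and G: "functorial G"
  shows "is_species (species_diff G F)" "species_iso (species_diff G F) D"
proof -
  have d: "is_species (species_diff G F) \<and> species_iso G (species_add F (species_diff G F))"
    unfolding species_diff_def by (rule someI[of _ D]) (use iso D in blast)
  then show "is_species (species_diff G F)" by blast
  have "species_iso (species_add F (species_diff G F)) (species_add F D)"
    using species_iso_trans[OF species_iso_sym[OF _ G] iso] d by blast
  then show "species_iso (species_diff G F) D"
    using species_add_cancel F d by blast
qed

section \<open>Derivatives and assemblies\<close>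

lemma mem_add_star: "a |\<in>| add_star s U t \<longleftrightarrow> (if t = s then a = 0 \<or> (\<exists>b. a = Suc b \<and> b |\<in>| U s) else a |\<in>| U t)"
  by (auto simp: add_star_def)

lemma relabel_add_star: "relabel (lift_star s \<sigma>) (add_star s U) = add_star s (relabel \<sigma> U)"
  by (auto simp: relabel_def lift_star_def add_star_def fun_eq_iff fset.map_comp comp_def)

lemma relabelling_lift_star: "relabelling \<sigma> U \<Longrightarrow> relabelling (lift_star s \<sigma>) (add_star s U)"
  by (auto simp: relabelling_def lift_star_def add_star_def inj_on_def)

lemma lift_star_id: "lift_star s (\<lambda>s. id) = (\<lambda>s. id)"
  by (auto simp: lift_star_def fun_eq_iff split: nat.split)

lemma lift_star_comp: "lift_star s (\<lambda>t. \<tau> t \<circ> \<sigma> t) = (\<lambda>t. lift_star s \<tau> t \<circ> lift_star s \<sigma> t)"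
  by (auto simp: lift_star_def fun_eq_iff split: nat.split)

lemma is_species_deriv:
  assumes "is_species F" shows "is_species (species_deriv s F)"
proof -
  have F: "functorial F" and fin: "\<And>U. finite (structs F U)"
    using assms by (auto simp: is_species_iff_functorial)
  have "functorial (species_deriv s F)"
  proof (rule functorialI)
    fix U \<sigma> x assume \<sigma>: "relabelling \<sigma> U" and x: "x \<in> structs (species_deriv s F) U"
    then have x': "x \<in> structs F (add_star s U)" by (simp add: species_deriv_def)
    note l = relabelling_lift_star[OF \<sigma>, of s]
    show "transport (species_deriv s F) U \<sigma> x \<in> structs (species_deriv s F) (relabel \<sigma> U)"
      using functorial_closed[OF F l x'] by (simp add: species_deriv_def relabel_add_star)
    show "transport (species_deriv s F) U \<sigma> x = transport (species_deriv s F) U \<sigma>' x"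
      if "\<forall>s a. a |\<in>| U s \<longrightarrow> \<sigma> s a = \<sigma>' s a" for \<sigma>'
    proof -
      have "\<forall>t a. a |\<in>| add_star s U t \<longrightarrow> lift_star s \<sigma> t a = lift_star s \<sigma>' t a"
        using that by (auto simp: mem_add_star lift_star_def)
      then show ?thesis using functorial_cong[OF F l _ x'] by (simp add: species_deriv_def)
    qed
    show "transport (species_deriv s F) U (\<lambda>s. \<tau> s \<circ> \<sigma> s) x
        = transport (species_deriv s F) (relabel \<sigma> U) \<tau> (transport (species_deriv s F) U \<sigma> x)"
      if "relabelling \<tau> (relabel \<sigma> U)" for \<tau>
      using functorial_comp[OF F l _ x', of "lift_star s \<tau>"] relabelling_lift_star[OF that, of s]
      by (simp add: species_deriv_def relabel_add_star lift_star_comp)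
  qed (simp add: species_deriv_def lift_star_id functorial_id[OF F])
  then show ?thesis by (simp add: is_species_iff_functorial fin species_deriv_def)
qed

section \<open>Blocks and the labels in them\<close>

lemma mem_block_labels: "a |\<in>| block_labels bl t \<longleftrightarrow> a < length (bl t)"
  by (simp add: block_labels_def standard_labels_def fset_of_list_elem)

lemma fset_block_labels: "fset (block_labels bl t) = {..<length (bl t)}"
  by (auto simp: mem_block_labels)

lemma block_labels_cong: "(\<And>t. length (bl t) = length (bl' t)) \<Longrightarrow> block_labels bl = block_labels bl'"
  by (simp add: block_labels_def)

text \<open>Blocks are counted with their positions. That a label lies in exactly one block becomes
  the equation \<open>label_count bl s a = 1\<close>, and the count is additive in the blocks and
  blind to their order.\<close>

definition label_count :: "('t::finite \<Rightarrow> ('s labels \<times> 'b) list) \<Rightarrow> 's \<Rightarrow> nat \<Rightarrow> nat" where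
  "label_count bl s a = (\<Sum>t\<in>UNIV. length (filter (\<lambda>b. a |\<in>| fst b s) (bl t)))"

lemma ex1_position_iff_label_count:
  fixes bl :: "'t::finite \<Rightarrow> ('s labels \<times> 'b) list"
  shows "(\<exists>!(t, j). j < length (bl t) \<and> a |\<in>| fst (bl t ! j) s) \<longleftrightarrow> label_count bl s a = 1"
proof -
  let ?A = "SIGMA t:UNIV. {j. j < length (bl t) \<and> a |\<in>| fst (bl t ! j) s}"
  have "card ?A = label_count bl s a"
    unfolding label_count_def by (simp add: length_filter_conv_card)
  moreover have "(\<exists>!(t, j). j < length (bl t) \<and> a |\<in>| fst (bl t ! j) s) \<longleftrightarrow> (\<exists>!x. x \<in> ?A)"
    by (rule arg_cong[where f = Ex1]) (auto simp: fun_eq_iff)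
  moreover have "(\<exists>!x. x \<in> A) \<longleftrightarrow> card A = 1" for A :: "('t \<times> nat) set"
    unfolding One_nat_def card_1_singleton_iff set_eq_iff singleton_iff Ex1_def by metis
  ultimately show ?thesis by simp
qed

lemma assemblies_iff:
  fixes F :: "('t::finite, 'a) species"
  shows "(f, bl) \<in> assemblies F G U \<longleftrightarrow> f \<in> structs F (block_labels bl) \<and>
     (\<forall>t B g. (B, g) \<in> set (bl t) \<longrightarrow> g \<in> structs (G t) B \<and> (\<forall>s. B s |\<subseteq>| U s)) \<and>
     (\<forall>s a. a |\<in>| U s \<longrightarrow> label_count bl s a = 1)"
  unfolding assemblies_def ex1_position_iff_label_count by (simp add: Ball_def)

lemma assemblies_mono:
  assumes "\<And>t B. structs (G t) B \<subseteq> structs (G' t) B"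
  shows "assemblies F G U \<subseteq> assemblies F G' U"
  using assms unfolding assemblies_def by fastforce

lemma label_count_eq_0_iff: "label_count bl s a = 0 \<longleftrightarrow> (\<forall>t. \<forall>b\<in>set (bl t). a |\<notin>| fst b s)"
  by (auto simp: label_count_def filter_empty_conv)

lemma label_count_Cons:
  "label_count (bl(j := b # l)) s a = (if a |\<in>| fst b s then 1 else 0) + label_count (bl(j := l)) s a"
  unfolding label_count_def by (subst (1 2) sum.remove[of UNIV j]) (auto intro!: sum.cong)

subsection \<open>Reordering blocks\<close>

definition reorders :: "('t \<Rightarrow> nat \<Rightarrow> nat) \<Rightarrow> ('t \<Rightarrow> 'c list) \<Rightarrow> ('t \<Rightarrow> 'c list) \<Rightarrow> bool" where
  "reorders \<pi> bl bl' \<longleftrightarrow> (\<forall>t. bij_betw (\<pi> t) {..<length (bl t)} {..<length (bl t)} \<and>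
     length (bl' t) = length (bl t) \<and> (\<forall>j<length (bl t). bl' t ! \<pi> t j = bl t ! j))"

lemma mem_reorderings:
  "(f', bl') \<in> reorderings F (f, bl) \<longleftrightarrow>
    (\<exists>\<pi>. reorders \<pi> bl bl' \<and> f' = transport F (block_labels bl) \<pi> f)"
  by (simp add: reorderings_def reorders_def)

lemma reorders_lt: "reorders \<pi> bl bl' \<Longrightarrow> j < length (bl t) \<Longrightarrow> \<pi> t j < length (bl t)"
  unfolding reorders_def bij_betw_def by blast

lemma reorders_nth: "reorders \<pi> bl bl' \<Longrightarrow> j < length (bl t) \<Longrightarrow> bl' t ! \<pi> t j = bl t ! j"
  unfolding reorders_def by blast

lemma reorders_length: "reorders \<pi> bl bl' \<Longrightarrow> length (bl' t) = length (bl t)"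
  unfolding reorders_def by blast

lemma reorders_bij: "reorders \<pi> bl bl' \<Longrightarrow> bij_betw (\<pi> t) {..<length (bl t)} {..<length (bl t)}"
  unfolding reorders_def by blast

lemma reorders_id: "reorders (\<lambda>t. id) bl bl"
  by (simp add: reorders_def)

lemma reorders_block_labels:
  assumes "reorders \<pi> bl bl'"
  shows "block_labels bl' = block_labels bl" "relabelling \<pi> (block_labels bl)"
    "relabel \<pi> (block_labels bl) = block_labels bl"
proof -
  show "block_labels bl' = block_labels bl" by (rule block_labels_cong) (rule reorders_length[OF assms])
  show "relabelling \<pi> (block_labels bl)"
    using reorders_bij[OF assms] by (simp add: relabelling_def fset_block_labels bij_betw_def)
  show "relabel \<pi> (block_labels bl) = block_labels bl"
    using reorders_bij[OF assms]
    by (simp add: relabel_def fun_eq_iff fset_inject[symmetric] fset_block_labels bij_betw_def)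
qed

lemma reorders_trans:
  assumes "reorders \<pi> bl bl'" "reorders \<rho> bl' bl''"
  shows "reorders (\<lambda>t. \<rho> t \<circ> \<pi> t) bl bl''"
  unfolding reorders_def
proof (intro allI conjI impI)
  fix t
  show "bij_betw (\<rho> t \<circ> \<pi> t) {..<length (bl t)} {..<length (bl t)}"
    using bij_betw_trans[OF reorders_bij[OF assms(1)], of _ t] reorders_bij[OF assms(2), of t]
    by (simp add: reorders_length[OF assms(1)])
  show "length (bl'' t) = length (bl t)" using assms by (simp add: reorders_length)
  show "bl'' t ! (\<rho> t \<circ> \<pi> t) j = bl t ! j" if "j < length (bl t)" for j
    using that reorders_nth[OF assms(2), of "\<pi> t j" t] reorders_nth[OF assms(1) that] reorders_lt[OF assms(1) that]
    by (simp add: reorders_length[OF assms(1)])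
qed

lemma reorders_sym:
  assumes "reorders \<pi> bl bl'"
  shows "reorders (\<lambda>t. inv_into {..<length (bl t)} (\<pi> t)) bl' bl"
  unfolding reorders_def
proof (intro allI conjI impI)
  fix t
  note b = reorders_bij[OF assms, of t]
  note l = reorders_length[OF assms, of t]
  show "bij_betw (inv_into {..<length (bl t)} (\<pi> t)) {..<length (bl' t)} {..<length (bl' t)}"
    using bij_betw_inv_into[OF b] l by simp
  show "length (bl t) = length (bl' t)" using l by simp
  show "bl t ! inv_into {..<length (bl t)} (\<pi> t) j = bl' t ! j" if "j < length (bl' t)" for j
  proof -
    let ?k = "inv_into {..<length (bl t)} (\<pi> t) j"
    have "?k < length (bl t)" using bij_betwE[OF bij_betw_inv_into[OF b]] that l by auto
    moreover have "\<pi> t ?k = j" using bij_betw_inv_into_right[OF b] that l by auto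
    ultimately show ?thesis using reorders_nth[OF assms, of ?k t] by simp
  qed
qed

lemma reorders_unique:
  assumes "reorders \<pi> bl bl'" "reorders \<pi> bl bl''"
  shows "bl' = bl''"
proof
  fix t
  show "bl' t = bl'' t"
  proof (rule nth_equalityI)
    show "length (bl' t) = length (bl'' t)" using assms by (simp add: reorders_length)
    fix i assume "i < length (bl' t)"
    then have "i \<in> \<pi> t ` {..<length (bl t)}"
      using reorders_bij[OF assms(1), of t] by (simp add: bij_betw_def reorders_length[OF assms(1)])
    then show "bl' t ! i = bl'' t ! i"
      using reorders_nth[OF assms(1)] reorders_nth[OF assms(2)] by fastforce
  qed
qed

lemma reorders_exists:
  assumes "\<And>t. bij_betw (\<pi> t) {..<length (bl t)} {..<length (bl t)}"
  shows "\<exists>bl'. reorders \<pi> bl bl'"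
proof
  show "reorders \<pi> bl (\<lambda>t. map (\<lambda>k. bl t ! inv_into {..<length (bl t)} (\<pi> t) k) [0..<length (bl t)])"
    unfolding reorders_def
  proof (intro allI conjI impI)
    fix t j assume j: "j < length (bl t)"
    have "\<pi> t j < length (bl t)" using bij_betwE[OF assms] j by auto
    then show "map (\<lambda>k. bl t ! inv_into {..<length (bl t)} (\<pi> t) k) [0..<length (bl t)] ! \<pi> t j = bl t ! j"
      using bij_betw_inv_into_left[OF assms, of j t] j by simp
  qed (use assms in auto)
qed

lemma reorders_set:
  assumes "reorders \<pi> bl bl'" shows "set (bl' t) = set (bl t)"
proof -
  have sub: "set (bl t) \<subseteq> set (bl' t)" if "reorders \<pi> bl bl'" for \<pi> bl bl'
  proof
    fix b assume "b \<in> set (bl t)"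
    then obtain j where "j < length (bl t)" "b = bl t ! j" by (auto simp: in_set_conv_nth)
    then show "b \<in> set (bl' t)"
      using reorders_nth[OF that, of j t] reorders_lt[OF that, of j t] reorders_length[OF that, of t]
      by (metis nth_mem)
  qed
  show ?thesis using sub[OF assms] sub[OF reorders_sym[OF assms]] by blast
qed

lemma reorders_label_count:
  assumes "reorders \<pi> bl bl'" shows "label_count bl' s a = label_count bl s a"
  unfolding label_count_def
proof (rule sum.cong)
  fix t
  have "bij_betw (\<pi> t) {j. j < length (bl t) \<and> a |\<in>| fst (bl t ! j) s}
      {j. j < length (bl' t) \<and> a |\<in>| fst (bl' t ! j) s}"
    unfolding bij_betw_def
  proof
    show "inj_on (\<pi> t) {j. j < length (bl t) \<and> a |\<in>| fst (bl t ! j) s}"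
      using reorders_bij[OF assms, of t] by (auto simp: bij_betw_def inj_on_def)
    have "\<exists>k<length (bl t). j = \<pi> t k" if "j < length (bl' t)" for j
    proof -
      have "j \<in> \<pi> t ` {..<length (bl t)}"
        using reorders_bij[OF assms, of t] that reorders_length[OF assms, of t] by (simp add: bij_betw_def)
      then show ?thesis by blast
    qed
    then show "\<pi> t ` {j. j < length (bl t) \<and> a |\<in>| fst (bl t ! j) s}
        = {j. j < length (bl' t) \<and> a |\<in>| fst (bl' t ! j) s}"
      using reorders_nth[OF assms, of _ t] reorders_lt[OF assms, of _ t] reorders_length[OF assms, of t] by force
  qed
  then show "length (filter (\<lambda>b. a |\<in>| fst b s) (bl' t)) = length (filter (\<lambda>b. a |\<in>| fst b s) (bl t))"
    unfolding length_filter_conv_card by (rule bij_betw_same_card[symmetric])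
qed simp

lemma reorderings_closed:
  fixes F :: "('t::finite, 'a) species"
  assumes F: "functorial F" and p: "p \<in> assemblies F G U" and q: "q \<in> reorderings F p"
  shows "q \<in> assemblies F G U"
proof -
  obtain f bl f' bl' where pq: "p = (f, bl)" "q = (f', bl')" by (metis surj_pair)
  then obtain \<pi> where \<pi>: "reorders \<pi> bl bl'" "f' = transport F (block_labels bl) \<pi> f"
    using q by (auto simp: mem_reorderings)
  have "f' \<in> structs F (block_labels bl')"
    using functorial_closed[OF F reorders_block_labels(2)[OF \<pi>(1)], of f] p
    by (simp add: pq \<pi>(2) reorders_block_labels[OF \<pi>(1)] assemblies_iff)
  then show ?thesis
    using p by (simp add: pq assemblies_iff reorders_set[OF \<pi>(1)] reorders_label_count[OF \<pi>(1)])
qed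

text \<open>The part of being an assembly that makes reordering an equivalence relation. It mentions
  neither the label set nor the species in the blocks, so it survives any change of the contents of
  blocks.\<close>

definition well_labelled :: "('t, 'a) species \<Rightarrow> ('s, 't, 'a, 'b) assembly \<Rightarrow> bool" where
  "well_labelled F p \<longleftrightarrow> fst p \<in> structs F (block_labels (snd p))"

lemma well_labelled_assembly: "p \<in> assemblies F G U \<Longrightarrow> well_labelled F p"
  by (auto simp: assemblies_def well_labelled_def)

lemma reorderings_self: "functorial F \<Longrightarrow> well_labelled F p \<Longrightarrow> p \<in> reorderings F p"
  by (cases p) (auto simp: mem_reorderings well_labelled_def intro!: exI[of _ "\<lambda>t. id"] reorders_id
      functorial_id[symmetric])

lemma reorderings_well_labelled:
  "functorial F \<Longrightarrow> well_labelled F p \<Longrightarrow> q \<in> reorderings F p \<Longrightarrow> well_labelled F q"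
  by (cases p, cases q) (auto simp: mem_reorderings well_labelled_def reorders_block_labels
      dest: functorial_closed[OF _ reorders_block_labels(2)])

lemma reorderings_trans:
  assumes F: "functorial F" and p: "well_labelled F p" and q: "q \<in> reorderings F p" and r: "r \<in> reorderings F q"
  shows "r \<in> reorderings F p"
proof -
  obtain f bl f' bl' f'' bl'' where pq: "p = (f, bl)" "q = (f', bl')" "r = (f'', bl'')" by (metis surj_pair)
  then obtain \<pi> \<rho> where \<pi>: "reorders \<pi> bl bl'" "f' = transport F (block_labels bl) \<pi> f"
    and \<rho>: "reorders \<rho> bl' bl''" "f'' = transport F (block_labels bl') \<rho> f'"
    using q r by (auto simp: mem_reorderings)
  have "f'' = transport F (block_labels bl) (\<lambda>t. \<rho> t \<circ> \<pi> t) f"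
    using functorial_comp[OF F, of \<pi> "block_labels bl" \<rho> f] p reorders_block_labels[OF \<pi>(1)] reorders_block_labels[OF \<rho>(1)]
    by (simp add: \<pi>(2) \<rho>(2) pq well_labelled_def)
  then show ?thesis using reorders_trans[OF \<pi>(1) \<rho>(1)] by (auto simp: pq mem_reorderings)
qed

lemma reorderings_sym:
  assumes F: "functorial F" and p: "well_labelled F p" and q: "q \<in> reorderings F p"
  shows "p \<in> reorderings F q"
proof -
  obtain f bl f' bl' where pq: "p = (f, bl)" "q = (f', bl')" by (metis surj_pair)
  then obtain \<pi> where \<pi>: "reorders \<pi> bl bl'" "f' = transport F (block_labels bl) \<pi> f"
    using q by (auto simp: mem_reorderings)
  let ?\<rho> = "\<lambda>t. inv_into {..<length (bl t)} (\<pi> t)"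
  note \<rho> = reorders_sym[OF \<pi>(1)]
  have f: "f \<in> structs F (block_labels bl)" using p by (simp add: well_labelled_def pq)
  have "transport F (block_labels bl') ?\<rho> f' = transport F (block_labels bl) (\<lambda>t. ?\<rho> t \<circ> \<pi> t) f"
    using functorial_comp[OF F reorders_block_labels(2)[OF \<pi>(1)] _ f, of ?\<rho>] reorders_block_labels[OF \<pi>(1)]
      reorders_block_labels(2)[OF \<rho>] by (simp add: \<pi>(2))
  also have "\<dots> = transport F (block_labels bl) (\<lambda>t. id) f"
  proof (rule functorial_cong[OF F _ _ f])
    show "relabelling (\<lambda>t. ?\<rho> t \<circ> \<pi> t) (block_labels bl)"
      using reorders_block_labels(2)[OF reorders_trans[OF \<pi>(1) \<rho>]] .
    show "\<forall>t a. a |\<in>| block_labels bl t \<longrightarrow> (?\<rho> t \<circ> \<pi> t) a = id a"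
      using bij_betw_inv_into_left[OF reorders_bij[OF \<pi>(1)]] by (simp add: mem_block_labels)
  qed
  also have "\<dots> = f" by (rule functorial_id[OF F f])
  finally show ?thesis using \<rho> by (auto simp: pq mem_reorderings)
qed

lemma reorderings_eq:
  "functorial F \<Longrightarrow> well_labelled F p \<Longrightarrow> q \<in> reorderings F p \<Longrightarrow> reorderings F q = reorderings F p"
  using reorderings_trans reorderings_sym reorderings_well_labelled by (metis subsetI subset_antisym)

text \<open>Classes are stored as finite sets, and \<open>Abs_fset\<close> is meaningful on finite
  sets only. Reordered lists have the same elements and the same lengths, and there are finitely
  many sorts, so finitely many families of lists occur.\<close>

lemma finite_reorderings:
  fixes F :: "('t::finite, 'a) species"
  assumes F: "is_species F" and p: "well_labelled F p"
  shows "finite (reorderings F p)"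
proof -
  obtain f bl where pq: "p = (f, bl)" by (metis surj_pair)
  let ?A = "\<lambda>t. {l. set l \<subseteq> set (bl t) \<and> length l = length (bl t)}"
  have "reorderings F p \<subseteq> structs F (block_labels bl) \<times> (PiE UNIV ?A)"
  proof
    fix q assume q: "q \<in> reorderings F p"
    obtain f' bl' where q': "q = (f', bl')" by (metis surj_pair)
    then obtain \<pi> where \<pi>: "reorders \<pi> bl bl'" using q by (auto simp: pq mem_reorderings)
    have "well_labelled F q" using reorderings_well_labelled[OF _ p q] F by (simp add: is_species_iff_functorial)
    then show "q \<in> structs F (block_labels bl) \<times> (PiE UNIV ?A)"
      using reorders_set[OF \<pi>] reorders_length[OF \<pi>] reorders_block_labels[OF \<pi>]
      by (simp add: q' well_labelled_def PiE_UNIV_domain)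
  qed
  moreover have "finite (structs F (block_labels bl))" using F by (simp add: is_species_iff_functorial)
  moreover have "finite (PiE UNIV ?A)" by (intro finite_PiE) (auto intro: finite_lists_length_eq)
  ultimately show ?thesis by (meson finite_SigmaI finite_subset)
qed

definition assembly_class :: "('t, 'a) species \<Rightarrow> ('s, 't, 'a, 'b) assembly \<Rightarrow> ('s, 't, 'a, 'b) assembly fset" where
  "assembly_class F p = Abs_fset (reorderings F p)"

lemma fset_assembly_class:
  fixes F :: "('t::finite, 'a) species"
  shows "is_species F \<Longrightarrow> well_labelled F p \<Longrightarrow> fset (assembly_class F p) = reorderings F p"
  by (simp add: assembly_class_def Abs_fset_inverse finite_reorderings)

lemma assembly_class_eq_iff:
  fixes F :: "('t::finite, 'a) species"
  assumes F: "is_species F" and p: "well_labelled F p" and q: "well_labelled F q"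
  shows "assembly_class F p = assembly_class F q \<longleftrightarrow> q \<in> reorderings F p"
proof -
  have "functorial F" using F by (simp add: is_species_iff_functorial)
  then have "reorderings F p = reorderings F q \<longleftrightarrow> q \<in> reorderings F p"
    using reorderings_self q reorderings_eq p by metis
  then show ?thesis using fset_assembly_class[OF F p] fset_assembly_class[OF F q] by (metis fset_inject)
qed

text \<open>The common form of relabelling an assembly and of replacing the structures in its
  blocks: positions do not change, so the root structure stays.\<close>

definition map_blocks :: "('t \<Rightarrow> 'c \<Rightarrow> 'd) \<Rightarrow> 'a \<times> ('t \<Rightarrow> 'c list) \<Rightarrow> 'a \<times> ('t \<Rightarrow> 'd list)" where
  "map_blocks h = (\<lambda>(f, bl). (f, \<lambda>t. map (h t) (bl t)))"

lemma assembly_relabel_eq_map_blocks: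
  "assembly_relabel G \<sigma> = map_blocks (\<lambda>t (B, g). (relabel \<sigma> B, transport (G t) B \<sigma> g))"
  by (simp add: assembly_relabel_def map_blocks_def)

lemma reorders_map: "reorders \<pi> bl bl' \<Longrightarrow> reorders \<pi> (\<lambda>t. map (h t) (bl t)) (\<lambda>t. map (h t) (bl' t))"
  using reorders_lt[of \<pi> bl bl'] by (auto simp: reorders_def)

text \<open>A reordering moves positions without looking at contents, so a permutation found after
  applying \<open>h\<close> can be applied before it, even where \<open>h\<close> identifies
  blocks.\<close>

lemma reorderings_map_blocks: "reorderings F (map_blocks h p) = map_blocks h ` reorderings F p"
proof -
  obtain f bl where p: "p = (f, bl)" by (metis surj_pair)
  have lab: "block_labels (\<lambda>t. map (h t) (bl t)) = block_labels bl" by (rule block_labels_cong) simp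
  show ?thesis
  proof (intro subset_antisym subsetI)
    fix q assume "q \<in> reorderings F (map_blocks h p)"
    then obtain f' bl'' \<pi> where q: "q = (f', bl'')" "reorders \<pi> (\<lambda>t. map (h t) (bl t)) bl''"
      "f' = transport F (block_labels bl) \<pi> f"
      by (cases q) (auto simp: p map_blocks_def mem_reorderings lab)
    obtain bl' where bl': "reorders \<pi> bl bl'" using reorders_exists[of \<pi> bl] reorders_bij[OF q(2)] by auto
    have "bl'' = (\<lambda>t. map (h t) (bl' t))" using reorders_unique[OF q(2) reorders_map[OF bl']] .
    moreover have "(f', bl') \<in> reorderings F p" using bl' q(3) by (auto simp: p mem_reorderings)
    ultimately show "q \<in> map_blocks h ` reorderings F p"
      by (intro image_eqI[of _ _ "(f', bl')"]) (simp_all add: q(1) map_blocks_def)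
  next
    fix q assume "q \<in> map_blocks h ` reorderings F p"
    then obtain f' bl' \<pi> where "q = (f', \<lambda>t. map (h t) (bl' t))" "reorders \<pi> bl bl'"
      "f' = transport F (block_labels bl) \<pi> f"
      by (auto simp: p map_blocks_def mem_reorderings)
    then show "q \<in> reorderings F (map_blocks h p)"
      using reorders_map[of \<pi> bl bl' h] by (auto simp: p map_blocks_def mem_reorderings lab)
  qed
qed

lemma well_labelled_map_blocks: "well_labelled F (map_blocks h p) \<longleftrightarrow> well_labelled F p"
proof -
  have "block_labels (\<lambda>t. map (h t) (snd p t)) = block_labels (snd p)" by (rule block_labels_cong) simp
  then show ?thesis by (simp add: well_labelled_def map_blocks_def case_prod_beta)
qed

lemma assemblies_map_blocks:
  fixes F :: "('t::finite, 'a) species"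
  assumes p: "p \<in> assemblies F G U"
    and h: "\<And>t B g. (B, g) \<in> set (snd p t) \<Longrightarrow> fst (h t (B, g)) = B \<and> snd (h t (B, g)) \<in> structs (G' t) B"
  shows "map_blocks h p \<in> assemblies F G' U"
proof -
  obtain f bl where pe: "p = (f, bl)" by (metis surj_pair)
  have lab: "block_labels (\<lambda>t. map (h t) (bl t)) = block_labels bl" by (rule block_labels_cong) simp
  have "label_count (\<lambda>t. map (h t) (bl t)) s a = label_count bl s a" for s a
    unfolding label_count_def filter_map length_map comp_def
    by (intro sum.cong refl arg_cong[where f = length] filter_cong) (use h in \<open>auto simp: pe\<close>)
  moreover have "g \<in> structs (G' t) B \<and> (\<forall>s. B s |\<subseteq>| U s)" if Bg: "(B, g) \<in> h t ` set (bl t)" for t B g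
  proof -
    obtain B' g' where b: "(B', g') \<in> set (bl t)" "h t (B', g') = (B, g)" using Bg by auto
    then show ?thesis using h[of B' g' t] p unfolding pe assemblies_iff by auto
  qed
  ultimately show ?thesis using p by (auto simp: pe map_blocks_def assemblies_iff lab)
qed

lemma assembly_relabel_closed:
  fixes F :: "('t::finite, 'a) species"
  assumes G: "\<And>t. functorial (G t)" and \<sigma>: "relabelling \<sigma> U" and p: "p \<in> assemblies F G U"
  shows "assembly_relabel G \<sigma> p \<in> assemblies F G (relabel \<sigma> U)"
proof -
  obtain f bl where pe: "p = (f, bl)" by (metis surj_pair)
  let ?h = "\<lambda>t (B, g). (relabel \<sigma> B, transport (G t) B \<sigma> g)"
  have lab: "block_labels (\<lambda>t. map (?h t) (bl t)) = block_labels bl" by (rule block_labels_cong) simp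
  have bl: "g \<in> structs (G t) B" "B s |\<subseteq>| U s" if "(B, g) \<in> set (bl t)" for t B g s
    using p that by (auto simp: pe assemblies_iff)
  have count: "label_count (\<lambda>t. map (?h t) (bl t)) s (\<sigma> s a) = label_count bl s a" if a: "a |\<in>| U s" for s a
    unfolding label_count_def filter_map length_map comp_def
  proof (intro sum.cong refl arg_cong[where f = length] filter_cong)
    fix t b assume b: "b \<in> set (bl t)"
    obtain B g where bBg: "b = (B, g)" by (metis surj_pair)
    \<comment> \<open>Injectivity on all of \<open>U\<close>, not just on each block, keeps a label
      from entering the image of a block that does not contain it.\<close>
    have "inj_on (\<sigma> s) (fset (U s))" using \<sigma> by (simp add: relabelling_def)
    then have "\<sigma> s a \<in> \<sigma> s ` fset (B s) \<longleftrightarrow> a \<in> fset (B s)"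
      using a bl(2)[of B g t s] b bBg by (metis inj_on_image_mem_iff less_eq_fset.rep_eq)
    then show "(\<sigma> s a |\<in>| fst (?h t b) s) = (a |\<in>| fst b s)"
      by (simp add: bBg relabel_def)
  qed
  have "g \<in> structs (G t) B \<and> (\<forall>s. B s |\<subseteq>| relabel \<sigma> U s)" if Bg: "(B, g) \<in> ?h t ` set (bl t)" for t B g
  proof -
    obtain B' g' where b: "(B', g') \<in> set (bl t)" "B = relabel \<sigma> B'" "g = transport (G t) B' \<sigma> g'" using Bg by auto
    have "relabelling \<sigma> B'" using relabelling_subset[OF \<sigma>] bl(2)[OF b(1)] by blast
    then show ?thesis
      using functorial_closed[OF G _ bl(1)[OF b(1)]] bl(2)[OF b(1)] b
      by (auto simp: relabel_def fimage_mono)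
  qed
  moreover have "label_count (\<lambda>t. map (?h t) (bl t)) s a = 1" if a: "a |\<in>| relabel \<sigma> U s" for s a
  proof -
    obtain a' where "a = \<sigma> s a'" "a' |\<in>| U s" using a by (auto simp: relabel_def)
    then show ?thesis using count p by (simp add: pe assemblies_iff)
  qed
  moreover have "f \<in> structs F (block_labels bl)" using p by (simp add: pe assemblies_iff)
  ultimately show ?thesis
    unfolding pe assembly_relabel_eq_map_blocks map_blocks_def prod.case assemblies_iff lab set_map by blast
qed

lemma block_subset: "(f, bl) \<in> assemblies F G U \<Longrightarrow> (B, g) \<in> set (bl t) \<Longrightarrow> B s |\<subseteq>| U s"
  unfolding assemblies_def by fastforce

lemma block_struct: "(f, bl) \<in> assemblies F G U \<Longrightarrow> (B, g) \<in> set (bl t) \<Longrightarrow> g \<in> structs (G t) B"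
  unfolding assemblies_def by fastforce

subsection \<open>Composition\<close>

lemma structs_comp: "structs (species_comp F G) U = assembly_class F ` assemblies F G U"
  by (simp add: species_comp_def assembly_class_def)

lemma transport_comp:
  assumes F: "is_species F" and p: "p \<in> assemblies F G U"
  shows "transport (species_comp F G) U \<sigma> (assembly_class F p) = assembly_class F (assembly_relabel G \<sigma> p)"
proof -
  note wl = well_labelled_assembly[OF p]
  have "fset (assembly_relabel G \<sigma> |`| assembly_class F p) = fset (assembly_class F (assembly_relabel G \<sigma> p))"
    using wl by (simp add: fset_assembly_class[OF F] assembly_relabel_eq_map_blocks reorderings_map_blocks
        well_labelled_map_blocks)
  then have "assembly_relabel G \<sigma> |`| assembly_class F p = assembly_class F (assembly_relabel G \<sigma> p)"
    by (simp only: fset_inject)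
  then show ?thesis by (simp add: species_comp_def)
qed

lemma map_blocks_cong:
  "(\<And>t b. b \<in> set (snd p t) \<Longrightarrow> h t b = h' t b) \<Longrightarrow> map_blocks h p = map_blocks h' p"
  by (cases p) (auto simp: map_blocks_def)

lemma map_blocks_map_blocks: "map_blocks h (map_blocks h' p) = map_blocks (\<lambda>t. h t \<circ> h' t) p"
  by (cases p) (simp add: map_blocks_def)

lemma map_blocks_ident: "map_blocks (\<lambda>t b. b) p = p"
  by (cases p) (simp add: map_blocks_def)

lemma functorial_species_comp:
  fixes F :: "('t::finite, 'a) species"
  assumes F: "is_species F" and G: "\<And>t. functorial (G t)"
  shows "functorial (species_comp F G)"
proof (rule functorialI)
  fix U c assume "c \<in> structs (species_comp F G) U"
  then obtain p where p: "p \<in> assemblies F G U" "c = assembly_class F p" by (auto simp: structs_comp)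
  have bl: "g \<in> structs (G t) B" "B s |\<subseteq>| U s" if "(B, g) \<in> set (snd p t)" for t B g s
    using p that by (cases p; auto dest: block_struct block_subset; fail)+
  have "assembly_relabel G (\<lambda>s. id) p = p"
    unfolding assembly_relabel_eq_map_blocks
    by (subst (2) map_blocks_ident[symmetric], rule map_blocks_cong) (auto simp: functorial_id[OF G] bl)
  then show "transport (species_comp F G) U (\<lambda>s. id) c = c" using p by (simp add: transport_comp[OF F])
  fix \<sigma> assume \<sigma>: "relabelling \<sigma> U"
  have \<sigma>': "relabelling \<sigma> B" if "(B, g) \<in> set (snd p t)" for B g t
    using relabelling_subset[OF \<sigma>] bl(2)[OF that] by blast
  note p' = assembly_relabel_closed[OF G \<sigma> p(1)]
  show "transport (species_comp F G) U \<sigma> c \<in> structs (species_comp F G) (relabel \<sigma> U)"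
    using p p' by (simp add: transport_comp[OF F] structs_comp)
  show "transport (species_comp F G) U \<sigma> c = transport (species_comp F G) U \<sigma>' c"
    if e: "\<forall>s a. a |\<in>| U s \<longrightarrow> \<sigma> s a = \<sigma>' s a" for \<sigma>'
  proof -
    have "assembly_relabel G \<sigma> p = assembly_relabel G \<sigma>' p"
      unfolding assembly_relabel_eq_map_blocks
    proof (rule map_blocks_cong)
      fix t b assume b: "b \<in> set (snd p t)"
      obtain B g where Bg: "b = (B, g)" by (metis surj_pair)
      have e': "\<forall>s a. a |\<in>| B s \<longrightarrow> \<sigma> s a = \<sigma>' s a" using e bl(2) b Bg by blast
      show "(case b of (B, g) \<Rightarrow> (relabel \<sigma> B, transport (G t) B \<sigma> g))
          = (case b of (B, g) \<Rightarrow> (relabel \<sigma>' B, transport (G t) B \<sigma>' g))"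
        using relabel_cong[OF e'] functorial_cong[OF G \<sigma>' e' bl(1)] b Bg by simp
    qed
    then show ?thesis using p by (simp add: transport_comp[OF F])
  qed
  show "transport (species_comp F G) U (\<lambda>s. \<tau> s \<circ> \<sigma> s) c
      = transport (species_comp F G) (relabel \<sigma> U) \<tau> (transport (species_comp F G) U \<sigma> c)"
    if \<tau>: "relabelling \<tau> (relabel \<sigma> U)" for \<tau>
  proof -
    have "assembly_relabel G (\<lambda>s. \<tau> s \<circ> \<sigma> s) p = assembly_relabel G \<tau> (assembly_relabel G \<sigma> p)"
      unfolding assembly_relabel_eq_map_blocks map_blocks_map_blocks
    proof (rule map_blocks_cong)
      fix t b assume b: "b \<in> set (snd p t)"
      obtain B g where Bg: "b = (B, g)" by (metis surj_pair)
      have "relabelling \<tau> (relabel \<sigma> B)"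
        using relabelling_subset[OF \<tau>] bl(2) b Bg by (metis fimage_mono relabel_def)
      then show "(case b of (B, g) \<Rightarrow> (relabel (\<lambda>s. \<tau> s \<circ> \<sigma> s) B, transport (G t) B (\<lambda>s. \<tau> s \<circ> \<sigma> s) g))
          = ((\<lambda>(B, g). (relabel \<tau> B, transport (G t) B \<tau> g)) \<circ> (\<lambda>(B, g). (relabel \<sigma> B, transport (G t) B \<sigma> g))) b"
        using functorial_comp[OF G \<sigma>' _ bl(1)] b Bg by (simp add: relabel_relabel)
    qed
    then show ?thesis using p p' by (simp add: transport_comp[OF F])
  qed
qed

text \<open>The composition as a quotient: a natural map on assemblies that identifies exactly the
  reorderings of each other factors through the classes. Representatives are chosen, but by
  \<open>eq\<close> their image under \<open>\<nu>\<close> does not depend on the choice.\<close>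

lemma species_comp_isoI:
  fixes F :: "('t::finite, 'a) species"
  assumes F: "is_species F"
    and im: "\<And>U. \<nu> U ` assemblies F G U = structs K U"
    and eq: "\<And>U p q. p \<in> assemblies F G U \<Longrightarrow> q \<in> assemblies F G U \<Longrightarrow> \<nu> U p = \<nu> U q \<longleftrightarrow> q \<in> reorderings F p"
    and nat: "\<And>U \<sigma> p. relabelling \<sigma> U \<Longrightarrow> p \<in> assemblies F G U
      \<Longrightarrow> transport K U \<sigma> (\<nu> U p) = \<nu> (relabel \<sigma> U) (assembly_relabel G \<sigma> p)"
    and G: "\<And>t. functorial (G t)"
  shows "species_iso (species_comp F G) K"
proof -
  define rep where "rep U c = (SOME p. p \<in> assemblies F G U \<and> c = assembly_class F p)" for U c
  have rep: "rep U c \<in> assemblies F G U \<and> c = assembly_class F (rep U c)"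
    if "c \<in> structs (species_comp F G) U" for U c
    unfolding rep_def by (rule someI_ex) (use that in \<open>auto simp: structs_comp\<close>)
  have \<nu>rep: "\<nu> U (rep U (assembly_class F p)) = \<nu> U p" if p: "p \<in> assemblies F G U" for U p
  proof -
    have "assembly_class F p \<in> structs (species_comp F G) U" using p by (simp add: structs_comp)
    note r = rep[OF this]
    then have "p \<in> reorderings F (rep U (assembly_class F p))"
      using assembly_class_eq_iff[OF F] well_labelled_assembly p by metis
    then show ?thesis using eq r p by blast
  qed
  show ?thesis
  proof (rule species_isoI[where \<phi> = "\<lambda>U c. \<nu> U (rep U c)"])
    fix U
    show "bij_betw (\<lambda>c. \<nu> U (rep U c)) (structs (species_comp F G) U) (structs K U)"
      unfolding bij_betw_def
    proof
      show "inj_on (\<lambda>c. \<nu> U (rep U c)) (structs (species_comp F G) U)"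
      proof (rule inj_onI)
        fix c d assume "c \<in> structs (species_comp F G) U" "d \<in> structs (species_comp F G) U"
          and e: "\<nu> U (rep U c) = \<nu> U (rep U d)"
        note c = rep[OF this(1)] and d = rep[OF this(2)]
        have "rep U d \<in> reorderings F (rep U c)" using e eq c d by blast
        then have "assembly_class F (rep U c) = assembly_class F (rep U d)"
          using assembly_class_eq_iff[OF F] well_labelled_assembly c d by blast
        then show "c = d" using c d by argo
      qed
      show "(\<lambda>c. \<nu> U (rep U c)) ` structs (species_comp F G) U = structs K U"
        unfolding im[symmetric] structs_comp image_image using \<nu>rep by (simp cong: image_cong)
    qed
  next
    fix U \<sigma> c assume \<sigma>: "relabelling \<sigma> U" and c: "c \<in> structs (species_comp F G) U"
    obtain p where p: "p \<in> assemblies F G U" "c = assembly_class F p" using c by (auto simp: structs_comp)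
    show "\<nu> (relabel \<sigma> U) (rep (relabel \<sigma> U) (transport (species_comp F G) U \<sigma> c)) = transport K U \<sigma> (\<nu> U (rep U c))"
      using p \<nu>rep[OF p(1)] \<nu>rep[OF assembly_relabel_closed[OF G \<sigma> p(1)]] nat[OF \<sigma> p(1)]
      by (simp add: transport_comp[OF F])
  qed
qed

lemma species_comp_cong:
  fixes F :: "('t::finite, 'a) species" and G :: "'t \<Rightarrow> ('s, 'b) species" and G' :: "'t \<Rightarrow> ('s, 'c) species"
  assumes F: "is_species F" and G: "\<And>t. functorial (G t)"
    and iso: "\<And>t. species_iso (G t) (G' t)"
  shows "species_iso (species_comp F G) (species_comp F G')"
proof -
  have "\<forall>t. \<exists>\<phi>. natural (G t) (G' t) \<phi> \<and> (\<forall>U. bij_betw (\<phi> U) (structs (G t) U) (structs (G' t) U))"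
    using iso unfolding species_iso_def by blast
  then obtain \<phi> where \<phi>: "\<And>t. natural (G t) (G' t) (\<phi> t)"
    "\<And>t U. bij_betw (\<phi> t U) (structs (G t) U) (structs (G' t) U)" by metis
  define h where "h = (\<lambda>t (B, g). (B, \<phi> t B g))"
  define k where "k = (\<lambda>t (B, g). (B, inv_into (structs (G t) B) (\<phi> t B) g))"
  have h: "map_blocks h p \<in> assemblies F G' U" if "p \<in> assemblies F G U" for p U
    by (rule assemblies_map_blocks[OF that])
      (use that bij_betwE[OF \<phi>(2)] in \<open>cases p; auto simp: h_def dest!: block_struct\<close>)
  show ?thesis
  proof (rule species_comp_isoI[OF F _ _ _ G, where \<nu> = "\<lambda>U p. assembly_class F (map_blocks h p)"])
    fix U
    show "(\<lambda>p. assembly_class F (map_blocks h p)) ` assemblies F G U = structs (species_comp F G') U"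
    proof (intro subset_antisym subsetI)
      fix c assume "c \<in> structs (species_comp F G') U"
      then obtain q where q: "q \<in> assemblies F G' U" "c = assembly_class F q" by (auto simp: structs_comp)
      have "map_blocks k q \<in> assemblies F G U"
        by (rule assemblies_map_blocks[OF q(1)])
          (use q(1) bij_betwE[OF bij_betw_inv_into[OF \<phi>(2)]] in \<open>cases q; auto simp: k_def dest!: block_struct\<close>)
      moreover have "map_blocks h (map_blocks k q) = map_blocks (\<lambda>t b. b) q"
        unfolding map_blocks_map_blocks
        by (rule map_blocks_cong)
          (use q(1) in \<open>cases q; auto simp: h_def k_def bij_betw_inv_into_right[OF \<phi>(2)] dest!: block_struct\<close>)
      ultimately show "c \<in> (\<lambda>p. assembly_class F (map_blocks h p)) ` assemblies F G U"
        using q(2) by (intro image_eqI[of _ _ "map_blocks k q"]) (simp_all add: map_blocks_ident)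
    qed (auto simp: structs_comp h)
  next
    fix U p q assume p: "p \<in> assemblies F G U" and q: "q \<in> assemblies F G U"
    have fF: "functorial F" using F by (simp add: is_species_iff_functorial)
    \<comment> \<open>\<open>h\<close> is injective on blocks that carry structures of their sort,
      so equal images can be cancelled between assemblies, though not between arbitrary
      lists.\<close>
    have inj: "r = q" if r: "r \<in> assemblies F G U" and e: "map_blocks h r = map_blocks h q" for r
    proof -
      obtain f bl f' bl' where rq: "r = (f, bl)" "q = (f', bl')" by (metis surj_pair)
      have "bl t = bl' t" for t
      proof -
        have "inj_on (h t) (set (bl t) \<union> set (bl' t))"
        proof (rule inj_onI)
          fix x y assume "x \<in> set (bl t) \<union> set (bl' t)" "y \<in> set (bl t) \<union> set (bl' t)" "h t x = h t y"
          moreover obtain B g C g' where "x = (B, g)" "y = (C, g')" by (metis surj_pair)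
          moreover have "inj_on (\<phi> t B) (structs (G t) B)" using \<phi>(2) by (simp add: bij_betw_def)
          ultimately show "x = y"
            using block_struct[OF r[unfolded rq]] block_struct[OF q[unfolded rq]]
            by (auto simp: h_def dest: inj_onD)
        qed
        moreover have "map (h t) (bl t) = map (h t) (bl' t)"
          using e by (simp add: rq map_blocks_def fun_eq_iff)
        ultimately show ?thesis by (simp add: inj_on_map_eq_map)
      qed
      then show ?thesis using e by (auto simp: rq map_blocks_def)
    qed
    have "assembly_class F (map_blocks h p) = assembly_class F (map_blocks h q)
        \<longleftrightarrow> map_blocks h q \<in> map_blocks h ` reorderings F p"
      using p q by (simp add: assembly_class_eq_iff[OF F] well_labelled_map_blocks well_labelled_assembly
          reorderings_map_blocks)
    also have "\<dots> \<longleftrightarrow> q \<in> reorderings F p"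
      using inj reorderings_closed[OF fF p] by (auto simp: image_iff) metis
    finally show "assembly_class F (map_blocks h p) = assembly_class F (map_blocks h q)
        \<longleftrightarrow> q \<in> reorderings F p" .
  next
    fix U \<sigma> p assume \<sigma>: "relabelling \<sigma> U" and p: "p \<in> assemblies F G U"
    have "assembly_relabel G' \<sigma> (map_blocks h p) = map_blocks h (assembly_relabel G \<sigma> p)"
      unfolding assembly_relabel_eq_map_blocks map_blocks_map_blocks
    proof (rule map_blocks_cong)
      fix t b assume "b \<in> set (snd p t)"
      moreover obtain B g f bl where "b = (B, g)" "p = (f, bl)" by (metis surj_pair)
      ultimately have "b = (B, g)" "g \<in> structs (G t) B" "relabelling \<sigma> B"
        using p relabelling_subset[OF \<sigma>] by (auto dest: block_struct block_subset)
      then show "((\<lambda>(B, g). (relabel \<sigma> B, transport (G' t) B \<sigma> g)) \<circ> h t) b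
          = (h t \<circ> (\<lambda>(B, g). (relabel \<sigma> B, transport (G t) B \<sigma> g))) b"
        using naturalD[OF \<phi>(1)] by (simp add: h_def)
    qed
    then show "transport (species_comp F G') U \<sigma> (assembly_class F (map_blocks h p))
        = assembly_class F (map_blocks h (assembly_relabel G \<sigma> p))"
      using transport_comp[OF F h[OF p]] by simp
  qed
qed

subsection \<open>Adding a distinguished block\<close>

text \<open>The head of a list has position 0, which is the \<open>\<star>\<close> of the
  derivative, and the old blocks move to the successors. Hence a structure of the derivative on the
  old blocks is, unchanged, an \<open>F\<close>-structure on the new ones.\<close>

definition add_block :: "'t \<Rightarrow> 'c \<Rightarrow> 'a \<times> ('t \<Rightarrow> 'c list) \<Rightarrow> 'a \<times> ('t \<Rightarrow> 'c list)" where
  "add_block j b = (\<lambda>(f, bl). (f, bl(j := b # bl j)))"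

lemma block_labels_Cons: "block_labels (bl(j := b # l)) = add_star j (block_labels (bl(j := l)))"
proof -
  have "a |\<in>| block_labels (bl(j := b # l)) t \<longleftrightarrow> a |\<in>| add_star j (block_labels (bl(j := l))) t" for a t
    by (cases a) (auto simp: mem_block_labels mem_add_star)
  then show ?thesis by (intro ext fset_eqI) blast
qed

lemma add_block_assembly:
  fixes F :: "('t::finite, 'a) species"
  assumes p: "p \<in> assemblies (species_deriv j F) G A" and sp: "label_split U A B" and x: "x \<in> structs (G' j) B"
    and G: "\<And>t C. structs (G t) C \<subseteq> structs (G' t) C"
  shows "add_block j (B, x) p \<in> assemblies F G' U"
proof -
  obtain f bl where pe: "p = (f, bl)" by (metis surj_pair)
  note p = p[unfolded pe assemblies_iff]
  have "label_count (bl(j := (B, x) # bl j)) s a = 1" if a: "a |\<in>| U s" for s a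
  proof (cases "a |\<in>| B s")
    case True
    then have "a |\<notin>| A s" using sp by (auto simp: label_split_iff)
    then have "label_count bl s a = 0" unfolding label_count_eq_0_iff using p by fastforce
    then show ?thesis using True by (simp add: label_count_Cons)
  next
    case False
    then have "a |\<in>| A s" using sp a by (auto simp: label_split_iff)
    then show ?thesis using False p by (simp add: label_count_Cons)
  qed
  moreover have "g \<in> structs (G' t) C \<and> (\<forall>s. C s |\<subseteq>| U s)" if "(C, g) \<in> set ((bl(j := (B, x) # bl j)) t)" for t C g
  proof (cases "(C, g) \<in> set (bl t)")
    case True
    then show ?thesis using p G label_split_subset(1)[OF sp] by (meson subset_iff order_trans)
  next
    case False
    then have "t = j" "C = B" "g = x" using that by (auto split: if_splits)
    then show ?thesis using x label_split_subset(2)[OF sp] by blast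
  qed
  moreover have "f \<in> structs F (block_labels (bl(j := (B, x) # bl j)))"
    using p by (simp add: block_labels_Cons species_deriv_def)
  ultimately show ?thesis by (simp add: pe add_block_def assemblies_iff)
qed

lemma remove_block:
  fixes F :: "('t::finite, 'a) species"
  assumes p: "add_block j (B, x) p \<in> assemblies F G' U"
    and G: "\<And>t C g. (C, g) \<in> set (snd p t) \<Longrightarrow> g \<in> structs (G t) C"
  obtains A where "label_split U A B" "p \<in> assemblies (species_deriv j F) G A"
proof
  obtain f bl where pe: "p = (f, bl)" by (metis surj_pair)
  note p = p[unfolded pe add_block_def prod.case assemblies_iff]
  have "(B, x) \<in> set ((bl(j := (B, x) # bl j)) j)" by simp
  then have BU: "B s |\<subseteq>| U s" for s using p by blast
  define A where "A = (\<lambda>s. U s |-| B s)"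
  show "label_split U (\<lambda>s. U s |-| B s) B" using BU by (auto simp: label_split_iff)
  have count: "label_count bl s a = (if a |\<in>| B s then 0 else 1)" if "a |\<in>| U s" for s a
    using p that label_count_Cons[of bl j "(B, x)" "bl j" s a] by (auto split: if_splits)
  have "C s |\<subseteq>| A s" if Cg: "(C, g) \<in> set (bl t)" for C g t s
  proof
    fix a assume a: "a |\<in>| C s"
    have "(C, g) \<in> set ((bl(j := (B, x) # bl j)) t)" using Cg by auto
    then have aU: "a |\<in>| U s" using p a by blast
    have "label_count bl s a \<noteq> 0" unfolding label_count_eq_0_iff using a Cg by force
    then show "a |\<in>| A s" using count[OF aU] aU by (auto simp: A_def split: if_splits)
  qed
  moreover have "label_count bl s a = 1" if "a |\<in>| A s" for s a
    using count[of a s] that by (simp add: A_def)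
  moreover have "f \<in> structs (species_deriv j F) (block_labels bl)"
    using p by (simp add: block_labels_Cons species_deriv_def)
  ultimately show "p \<in> assemblies (species_deriv j F) G (\<lambda>s. U s |-| B s)"
    using G unfolding pe assemblies_iff A_def[symmetric] by auto
qed

lemma bij_betw_shift:
  assumes "bij_betw g {..<n} {..<n}"
  shows "bij_betw (case_nat 0 (\<lambda>a. Suc (g a))) {..<Suc n} {..<Suc n}"
proof -
  have "inj_on (case_nat 0 (\<lambda>a. Suc (g a))) {..<Suc n}"
    using assms by (auto simp: bij_betw_def inj_on_def split: nat.splits)
  moreover have "case_nat 0 (\<lambda>a. Suc (g a)) ` {..<Suc n} \<subseteq> {..<Suc n}"
    using bij_betwE[OF assms] by (auto split: nat.splits)
  ultimately show ?thesis by (simp add: bij_betw_def endo_inj_surj)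
qed

lemma bij_betw_unshift:
  assumes "bij_betw g {..<Suc n} {..<Suc n}" "g 0 = 0"
  shows "bij_betw (\<lambda>a. g (Suc a) - 1) {..<n} {..<n}" "\<And>a. a < n \<Longrightarrow> g (Suc a) = Suc (g (Suc a) - 1)"
proof -
  have inj: "inj_on g {..<Suc n}" using assms by (simp add: bij_betw_def)
  show pos: "g (Suc a) = Suc (g (Suc a) - 1)" if "a < n" for a
    using inj_onD[OF inj, of "Suc a" 0] assms(2) that by fastforce
  have "inj_on (\<lambda>a. g (Suc a) - 1) {..<n}"
  proof (rule inj_onI)
    fix a b assume ab: "a \<in> {..<n}" "b \<in> {..<n}" "g (Suc a) - 1 = g (Suc b) - 1"
    then have "g (Suc a) = g (Suc b)" using pos[of a] pos[of b] by simp
    then show "a = b" using inj_onD[OF inj, of "Suc a" "Suc b"] ab by simp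
  qed
  moreover have "g (Suc a) - 1 < n" if "a < n" for a
    using bij_betwE[OF assms(1)] pos[OF that] that by (metis Suc_less_eq lessThan_iff)
  then have "(\<lambda>a. g (Suc a) - 1) ` {..<n} \<subseteq> {..<n}" by auto
  ultimately show "bij_betw (\<lambda>a. g (Suc a) - 1) {..<n} {..<n}" by (simp add: bij_betw_def endo_inj_surj)
qed

lemma add_block_reorderings:
  assumes "q \<in> reorderings (species_deriv j F) p"
  shows "add_block j b q \<in> reorderings F (add_block j b p)"
proof -
  obtain f bl f' bl' where pq: "p = (f, bl)" "q = (f', bl')" by (metis surj_pair)
  then obtain \<pi> where \<pi>: "reorders \<pi> bl bl'" "f' = transport F (add_star j (block_labels bl)) (lift_star j \<pi>) f"
    using assms by (auto simp: mem_reorderings species_deriv_def)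
  have "reorders (lift_star j \<pi>) (bl(j := b # bl j)) (bl'(j := b # bl' j))"
    unfolding reorders_def
  proof (intro allI)
    fix t
    show "bij_betw (lift_star j \<pi> t) {..<length ((bl(j := b # bl j)) t)} {..<length ((bl(j := b # bl j)) t)} \<and>
      length ((bl'(j := b # bl' j)) t) = length ((bl(j := b # bl j)) t) \<and>
      (\<forall>k<length ((bl(j := b # bl j)) t). (bl'(j := b # bl' j)) t ! lift_star j \<pi> t k = (bl(j := b # bl j)) t ! k)"
    proof (cases "t = j")
      case True
      have "(b # bl' j) ! (case_nat 0 (\<lambda>a. Suc (\<pi> j a)) k) = (b # bl j) ! k" if "k < Suc (length (bl j))" for k
        using that reorders_nth[OF \<pi>(1)] by (cases k) auto
      then show ?thesis
        using True bij_betw_shift[OF reorders_bij[OF \<pi>(1), of j]] reorders_length[OF \<pi>(1), of j]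
        by (simp add: lift_star_def)
    next
      case False
      then show ?thesis
        using reorders_bij[OF \<pi>(1), of t] reorders_length[OF \<pi>(1), of t] reorders_nth[OF \<pi>(1), of _ t]
        by (simp add: lift_star_def)
    qed
  qed
  then show ?thesis
    using \<pi>(2) by (auto simp: pq add_block_def mem_reorderings block_labels_Cons)
qed

text \<open>The predicate \<open>bad\<close> marks the front block: no block of \<open>q\<close>
  satisfies it, so a reordering must take front block to front block. It then fixes the position
  that stands for \<open>\<star>\<close> and restricts to a reordering for the derivative. Without a
  mark, the front block could be exchanged with another one.\<close>

lemma add_block_reorderings_cancel:
  assumes F: "functorial F" and p: "well_labelled F (add_block j b p)"
    and q: "add_block j' b' q \<in> reorderings F (add_block j b p)"
    and bad: "bad j b" and good: "\<And>t c. c \<in> set (snd q t) \<Longrightarrow> \<not> bad t c"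
  shows "j' = j" "b' = b" "q \<in> reorderings (species_deriv j F) p"
proof -
  obtain f bl f' bl' where pq: "p = (f, bl)" "q = (f', bl')" by (metis surj_pair)
  let ?bl = "bl(j := b # bl j)" and ?bl' = "bl'(j' := b' # bl' j')"
  obtain \<pi> where \<pi>: "reorders \<pi> ?bl ?bl'" "f' = transport F (add_star j (block_labels bl)) \<pi> f"
    using q by (auto simp: mem_reorderings pq add_block_def block_labels_Cons)
  have at0: "?bl' j ! \<pi> j 0 = b" using reorders_nth[OF \<pi>(1), of 0 j] by simp
  have lt0: "\<pi> j 0 < length (?bl' j)"
    using reorders_lt[OF \<pi>(1), of 0 j] reorders_length[OF \<pi>(1), of j] by simp
  have notin: "b \<notin> set (bl' j)" using good[of b j] bad by (auto simp: pq)
  show j: "j' = j"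
    using at0 lt0 notin by (cases "j' = j") (auto simp: in_set_conv_nth)
  \<comment> \<open>Any other position would place the marked block among the blocks of
    \<open>q\<close>.\<close>
  have \<pi>0: "\<pi> j 0 = 0"
  proof (cases "\<pi> j 0")
    case (Suc k)
    then show ?thesis using at0 lt0 notin j by (auto simp: in_set_conv_nth)
  qed simp
  show b: "b' = b" using at0 \<pi>0 j by simp
  \<comment> \<open>As \<open>\<pi> j\<close> is injective and fixes 0, its values at successors are
    positive and the subtraction is exact.\<close>
  define \<rho> where "\<rho> = (\<lambda>t. if t = j then (\<lambda>a. \<pi> j (Suc a) - 1) else \<pi> t)"
  have bijj: "bij_betw (\<pi> j) {..<Suc (length (bl j))} {..<Suc (length (bl j))}"
    using reorders_bij[OF \<pi>(1), of j] by simp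
  note un = bij_betw_unshift[OF bijj \<pi>0]
  have "reorders \<rho> bl bl'"
    unfolding reorders_def
  proof (intro allI)
    fix t
    show "bij_betw (\<rho> t) {..<length (bl t)} {..<length (bl t)} \<and> length (bl' t) = length (bl t) \<and>
      (\<forall>k<length (bl t). bl' t ! \<rho> t k = bl t ! k)"
    proof (cases "t = j")
      case True
      have "bl' j ! (\<pi> j (Suc k) - 1) = bl j ! k" if "k < length (bl j)" for k
        using reorders_nth[OF \<pi>(1), of "Suc k" j] un(2)[OF that] that j by (metis fun_upd_same length_Cons nth_Cons_Suc Suc_less_eq)
      then show ?thesis
        using True un(1) reorders_length[OF \<pi>(1), of j] j by (simp add: \<rho>_def)
    next
      case False
      then show ?thesis
        using reorders_bij[OF \<pi>(1), of t] reorders_length[OF \<pi>(1), of t] reorders_nth[OF \<pi>(1), of _ t] j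
        by (simp add: \<rho>_def)
    qed
  qed
  moreover have "f' = transport F (add_star j (block_labels bl)) (lift_star j \<rho>) f"
    unfolding \<pi>(2)
  proof (rule functorial_cong[OF F])
    have *: "add_star j (block_labels bl) = block_labels ?bl" by (simp add: block_labels_Cons)
    show "relabelling \<pi> (add_star j (block_labels bl))" unfolding * by (rule reorders_block_labels(2)[OF \<pi>(1)])
    show "f \<in> structs F (add_star j (block_labels bl))" using p by (simp add: * well_labelled_def pq add_block_def)
    show "\<forall>t a. a |\<in>| add_star j (block_labels bl) t \<longrightarrow> \<pi> t a = lift_star j \<rho> t a"
      using un(2) \<pi>0 by (auto simp: mem_add_star mem_block_labels lift_star_def \<rho>_def)
  qed
  ultimately show "q \<in> reorderings (species_deriv j F) p"
    by (auto simp: pq mem_reorderings species_deriv_def)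
qed

lemma bring_to_front:
  assumes b: "b \<in> set (snd p j)"
  obtains q where "add_block j b q \<in> reorderings F p"
proof -
  obtain f bl where pe: "p = (f, bl)" by (metis surj_pair)
  obtain k where k: "k < length (bl j)" "bl j ! k = b" using b by (auto simp: pe in_set_conv_nth)
  \<comment> \<open>The transposition of 0 and \<open>k\<close> in sort \<open>j\<close>, which is
    its own inverse.\<close>
  define \<pi> where "\<pi> = (\<lambda>t. if t = j then (\<lambda>x. if x = 0 then k else if x = k then 0 else x) else id)"
  have "bij_betw (\<pi> t) {..<length (bl t)} {..<length (bl t)}" for t
    by (rule bij_betw_byWitness[where f' = "\<pi> t"]) (use k in \<open>auto simp: \<pi>_def\<close>)
  then obtain bl' where bl': "reorders \<pi> bl bl'" using reorders_exists by blast
  have "\<pi> j k = 0" by (simp add: \<pi>_def)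
  then have "bl' j ! 0 = b" using reorders_nth[OF bl' k(1)] k(2) by simp
  moreover have "bl' j \<noteq> []" using reorders_length[OF bl', of j] k(1) by auto
  ultimately have "bl' j = b # tl (bl' j)" by (cases "bl' j") auto
  then have "bl' = (bl'(j := tl (bl' j)))(j := b # (bl'(j := tl (bl' j))) j)" by (auto simp: fun_eq_iff)
  then have "add_block j b (transport F (block_labels bl) \<pi> f, bl'(j := tl (bl' j))) \<in> reorderings F p"
    using bl' by (auto simp: pe add_block_def mem_reorderings)
  then show thesis by (rule that)
qed

lemma assembly_relabel_add_block:
  "assembly_relabel G \<sigma> (add_block j (B, x) p) = add_block j (relabel \<sigma> B, transport (G j) B \<sigma> x) (assembly_relabel G \<sigma> p)"
  by (cases p) (auto simp: assembly_relabel_def add_block_def fun_eq_iff)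

section \<open>Solutions as algebras of trees\<close>

lemma functorial_at_ZY: "(\<And>i. functorial (Y i)) \<Longrightarrow> functorial (at_ZY Y t)"
  by (cases t) (auto simp: at_ZY_def functorial_atom)

lemma species_iso_at_ZY: "(\<And>i. species_iso (Y i) (Y' i)) \<Longrightarrow> species_iso (at_ZY Y t) (at_ZY Y' t)"
  by (cases t) (auto simp: at_ZY_def species_iso_refl)

lemma functorial_system_apply:
  "(\<And>i. is_species (H i)) \<Longrightarrow> (\<And>i. functorial (Y i)) \<Longrightarrow> functorial (system_apply H Y i)"
  unfolding system_apply_def by (intro functorial_coded functorial_species_comp functorial_at_ZY)

lemma iterate_0 [simp]: "iterate H 0 = vec_zero" and iterate_Suc: "iterate H (Suc n) = system_apply H (iterate H n)"
  by (simp_all add: iterate_def)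

lemma functorial_iterate:
  assumes "\<And>i. is_species (H i)" shows "functorial (iterate H n i)"
proof (induction n arbitrary: i)
  case (Suc n)
  then show ?case by (simp add: iterate_Suc functorial_system_apply assms)
qed (simp add: vec_zero_def functorial_zero)

lemma system_apply_cong:
  assumes "\<And>i. is_species (H i)" "\<And>i. functorial (Y i)" "\<And>i. species_iso (Y i) (Y' i)"
  shows "species_iso (system_apply H Y i) (system_apply H Y' i)"
  unfolding system_apply_def
  by (intro species_iso_trans[OF coded_iso(1)] species_iso_trans[OF _ coded_iso(2)] species_comp_cong
      functorial_at_ZY species_iso_at_ZY assms)

text \<open>
  A solution \<open>S\<close> presented through its trees: \<open>node i U p\<close> is the \<open>S i\<close>-structure with root assembly \<open>p\<close>.
\<close>

locale tree_algebra =
  fixes H :: "('z::finite, 'm::finite) system" and S :: "('z, 'm) species_vec"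
    and node :: "'m \<Rightarrow> 'z labels \<Rightarrow> ('z, 'z + 'm, nat, nat) assembly \<Rightarrow> nat"
  assumes H: "\<And>i. is_species (H i)"
    and S: "\<And>i. is_species (S i)"
    and node_image: "\<And>i U. node i U ` assemblies (H i) (at_ZY S) U = structs (S i) U"
    and node_eq_iff: "\<And>i U p q. p \<in> assemblies (H i) (at_ZY S) U \<Longrightarrow> q \<in> assemblies (H i) (at_ZY S) U
      \<Longrightarrow> node i U p = node i U q \<longleftrightarrow> q \<in> reorderings (H i) p"
    and node_transport: "\<And>i U \<sigma> p. relabelling \<sigma> U \<Longrightarrow> p \<in> assemblies (H i) (at_ZY S) U
      \<Longrightarrow> transport (S i) U \<sigma> (node i U p) = node i (relabel \<sigma> U) (assembly_relabel (at_ZY S) \<sigma> p)"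
begin

section \<open>Subspecies of a solution as invariant sets of trees\<close>

lemma functorial_H: "functorial (H i)" and functorial_S: "functorial (S i)"
  and finite_S: "finite (structs (S i) U)"
  using H S by (auto simp: is_species_iff_functorial)

text \<open>Subspecies of \<open>S\<close> are handled as literal subsets with the transport of
  \<open>S\<close>, so that unions, differences and disjointness are those of sets.\<close>

definition sub :: "('m \<Rightarrow> 'z labels \<Rightarrow> nat set) \<Rightarrow> ('z, 'm) species_vec" where
  "sub X i = (S i)\<lparr>structs := X i\<rparr>"

lemma sub_simps [simp]: "structs (sub X i) = X i" "transport (sub X i) = transport (S i)"
  by (simp_all add: sub_def)

abbreviation all_assemblies where
  "all_assemblies i \<equiv> assemblies (H i) (at_ZY S)"

abbreviation assemblies_in where
  "assemblies_in X i \<equiv> assemblies (H i) (at_ZY (sub X))"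

abbreviation contexts where
  "contexts X i j \<equiv> assemblies (species_deriv (Inr j) (H i)) (at_ZY (sub X))"

definition invariant :: "('m \<Rightarrow> 'z labels \<Rightarrow> nat set) \<Rightarrow> bool" where
  "invariant X \<longleftrightarrow> (\<forall>i U. X i U \<subseteq> structs (S i) U) \<and>
     (\<forall>i U \<sigma>. relabelling \<sigma> U \<longrightarrow> (\<forall>x\<in>X i U. transport (S i) U \<sigma> x \<in> X i (relabel \<sigma> U)))"

lemma invariant_subset: "invariant X \<Longrightarrow> x \<in> X i U \<Longrightarrow> x \<in> structs (S i) U"
  unfolding invariant_def by blast

lemma invariant_transport:
  "invariant X \<Longrightarrow> relabelling \<sigma> U \<Longrightarrow> x \<in> X i U \<Longrightarrow> transport (S i) U \<sigma> x \<in> X i (relabel \<sigma> U)"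
  unfolding invariant_def by blast

text \<open>The converse direction transports back along the inverse relabelling. It is what makes a
  difference of two invariant sets invariant.\<close>

lemma invariant_transport_iff:
  assumes X: "invariant X" and \<sigma>: "relabelling \<sigma> U" and x: "x \<in> structs (S i) U"
  shows "transport (S i) U \<sigma> x \<in> X i (relabel \<sigma> U) \<longleftrightarrow> x \<in> X i U"
proof
  assume *: "transport (S i) U \<sigma> x \<in> X i (relabel \<sigma> U)"
  define \<tau> where "\<tau> s = inv_into (fset (U s)) (\<sigma> s)" for s
  have inj: "inj_on (\<sigma> s) (fset (U s))" for s using \<sigma> by (simp add: relabelling_def)
  have \<tau>: "relabelling \<tau> (relabel \<sigma> U)"
    using inj by (auto simp: relabelling_def relabel_def \<tau>_def intro!: inj_on_inv_into)
  have id: "\<forall>s a. a |\<in>| U s \<longrightarrow> (\<tau> s \<circ> \<sigma> s) a = id a"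
    using inj by (simp add: \<tau>_def)
  have inverse: "transport (S i) (relabel \<sigma> U) \<tau> (transport (S i) U \<sigma> x) = x"
    using functorial_comp[OF functorial_S \<sigma> \<tau> x] functorial_id[OF functorial_S x]
      functorial_cong[OF functorial_S relabelling_compose[OF \<sigma> \<tau>] id x] by (simp add: id_def)
  have "relabel \<tau> (relabel \<sigma> U) = U"
    unfolding relabel_relabel using relabel_cong[of U "\<lambda>s. \<tau> s \<circ> \<sigma> s" "\<lambda>s. id"] id by simp
  then show "x \<in> X i U" using invariant_transport[OF X \<tau> *] inverse by simp
qed (rule invariant_transport[OF X \<sigma>])

lemma functorial_sub: "invariant X \<Longrightarrow> functorial (sub X i)"
  by (rule functorialI)
    (use functorial_S[of i] in \<open>auto dest: invariant_transport intro: functorial_cong functorial_id functorial_comp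
      dest: invariant_subset\<close>)

lemma finite_invariant: "invariant X \<Longrightarrow> finite (X i U)"
  using finite_S finite_subset unfolding invariant_def by metis

lemma is_species_sub: "invariant X \<Longrightarrow> is_species (sub X i)"
  by (simp add: is_species_iff_functorial functorial_sub finite_invariant)

lemma functorial_at_ZY_sub: "invariant X \<Longrightarrow> functorial (at_ZY (sub X) t)"
  by (intro functorial_at_ZY functorial_sub)

lemma at_ZY_sub_mono: "(\<And>i B. X i B \<subseteq> Y i B) \<Longrightarrow> structs (at_ZY (sub X) t) B \<subseteq> structs (at_ZY (sub Y) t) B"
  by (cases t) (auto simp: at_ZY_def)

lemma at_ZY_sub_subset: "invariant X \<Longrightarrow> structs (at_ZY (sub X) t) B \<subseteq> structs (at_ZY S t) B"
  by (cases t) (auto simp: at_ZY_def dest: invariant_subset)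

lemma transport_at_ZY_sub: "transport (at_ZY (sub X) t) = transport (at_ZY S t)"
  by (cases t) (auto simp: at_ZY_def)

lemma assembly_relabel_sub: "assembly_relabel (at_ZY (sub X)) \<sigma> = assembly_relabel (at_ZY S) \<sigma>"
  by (simp add: assembly_relabel_def transport_at_ZY_sub)

lemma assemblies_sub_subset:
  "invariant X \<Longrightarrow> p \<in> assemblies F (at_ZY (sub X)) U \<Longrightarrow> p \<in> assemblies F (at_ZY S) U"
  using assemblies_mono[of "at_ZY (sub X)" "at_ZY S"] at_ZY_sub_subset by blast

lemma assemblies_sub_iff:
  assumes "p \<in> assemblies F (at_ZY S) U"
  shows "p \<in> assemblies F (at_ZY (sub X)) U \<longleftrightarrow> (\<forall>i B g. (B, g) \<in> set (snd p (Inr i)) \<longrightarrow> g \<in> X i B)"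
proof -
  have "(\<forall>t B g. (B, g) \<in> set (snd p t) \<longrightarrow> g \<in> structs (at_ZY (sub X) t) B) \<longleftrightarrow>
      (\<forall>i B g. (B, g) \<in> set (snd p (Inr i)) \<longrightarrow> g \<in> X i B)"
    (is "?L \<longleftrightarrow> ?R")
  proof
    show ?R if ?L using that[rule_format, of _ _ "Inr _"] by (simp add: at_ZY_def)
    show ?L if ?R
    proof (intro allI impI)
      fix t B g assume b: "(B, g) \<in> set (snd p t)"
      have "g \<in> structs (at_ZY S t) B" using assms b by (cases p) (auto dest: block_struct)
      then show "g \<in> structs (at_ZY (sub X) t) B" using b that by (cases t) (auto simp: at_ZY_def)
    qed
  qed
  then show ?thesis using assms by (cases p) (auto simp: assemblies_iff)
qed

text \<open>The system applied to the subspecies \<open>X\<close>, carried back into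
  \<open>S\<close> by \<open>node\<close>.\<close>

definition step :: "('m \<Rightarrow> 'z labels \<Rightarrow> nat set) \<Rightarrow> 'm \<Rightarrow> 'z labels \<Rightarrow> nat set" where
  "step X i U = node i U ` assemblies_in X i U"

lemma step_mono: "(\<And>i B. X i B \<subseteq> Y i B) \<Longrightarrow> step X i U \<subseteq> step Y i U"
  unfolding step_def by (intro image_mono assemblies_mono at_ZY_sub_mono)

lemma invariant_step: assumes X: "invariant X" shows "invariant (step X)"
  unfolding invariant_def
proof (intro conjI allI impI ballI)
  show "step X i U \<subseteq> structs (S i) U" for i U
    unfolding step_def node_image[symmetric] using assemblies_sub_subset[OF X] by blast
  fix i U \<sigma> x assume \<sigma>: "relabelling \<sigma> U" and "x \<in> step X i U"
  then obtain p where p: "p \<in> assemblies_in X i U" "x = node i U p" by (auto simp: step_def)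
  have "assembly_relabel (at_ZY S) \<sigma> p \<in> assemblies_in X i (relabel \<sigma> U)"
    using assembly_relabel_closed[OF functorial_at_ZY_sub[OF X] \<sigma> p(1)] by (simp add: assembly_relabel_sub)
  then show "transport (S i) U \<sigma> x \<in> step X i (relabel \<sigma> U)"
    using node_transport[OF \<sigma> assemblies_sub_subset[OF X p(1)]] p(2) by (simp add: step_def)
qed

lemma node_in_step_iff:
  assumes X: "invariant X" and p: "p \<in> all_assemblies i U"
  shows "node i U p \<in> step X i U \<longleftrightarrow> p \<in> assemblies_in X i U"
proof
  assume "node i U p \<in> step X i U"
  then obtain q where q: "q \<in> assemblies_in X i U" "node i U q = node i U p" by (auto simp: step_def)
  then have "p \<in> reorderings (H i) q" using node_eq_iff[OF assemblies_sub_subset[OF X q(1)] p] by simp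
  then show "p \<in> assemblies_in X i U" using reorderings_closed[OF functorial_H q(1)] by blast
qed (simp add: step_def)

lemma system_apply_sub_iso:
  assumes X: "invariant X" shows "species_iso (system_apply H (sub X) i) (sub (step X) i)"
  unfolding system_apply_def
proof (rule species_iso_trans[OF coded_iso(1)], rule species_comp_isoI[OF H, where \<nu> = "node i"])
  show "node i U ` assemblies_in X i U = structs (sub (step X) i) U" for U
    by (simp add: step_def)
  show "functorial (at_ZY (sub X) t)" for t by (rule functorial_at_ZY_sub[OF X])
qed (simp_all add: node_eq_iff node_transport assemblies_sub_subset[OF X] assembly_relabel_sub)

text \<open>The trees of height at most \<open>n\<close>, a node without children of the sorts of
  \<open>Y\<close> having height 1. They realise inside \<open>S\<close> the iteration that defines
  well-foundedness.\<close>

definition trees :: "nat \<Rightarrow> 'm \<Rightarrow> 'z labels \<Rightarrow> nat set" where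
  "trees n = (step ^^ n) (\<lambda>i U. {})"

lemma trees_0 [simp]: "trees 0 i U = {}" and trees_Suc: "trees (Suc n) = step (trees n)"
  by (simp_all add: trees_def)

lemma invariant_trees: "invariant (trees n)"
  by (induction n) (simp_all add: trees_Suc invariant_step, simp add: invariant_def)

lemma trees_Suc_mono: "trees n i U \<subseteq> trees (Suc n) i U"
proof (induction n arbitrary: i U)
  case (Suc n)
  have "step (trees n) i U \<subseteq> step (trees (Suc n)) i U" by (rule step_mono) (rule Suc)
  then show ?case by (simp only: trees_Suc[symmetric])
qed simp

lemma trees_mono: "n \<le> k \<Longrightarrow> trees n i U \<subseteq> trees k i U"
  by (rule lift_Suc_mono_le[where f = "\<lambda>n. trees n i U"]) (auto intro: trees_Suc_mono[THEN subsetD])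

lemma iterate_iso: "species_iso (iterate H n i) (sub (trees n) i)"
proof (induction n arbitrary: i)
  case 0
  show ?case
    by (rule species_iso_identity) (auto simp: vec_zero_def species_zero_def)
next
  case (Suc n)
  have "species_iso (system_apply H (iterate H n) i) (system_apply H (sub (trees n)) i)"
    by (rule system_apply_cong[OF H functorial_iterate[OF H] Suc])
  also have "species_iso \<dots> (sub (trees (Suc n)) i)"
    unfolding trees_Suc by (rule system_apply_sub_iso[OF invariant_trees])
  finally show ?case by (simp add: iterate_Suc)
qed

subsection \<open>Nodes with one distinguished child\<close>

text \<open>The Jacobian at \<open>P\<close> times the vector \<open>Q\<close>, realised inside
  \<open>S\<close>: the front child is taken from \<open>Q\<close> and the remaining ones from
  \<open>P\<close>.\<close>

definition plug :: "('m \<Rightarrow> 'z labels \<Rightarrow> nat set) \<Rightarrow> ('m \<Rightarrow> 'z labels \<Rightarrow> nat set) \<Rightarrow> 'm \<Rightarrow> 'z labels \<Rightarrow> nat set" where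
  "plug P Q i U = {node i U (add_block (Inr j) (B, y) p) |j A B y p.
     label_split U A B \<and> p \<in> contexts P i j A \<and> y \<in> Q j B}"

lemma add_block_in_assemblies:
  assumes "p \<in> contexts P i j A" "label_split U A B"
    "y \<in> X j B" "\<And>k C. P k C \<subseteq> X k C"
  shows "add_block (Inr j) (B, y) p \<in> assemblies_in X i U"
  by (rule add_block_assembly[OF assms(1,2)]) (use assms(3,4) at_ZY_sub_mono in \<open>auto simp: at_ZY_def\<close>)

lemma add_block_in_assemblies_S:
  assumes P: "invariant P" and "p \<in> contexts P i j A" "label_split U A B"
    "y \<in> structs (S j) B"
  shows "add_block (Inr j) (B, y) p \<in> all_assemblies i U"
  by (rule add_block_assembly[OF assms(2,3)]) (use assms(4) at_ZY_sub_subset[OF P] in \<open>auto simp: at_ZY_def\<close>)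

text \<open>The child \<open>y\<close> lies outside \<open>P\<close> and the others lie in
  \<open>P\<close>, so the marked child can be read off from the tree.\<close>

lemma node_add_block_inject:
  assumes P: "invariant P"
    and p: "p \<in> contexts P i j A" "label_split U A B"
      "y \<in> structs (S j) B" "y \<notin> P j B"
    and q: "q \<in> contexts P i k C" "label_split U C D" "z \<in> structs (S k) D"
    and eq: "node i U (add_block (Inr j) (B, y) p) = node i U (add_block (Inr k) (D, z) q)"
  shows "k = j" "D = B" "z = y" "C = A" "q \<in> reorderings (species_deriv (Inr j) (H i)) p"
proof -
  note pS = add_block_in_assemblies_S[OF P p(1-3)] and qS = add_block_in_assemblies_S[OF P q]
  have r: "add_block (Inr k) (D, z) q \<in> reorderings (H i) (add_block (Inr j) (B, y) p)"
    using node_eq_iff[OF pS qS] eq by simp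
  \<comment> \<open>The mark is to be a child outside \<open>P\<close>; blocks that carry atoms
    never have it.\<close>
  define bad where "bad t b \<longleftrightarrow> (\<exists>m. t = Inr m \<and> snd b \<notin> P m (fst b))" for t :: "'z + 'm" and b :: "'z labels \<times> nat"
  have b: "bad (Inr j) (B, y)" using p(4) by (simp add: bad_def)
  have g: "\<not> bad t c" if "c \<in> set (snd q t)" for t c
  proof -
    obtain E g f bl where "c = (E, g)" "q = (f, bl)" by (metis surj_pair)
    then have "g \<in> structs (at_ZY (sub P) t) E" using q(1) that by (auto dest: block_struct)
    then show ?thesis using \<open>c = (E, g)\<close> by (auto simp: bad_def at_ZY_def)
  qed
  note c = add_block_reorderings_cancel[where bad = bad, OF functorial_H well_labelled_assembly[OF pS] r b g]
  show "k = j" "D = B" "z = y" using c by auto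
  show "q \<in> reorderings (species_deriv (Inr j) (H i)) p" by (rule c(3))
  show "C = A" using label_split_eq_left p(2) q(2) \<open>D = B\<close> by metis
qed

text \<open>A structure on the left is a node with one child from \<open>Q\<close> marked.
  Disjointness of \<open>P\<close> and \<open>Q\<close> makes the mark recoverable, so forgetting it
  is injective and each tree is counted once.\<close>

lemma plug_iso:
  assumes P: "invariant P" and Q: "invariant Q" and disj: "\<And>j B. P j B \<inter> Q j B = {}"
  shows "species_iso (species_Sum (\<lambda>j. species_mult
      (species_comp (species_deriv (Inr j) (H i)) (at_ZY (sub P))) (sub Q j))) (sub (plug P Q) i)"
proof -
  let ?F = "\<lambda>j. species_deriv (Inr j) (H i)" and ?G = "at_ZY (sub P)"
  let ?K = "species_Sum (\<lambda>j. species_mult (species_comp (?F j) ?G) (sub Q j))"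
  have F: "is_species (?F j)" for j by (rule is_species_deriv[OF H])
  \<comment> \<open>The product contains a class of assemblies, and a node is built from an
    assembly. The resulting node is independent of the representative because
    \<open>add_block\<close> turns reorderings into reorderings.\<close>
  define rep where "rep j A c = (SOME p. p \<in> assemblies (?F j) ?G A \<and> c = assembly_class (?F j) p)" for j A c
  define \<nu> where "\<nu> U = (\<lambda>(j, ((A, c), (B, y))). node i U (add_block (Inr j) (B, y) (rep j A c)))" for U
  have mem: "x \<in> structs ?K U \<longleftrightarrow> (\<exists>j A p B y. x = (j, ((A, assembly_class (?F j) p), (B, y))) \<and>
      p \<in> assemblies (?F j) ?G A \<and> label_split U A B \<and> y \<in> Q j B)" for x U
    by (auto simp: species_Sum_def structs_mult structs_comp; blast)
  have \<nu>: "\<nu> U (j, ((A, assembly_class (?F j) p), (B, y))) = node i U (add_block (Inr j) (B, y) p)"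
    if p: "p \<in> assemblies (?F j) ?G A" "label_split U A B" "y \<in> Q j B" for U j A p B y
  proof -
    define q where "q = rep j A (assembly_class (?F j) p)"
    have q: "q \<in> assemblies (?F j) ?G A \<and> assembly_class (?F j) p = assembly_class (?F j) q"
      unfolding q_def rep_def by (rule someI) (use p(1) in simp)
    then have "q \<in> reorderings (?F j) p"
      using assembly_class_eq_iff[OF F] well_labelled_assembly p(1) by blast
    then have "add_block (Inr j) (B, y) q \<in> reorderings (H i) (add_block (Inr j) (B, y) p)"
      by (rule add_block_reorderings)
    moreover have y: "y \<in> structs (S j) B" using invariant_subset[OF Q p(3)] .
    ultimately have "node i U (add_block (Inr j) (B, y) p) = node i U (add_block (Inr j) (B, y) q)"
      using node_eq_iff[OF add_block_in_assemblies_S[OF P p(1,2) y] add_block_in_assemblies_S[OF P _ p(2) y]] q by blast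
    then show ?thesis by (simp add: \<nu>_def q_def)
  qed
  show ?thesis
  proof (rule species_isoI[where \<phi> = \<nu>])
    fix U
    show "bij_betw (\<nu> U) (structs ?K U) (structs (sub (plug P Q) i) U)"
      unfolding bij_betw_def
    proof
      show "inj_on (\<nu> U) (structs ?K U)"
      proof (rule inj_onI)
        fix x x' assume "x \<in> structs ?K U" "x' \<in> structs ?K U" and eq: "\<nu> U x = \<nu> U x'"
        then obtain j A p B y k C q D z where
          x: "x = (j, ((A, assembly_class (?F j) p), (B, y)))" "p \<in> assemblies (?F j) ?G A" "label_split U A B" "y \<in> Q j B" and
          x': "x' = (k, ((C, assembly_class (?F k) q), (D, z)))" "q \<in> assemblies (?F k) ?G C" "label_split U C D" "z \<in> Q k D"
          unfolding mem by blast
        have "node i U (add_block (Inr j) (B, y) p) = node i U (add_block (Inr k) (D, z) q)"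
          using eq x x' by (simp add: \<nu>)
        moreover have "y \<notin> P j B" using x(4) disj by blast
        ultimately have *: "k = j" "D = B" "z = y" "C = A" "q \<in> reorderings (?F j) p"
          using node_add_block_inject[OF P x(2,3) invariant_subset[OF Q x(4)] _ x'(2,3) invariant_subset[OF Q x'(4)]] by blast+
        then have "assembly_class (?F j) p = assembly_class (?F j) q"
          using assembly_class_eq_iff[OF F] well_labelled_assembly x(2) x'(2) by metis
        then show "x = x'" using x x' * by simp
      qed
      show "\<nu> U ` structs ?K U = structs (sub (plug P Q) i) U"
      proof (intro subset_antisym subsetI)
        fix w assume "w \<in> \<nu> U ` structs ?K U"
        then obtain j A p B y where w: "w = \<nu> U (j, ((A, assembly_class (?F j) p), (B, y)))"
          "p \<in> assemblies (?F j) ?G A" "label_split U A B" "y \<in> Q j B" unfolding image_iff Bex_def mem by blast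
        then have "w = node i U (add_block (Inr j) (B, y) p)" by (simp add: \<nu>)
        with w(2-4) show "w \<in> structs (sub (plug P Q) i) U" unfolding plug_def sub_simps by blast
      next
        fix w assume "w \<in> structs (sub (plug P Q) i) U"
        then obtain j A p B y where w: "w = node i U (add_block (Inr j) (B, y) p)"
          "p \<in> assemblies (?F j) ?G A" "label_split U A B" "y \<in> Q j B" by (auto simp: plug_def)
        show "w \<in> \<nu> U ` structs ?K U"
          by (rule image_eqI[of _ _ "(j, ((A, assembly_class (?F j) p), (B, y)))"])
            (use w in \<open>simp add: \<nu>\<close>, use w in \<open>unfold mem, blast\<close>)
      qed
    qed
  next
    fix U \<sigma> x assume \<sigma>: "relabelling \<sigma> U" and "x \<in> structs ?K U"
    then obtain j A p B y where x: "x = (j, ((A, assembly_class (?F j) p), (B, y)))"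
      "p \<in> assemblies (?F j) ?G A" "label_split U A B" "y \<in> Q j B" unfolding mem by blast
    note sp = label_split_relabel[OF x(3) \<sigma>]
    have p': "assembly_relabel (at_ZY S) \<sigma> p \<in> assemblies (?F j) ?G (relabel \<sigma> A)"
      using assembly_relabel_closed[OF functorial_at_ZY_sub[OF P] sp(2) x(2)] by (simp add: assembly_relabel_sub)
    have "transport ?K U \<sigma> x = (j, ((relabel \<sigma> A, assembly_class (?F j) (assembly_relabel (at_ZY S) \<sigma> p)),
        (relabel \<sigma> B, transport (S j) B \<sigma> y)))"
      using transport_comp[OF F x(2), of \<sigma>] by (simp add: x(1) species_Sum_def assembly_relabel_sub)
    then have "\<nu> (relabel \<sigma> U) (transport ?K U \<sigma> x) = node i (relabel \<sigma> U)
        (add_block (Inr j) (relabel \<sigma> B, transport (S j) B \<sigma> y) (assembly_relabel (at_ZY S) \<sigma> p))"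
      using \<nu>[OF p' sp(1) invariant_transport[OF Q sp(3) x(4)]] by simp
    also have "\<dots> = transport (S i) U \<sigma> (node i U (add_block (Inr j) (B, y) p))"
      using node_transport[OF \<sigma> add_block_in_assemblies_S[OF P x(2,3) invariant_subset[OF Q x(4)]]]
      by (simp add: assembly_relabel_add_block at_ZY_def)
    also have "\<dots> = transport (sub (plug P Q) i) U \<sigma> (\<nu> U x)" using \<nu>[OF x(2-4)] by (simp add: x(1))
    finally show "\<nu> (relabel \<sigma> U) (transport ?K U \<sigma> x) = transport (sub (plug P Q) i) U \<sigma> (\<nu> U x)" .
  qed
qed

end

section \<open>Functoriality of the Jacobian and of the Newton operator\<close>

lemma is_species_functorial: "is_species F \<Longrightarrow> functorial F"
  by (simp add: is_species_iff_functorial)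

lemma jacobian_functorial:
  "(\<And>i. is_species (H i)) \<Longrightarrow> (\<And>i. functorial (Y i)) \<Longrightarrow> functorial (jacobian H Y i j)"
  unfolding jacobian_def
  by (intro functorial_coded functorial_species_comp is_species_deriv functorial_at_ZY)

lemma mat_power_0 [simp]: "mat_power J 0 = mat_one"
  and mat_power_Suc: "mat_power J (Suc k) = mat_mult J (mat_power J k)"
  by (simp_all add: mat_power_def)

lemma mat_power_functorial: "(\<And>i j. functorial (J i j)) \<Longrightarrow> functorial (mat_power J k i j)"
  by (induction k arbitrary: i j)
    (auto simp: mat_power_Suc mat_mult_def mat_one_def functorial_one functorial_zero
      intro!: functorial_coded functorial_Sum functorial_mult)

lemma functorial_newton:
  assumes H: "\<And>i. is_species (H i)" and Y: "\<And>i. functorial (Y i)"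
    and D: "\<And>j. functorial (species_diff (system_apply H Y j) (Y j))"
  shows "functorial (newton H Y i)"
  unfolding newton_def mat_vec_mult_def mat_power_sum_def
  by (intro functorial_coded functorial_add functorial_Sum functorial_mult mat_power_functorial
      jacobian_functorial H Y D)

context tree_algebra
begin

section \<open>The Newton operator on sets of trees\<close>

lemma invariant_plug:
  assumes P: "invariant P" and Q: "invariant Q" shows "invariant (plug P Q)"
  unfolding invariant_def
proof (intro conjI allI impI ballI subsetI)
  fix i U x assume "x \<in> plug P Q i U"
  then obtain j A B y p where x: "x = node i U (add_block (Inr j) (B, y) p)" "label_split U A B"
    "p \<in> contexts P i j A" "y \<in> Q j B"
    unfolding plug_def by blast
  note a = add_block_in_assemblies_S[OF P x(3,2) invariant_subset[OF Q x(4)]]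
  show "x \<in> structs (S i) U" using a x(1) node_image by blast
  fix \<sigma> assume \<sigma>: "relabelling \<sigma> U"
  note sp = label_split_relabel[OF x(2) \<sigma>]
  have "assembly_relabel (at_ZY S) \<sigma> p \<in> contexts P i j (relabel \<sigma> A)"
    using assembly_relabel_closed[OF functorial_at_ZY_sub[OF P] sp(2) x(3)] by (simp add: assembly_relabel_sub)
  moreover have "transport (S i) U \<sigma> x = node i (relabel \<sigma> U)
      (add_block (Inr j) (relabel \<sigma> B, transport (S j) B \<sigma> y) (assembly_relabel (at_ZY S) \<sigma> p))"
    using node_transport[OF \<sigma> a] x(1) by (simp add: assembly_relabel_add_block at_ZY_def)
  ultimately show "transport (S i) U \<sigma> x \<in> plug P Q i (relabel \<sigma> U)"
    using sp(1) invariant_transport[OF Q sp(3) x(4)] unfolding plug_def by blast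
qed

lemma invariant_diff: "invariant X \<Longrightarrow> invariant Y \<Longrightarrow> invariant (\<lambda>i U. X i U - Y i U)"
  using invariant_transport_iff[of Y] unfolding invariant_def by blast

lemma invariant_Un: "invariant X \<Longrightarrow> invariant Y \<Longrightarrow> invariant (\<lambda>i U. X i U \<union> Y i U)"
  unfolding invariant_def by blast

lemma invariant_UN:
  assumes "\<And>k. invariant (X k)" shows "invariant (\<lambda>i U. \<Union>k. X k i U)"
proof -
  have "x \<in> structs (S i) U" if "x \<in> X k i U" for x i U k
    by (rule invariant_subset[OF assms that])
  moreover have "transport (S i) U \<sigma> x \<in> X k i (relabel \<sigma> U)" if "relabelling \<sigma> U" "x \<in> X k i U" for x i U k \<sigma>
    by (rule invariant_transport[OF assms that])
  ultimately show ?thesis unfolding invariant_def UN_iff UN_subset_iff by blast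
qed

text \<open>The term with exponent \<open>k\<close> of the Newton operator: a path with
  \<open>k\<close> edges, each leading to the only child outside \<open>P\<close>, that ends at a
  node outside \<open>P\<close> whose children all lie in \<open>P\<close>.\<close>

definition level :: "('m \<Rightarrow> 'z labels \<Rightarrow> nat set) \<Rightarrow> nat \<Rightarrow> 'm \<Rightarrow> 'z labels \<Rightarrow> nat set" where
  "level P k = (plug P ^^ k) (\<lambda>i U. step P i U - P i U)"

lemma level_0: "level P 0 = (\<lambda>i U. step P i U - P i U)" and level_Suc: "level P (Suc k) = plug P (level P k)"
  by (simp_all add: level_def)

definition newton_set :: "('m \<Rightarrow> 'z labels \<Rightarrow> nat set) \<Rightarrow> 'm \<Rightarrow> 'z labels \<Rightarrow> nat set" where
  "newton_set P i U = P i U \<union> (\<Union>k. level P k i U)"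

lemma invariant_level: "invariant P \<Longrightarrow> invariant (level P k)"
  by (induction k) (simp_all add: level_0 level_Suc invariant_diff invariant_step invariant_plug)

lemma invariant_newton_set: "invariant P \<Longrightarrow> invariant (newton_set P)"
  unfolding newton_set_def[abs_def] by (intro invariant_Un invariant_UN invariant_level)

lemma snd_add_block: "snd (add_block j b p) = (snd p)(j := b # snd p j)"
  by (cases p) (simp add: add_block_def)

lemma node_add_block_notin_step:
  assumes P: "invariant P" and X: "invariant X"
    and p: "p \<in> contexts P i j A" "label_split U A B"
      "y \<in> structs (S j) B" "y \<notin> X j B"
  shows "node i U (add_block (Inr j) (B, y) p) \<notin> step X i U"
proof -
  note a = add_block_in_assemblies_S[OF P p(1-3)]
  have "(B, y) \<in> set (snd (add_block (Inr j) (B, y) p) (Inr j))" by (simp add: snd_add_block)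
  then show ?thesis using node_in_step_iff[OF X a] assemblies_sub_iff[OF a, of X] p(4) by blast
qed

lemma plug_notin_step:
  assumes P: "invariant P" and Q: "invariant Q" and disj: "\<And>j B. P j B \<inter> Q j B = {}" and x: "x \<in> plug P Q i U"
  shows "x \<notin> step P i U"
proof -
  obtain j A B y p where x: "x = node i U (add_block (Inr j) (B, y) p)" "label_split U A B"
    "p \<in> contexts P i j A" "y \<in> Q j B"
    using x unfolding plug_def by blast
  have "y \<notin> P j B" using disj x(4) by blast
  then show ?thesis using node_add_block_notin_step[OF P P x(3,2) invariant_subset[OF Q x(4)]] x(1) by blast
qed

text \<open>By \<open>PH\<close> the children of an element of \<open>P\<close> lie in
  \<open>P\<close>, whereas an element of a positive level has a child outside \<open>P\<close>;
  level 0 avoids \<open>P\<close> by its definition.\<close>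

lemma level_disjoint_base:
  assumes P: "invariant P" and PH: "\<And>i U. P i U \<subseteq> step P i U"
  shows "P i U \<inter> level P k i U = {}"
proof (induction k arbitrary: i U)
  case (Suc k)
  then show ?case using plug_notin_step[OF P invariant_level[OF P]] PH unfolding level_Suc by blast
qed (auto simp: level_0)

text \<open>At each node the path continues to the only child outside \<open>P\<close>, so the tree
  determines the path and hence its length.\<close>

lemma level_disjoint:
  assumes P: "invariant P" and PH: "\<And>i U. P i U \<subseteq> step P i U" and "k \<noteq> l"
  shows "level P k i U \<inter> level P l i U = {}"
  using \<open>k \<noteq> l\<close>
proof (induction k arbitrary: l i U)
  case 0
  then obtain l' where "l = Suc l'" by (cases l) auto
  then show ?case
    using plug_notin_step[OF P invariant_level[OF P] level_disjoint_base[OF P PH], of _ l' i U]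
    by (auto simp: level_0 level_Suc)
next
  case (Suc k)
  show ?case
  proof (cases l)
    case 0
    then show ?thesis
      using plug_notin_step[OF P invariant_level[OF P] level_disjoint_base[OF P PH], of _ k i U]
      by (auto simp: level_0 level_Suc)
  next
    case (Suc l')
    show ?thesis
    proof (rule ccontr)
      assume "level P (Suc k) i U \<inter> level P l i U \<noteq> {}"
      then obtain x where x: "x \<in> plug P (level P k) i U" "x \<in> plug P (level P l') i U"
        using Suc by (auto simp: level_Suc)
      obtain j A B y p where 1: "x = node i U (add_block (Inr j) (B, y) p)" "label_split U A B"
        "p \<in> contexts P i j A" "y \<in> level P k j B"
        using x(1) unfolding plug_def by blast
      obtain j' A' B' y' p' where 2: "x = node i U (add_block (Inr j') (B', y') p')" "label_split U A' B'"
        "p' \<in> contexts P i j' A'" "y' \<in> level P l' j' B'"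
        using x(2) unfolding plug_def by blast
      have y: "y \<notin> P j B" using level_disjoint_base[OF P PH] 1(4) by blast
      note same = node_add_block_inject[OF P 1(3,2) invariant_subset[OF invariant_level[OF P] 1(4)] y
          2(3,2) invariant_subset[OF invariant_level[OF P] 2(4)] trans[OF 1(1)[symmetric] 2(1)]]
      have "k \<noteq> l'" using Suc.prems Suc by simp
      then show False using Suc.IH[of l' j B] 1(4) 2(4) same(1-3) by blast
    qed
  qed
qed

lemma sub_add_iso:
  assumes "\<And>U. X i U \<inter> Y i U = {}"
  shows "species_iso (species_add (sub X i) (sub Y i)) (sub (\<lambda>i U. X i U \<union> Y i U) i)"
proof (rule species_isoI[where \<phi> = "\<lambda>U. case_sum id id"])
  show "bij_betw (case_sum id id) (structs (species_add (sub X i) (sub Y i)) U)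
      (structs (sub (\<lambda>i U. X i U \<union> Y i U) i) U)" for U
    unfolding bij_betw_def
  proof
    show "inj_on (case_sum id id) (structs (species_add (sub X i) (sub Y i)) U)"
      using assms[of U] by (auto simp: species_add_def inj_on_def)
    show "case_sum id id ` structs (species_add (sub X i) (sub Y i)) U = structs (sub (\<lambda>i U. X i U \<union> Y i U) i) U"
      by (auto simp: species_add_def Plus_def image_Un image_image)
  qed
qed (auto simp: species_add_def)

lemma sub_Sum_iso:
  assumes "\<And>k l U. k \<noteq> l \<Longrightarrow> X k i U \<inter> X l i U = {}"
  shows "species_iso (species_Sum (\<lambda>k. sub (X k) i)) (sub (\<lambda>i U. \<Union>k. X k i U) i)"
proof (rule species_isoI[where \<phi> = "\<lambda>U. snd"])
  show "bij_betw snd (structs (species_Sum (\<lambda>k. sub (X k) i)) U) (structs (sub (\<lambda>i U. \<Union>k. X k i U) i) U)" for U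
    unfolding bij_betw_def
  proof
    show "inj_on snd (structs (species_Sum (\<lambda>k. sub (X k) i)) U)"
    proof (rule inj_onI)
      fix a b assume "a \<in> structs (species_Sum (\<lambda>k. sub (X k) i)) U" "b \<in> structs (species_Sum (\<lambda>k. sub (X k) i)) U"
        "snd a = snd b"
      then show "a = b" using assms[of "fst a" "fst b" U] by (cases a, cases b) (auto simp: species_Sum_def)
    qed
    show "snd ` structs (species_Sum (\<lambda>k. sub (X k) i)) U = structs (sub (\<lambda>i U. \<Union>k. X k i U) i) U"
      by (force simp: species_Sum_def)
  qed
qed (auto simp: species_Sum_def)

section \<open>The Newton operator on a species isomorphic to a set of trees\<close>

context
  fixes P :: "'m \<Rightarrow> 'z labels \<Rightarrow> nat set" and Y :: "('z, 'm) species_vec"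
  assumes P: "invariant P" and PH: "\<And>i U. P i U \<subseteq> step P i U"
    and Y: "\<And>i. is_species (Y i)" and YP: "\<And>i. species_iso (Y i) (sub P i)"
begin

lemma jacobian_iso:
  "species_iso (jacobian H Y i j) (species_comp (species_deriv (Inr j) (H i)) (at_ZY (sub P)))"
  unfolding jacobian_def
  by (rule species_iso_trans[OF coded_iso(1)], rule species_comp_cong)
    (intro is_species_deriv H functorial_at_ZY is_species_functorial[OF Y] species_iso_at_ZY YP)+

text \<open>Since \<open>P\<close> is contained in \<open>step P\<close>, the set difference is a
  complement of \<open>P\<close> there, and complements are unique up to isomorphism.\<close>

lemma difference_iso:
  "is_species (species_diff (system_apply H Y j) (Y j))"
  "species_iso (species_diff (system_apply H Y j) (Y j)) (sub (level P 0) j)"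
proof -
  have L: "invariant (level P 0)" by (rule invariant_level[OF P])
  have "species_iso (system_apply H Y j) (system_apply H (sub P) j)"
    by (rule system_apply_cong[OF H is_species_functorial[OF Y] YP])
  also have "species_iso \<dots> (sub (step P) j)" by (rule system_apply_sub_iso[OF P])
  also have "species_iso \<dots> (species_add (sub P j) (sub (level P 0) j))"
  proof (rule species_iso_sym)
    have "P i U \<union> level P 0 i U = step P i U" for i U using PH[of i U] by (auto simp: level_0)
    then show "species_iso (species_add (sub P j) (sub (level P 0) j)) (sub (step P) j)"
      using sub_add_iso[of P j "level P 0"] level_disjoint_base[OF P PH] by simp
    show "functorial (species_add (sub P j) (sub (level P 0) j))"
      by (intro functorial_add functorial_sub P L)
  qed
  also have "species_iso \<dots> (species_add (Y j) (sub (level P 0) j))"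
    by (intro species_add_cong species_iso_refl species_iso_sym[OF YP] is_species_functorial[OF Y])
  finally have iso: "species_iso (system_apply H Y j) (species_add (Y j) (sub (level P 0) j))" .
  have "functorial (system_apply H Y j)"
    by (rule functorial_system_apply[OF H is_species_functorial[OF Y]])
  note d = species_diff_iso[OF iso is_species_sub[OF L] Y this]
  show "is_species (species_diff (system_apply H Y j) (Y j))"
    "species_iso (species_diff (system_apply H Y j) (Y j)) (sub (level P 0) j)" using d by blast+
qed

text \<open>A power gains its new factor on the left, just as \<open>level\<close> adds a node above
  the root; associativity moves that factor away from the rest, to which the induction hypothesis
  applies.\<close>

lemma mat_power_level_iso:
  fixes D defines "D \<equiv> (\<lambda>j. species_diff (system_apply H Y j) (Y j))"
  shows "species_iso (species_Sum (\<lambda>l. species_mult (mat_power (jacobian H Y) k i l) (D l))) (sub (level P k) i)"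
proof (induction k arbitrary: i)
  case 0
  have "species_iso (species_Sum (\<lambda>l. species_mult (mat_one i l) (D l))) (D i)"
    by (rule species_mult_one_Sum)
  also have "species_iso \<dots> (sub (level P 0) i)" unfolding D_def by (rule difference_iso(2))
  finally show ?case by simp
next
  case (Suc k)
  let ?J = "jacobian H Y" and ?K = "mat_power (jacobian H Y) k"
  have "species_iso (species_Sum (\<lambda>l. species_mult (mat_power ?J (Suc k) i l) (D l)))
      (species_Sum (\<lambda>l. species_mult (species_Sum (\<lambda>j. species_mult (?J i j) (?K j l))) (D l)))"
    unfolding mat_power_Suc mat_mult_def
    by (intro species_Sum_cong species_mult_cong coded_iso species_iso_refl)
  also have "species_iso \<dots> (species_Sum (\<lambda>j. species_mult (?J i j) (species_Sum (\<lambda>l. species_mult (?K j l) (D l)))))"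
    by (rule species_mult_Sum_assoc)
  also have "species_iso \<dots> (species_Sum (\<lambda>j. species_mult
      (species_comp (species_deriv (Inr j) (H i)) (at_ZY (sub P))) (sub (level P k) j)))"
    by (intro species_Sum_cong species_mult_cong jacobian_iso Suc)
  also have "species_iso \<dots> (sub (level P (Suc k)) i)"
    unfolding level_Suc by (rule plug_iso[OF P invariant_level[OF P] level_disjoint_base[OF P PH]])
  finally show ?case .
qed

text \<open>The levels are disjoint from each other and from \<open>P\<close>, so the sums of
  species become unions inside \<open>S\<close>.\<close>

lemma newton_iso: "species_iso (newton H Y i) (sub (newton_set P) i)"
proof -
  let ?J = "jacobian H Y" and ?D = "\<lambda>j. species_diff (system_apply H Y j) (Y j)"
  let ?L = "\<lambda>i U. \<Union>k. level P k i U"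
  have "species_iso (mat_vec_mult (mat_power_sum ?J) ?D i)
      (species_Sum (\<lambda>j. species_mult (species_Sum (\<lambda>k. mat_power ?J k i j)) (?D j)))"
    unfolding mat_vec_mult_def mat_power_sum_def
    by (rule species_iso_trans[OF coded_iso(1)]) (intro species_Sum_cong species_mult_cong coded_iso species_iso_refl)
  also have "species_iso \<dots> (species_Sum (\<lambda>k. species_Sum (\<lambda>j. species_mult (mat_power ?J k i j) (?D j))))"
    by (rule species_mult_Sum_swap)
  also have "species_iso \<dots> (species_Sum (\<lambda>k. sub (level P k) i))"
    by (intro species_Sum_cong mat_power_level_iso)
  also have "species_iso \<dots> (sub ?L i)"
    by (rule sub_Sum_iso) (rule level_disjoint[OF P PH])
  finally have *: "species_iso (mat_vec_mult (mat_power_sum ?J) ?D i) (sub ?L i)" .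
  have "species_iso (newton H Y i) (species_add (sub P i) (sub ?L i))"
    unfolding newton_def by (rule species_iso_trans[OF coded_iso(1)]) (intro species_add_cong YP *)
  also have "species_iso \<dots> (sub (\<lambda>i U. P i U \<union> ?L i U) i)"
    by (rule sub_add_iso) (use level_disjoint_base[OF P PH] in blast)
  also have "(\<lambda>i U. P i U \<union> ?L i U) = newton_set P"
    by (simp add: newton_set_def fun_eq_iff)
  finally show ?thesis .
qed

lemma is_species_newton: "is_species (newton H Y i)"
proof -
  have "functorial (newton H Y i)"
    by (intro functorial_newton H is_species_functorial[OF Y] is_species_functorial[OF difference_iso(1)])
  \<comment> \<open>Finiteness is inherited from \<open>S\<close> through the isomorphism, whatever
    the number of nonzero powers of the Jacobian.\<close>
  moreover have "finite (structs (newton H Y i) U)" for U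
    using species_iso_finite[OF newton_iso] finite_invariant[OF invariant_newton_set[OF P]] by simp
  ultimately show ?thesis by (simp add: is_species_iff_functorial)
qed

lemma subspecies_system_apply: "subspecies (Y i) (system_apply H Y i)"
proof -
  obtain \<phi> where n\<phi>: "natural (Y i) (sub P i) \<phi>" and b\<phi>: "\<forall>U. bij_betw (\<phi> U) (structs (Y i) U) (structs (sub P i) U)"
    using species_isoE[OF YP] .
  have "species_iso (system_apply H Y i) (sub (step P) i)"
    using species_iso_trans[OF system_apply_cong[OF H is_species_functorial[OF Y] YP] system_apply_sub_iso[OF P]] .
  then have "species_iso (sub (step P) i) (system_apply H Y i)"
    by (rule species_iso_sym) (rule functorial_system_apply[OF H is_species_functorial[OF Y]])
  then obtain \<psi> where n\<psi>: "natural (sub (step P) i) (system_apply H Y i) \<psi>"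
    and b\<psi>: "\<forall>U. bij_betw (\<psi> U) (structs (sub (step P) i) U) (structs (system_apply H Y i) U)"
    using species_isoE by blast
  have \<phi>: "\<phi> U x \<in> step P i U" if "x \<in> structs (Y i) U" for U x
    using bij_betwE[OF b\<phi>[rule_format]] that PH by fastforce
  show ?thesis
    unfolding subspecies_def
  proof (intro exI[of _ "\<lambda>U. \<psi> U \<circ> \<phi> U"] conjI allI)
    show "natural (Y i) (system_apply H Y i) (\<lambda>U. \<psi> U \<circ> \<phi> U)"
      unfolding natural_def using naturalD[OF n\<phi>] naturalD[OF n\<psi>] \<phi> by simp
    fix U
    have "inj_on (\<psi> U) (\<phi> U ` structs (Y i) U)"
      by (rule inj_on_subset[of _ "step P i U"]) (use b\<psi> \<phi> in \<open>auto simp: bij_betw_def\<close>)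
    then show "inj_on (\<psi> U \<circ> \<phi> U) (structs (Y i) U)"
      using b\<phi> by (intro comp_inj_on) (auto simp: bij_betw_def)
    show "(\<psi> U \<circ> \<phi> U) ` structs (Y i) U \<subseteq> structs (system_apply H Y i) U"
      using bij_betwE[OF b\<psi>[rule_format]] \<phi> by auto
  qed
qed

text \<open>Hanging a tree below a path of length \<open>k\<close> makes a tree of height greater than \<open>k\<close>.\<close>

lemma mat_power_pump:
  assumes "structs (mat_power (jacobian H Y) k i j) A \<noteq> {}" "label_split U A B" "y \<in> structs (S j) B"
  shows "\<exists>x\<in>structs (S i) U. x \<notin> trees k i U"
  using assms(1,2)
proof (induction k arbitrary: i A U)
  case 0
  then show ?case
    using assms(3) by (auto simp: mat_one_def species_one_def species_zero_def split: if_splits)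
next
  case (Suc k)
  obtain l A1 a A2 b where A: "label_split A A1 A2" "a \<in> structs (jacobian H Y i l) A1"
    "b \<in> structs (mat_power (jacobian H Y) k l j) A2"
    using Suc.prems(1) by (auto simp: mat_power_Suc mat_mult_def coded_def species_Sum_def structs_mult)
  let ?V = "\<lambda>s. A2 s |\<union>| B s"
  have sp: "label_split U A1 ?V" "label_split ?V A2 B" using label_split_assoc(1,2)[OF Suc.prems(2) A(1)] by blast+
  obtain x where x: "x \<in> structs (S l) ?V" "x \<notin> trees k l ?V" using Suc.IH[OF _ sp(2)] A(3) by blast
  obtain p where p: "p \<in> contexts P i l A1"
    using species_iso_empty[OF jacobian_iso, of i l A1] A(2) by (auto simp: structs_comp)
  have "node i U (add_block (Inr l) (?V, x) p) \<notin> trees (Suc k) i U"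
    unfolding trees_Suc by (rule node_add_block_notin_step[OF P invariant_trees p sp(1) x])
  moreover have "node i U (add_block (Inr l) (?V, x) p) \<in> structs (S i) U"
    using add_block_in_assemblies_S[OF P p sp(1) x(1)] node_image by blast
  ultimately show ?case by blast
qed

end

end

section \<open>Polynomial species\<close>

lemma polynomial_in_subset:
  assumes "polynomial_in F J" "J' \<subseteq> J" shows "polynomial_in F J'"
  unfolding polynomial_in_def
proof
  fix k
  let ?A = "\<lambda>k'. {(n, f). (\<Sum>t\<in>-J. n t) = k' \<and> f \<in> structs F (standard_labels n)}"
  have "{(n, f). (\<Sum>t\<in>-J'. n t) = k \<and> f \<in> structs F (standard_labels n)} \<subseteq> (\<Union>k'\<in>{..k}. ?A k')"
  proof
    fix x assume "x \<in> {(n, f). (\<Sum>t\<in>-J'. n t) = k \<and> f \<in> structs F (standard_labels n)}"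
    moreover have "(\<Sum>t\<in>-J. n t) \<le> (\<Sum>t\<in>-J'. n t)" for n :: "'a \<Rightarrow> nat"
      using assms(2) by (intro sum_mono2) auto
    ultimately show "x \<in> (\<Union>k'\<in>{..k}. ?A k')" by auto
  qed
  moreover have "finite (\<Union>k'\<in>{..k}. ?A k')" using assms(1) by (simp add: polynomial_in_def)
  ultimately show "finite {(n, f). (\<Sum>t\<in>-J'. n t) = k \<and> f \<in> structs F (standard_labels n)}"
    by (rule finite_subset)
qed

lemma add_star_standard_labels: "add_star j (standard_labels n) = standard_labels (n(j := Suc (n j)))"
proof -
  have "a |\<in>| add_star j (standard_labels n) t \<longleftrightarrow> a |\<in>| standard_labels (n(j := Suc (n j))) t" for a t
    by (cases a) (auto simp: mem_add_star standard_labels_def fset_of_list_elem)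
  then show ?thesis by (intro ext fset_eqI) blast
qed

text \<open>The extra element \<open>\<star>\<close> raises the total size outside \<open>J\<close>
  by 0 or 1, according to whether \<open>j\<close> lies in \<open>J\<close>, so the structures of
  the derivative inject into two finite sets.\<close>

lemma polynomial_in_deriv:
  assumes "polynomial_in F J" shows "polynomial_in (species_deriv j F) J"
  unfolding polynomial_in_def
proof
  fix k
  let ?A = "\<lambda>k'. {(n, f). (\<Sum>t\<in>-J. n t) = k' \<and> f \<in> structs F (standard_labels n)}"
  let ?B = "{(n, f). (\<Sum>t\<in>-J. n t) = k \<and> f \<in> structs (species_deriv j F) (standard_labels n)}"
  let ?h = "\<lambda>(n, f). (n(j := Suc (n j)), f)"
  have "?h ` ?B \<subseteq> ?A k \<union> ?A (Suc k)"
  proof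
    fix x assume "x \<in> ?h ` ?B"
    then obtain n f where x: "x = (n(j := Suc (n j)), f)" "(\<Sum>t\<in>-J. n t) = k"
      "f \<in> structs F (standard_labels (n(j := Suc (n j))))"
      by (auto simp: species_deriv_def add_star_standard_labels)
    have "(\<Sum>t\<in>-J. (n(j := Suc (n j))) t) = (\<Sum>t\<in>-J. n t + (if t = j then 1 else 0))"
      by (intro sum.cong) auto
    also have "\<dots> = k + (if j \<in> J then 0 else 1)" using x(2) by (simp add: sum.distrib)
    finally show "x \<in> ?A k \<union> ?A (Suc k)" using x by (auto split: if_splits)
  qed
  moreover have "finite (?A k \<union> ?A (Suc k))" using assms by (simp add: polynomial_in_def)
  ultimately have "finite (?h ` ?B)" by (rule finite_subset)
  moreover have "inj_on ?h ?B"
  proof (rule inj_onI, clarsimp)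
    fix n n' :: "'a \<Rightarrow> nat" assume e: "n(j := Suc (n j)) = n'(j := Suc (n' j))"
    show "n = n'"
    proof
      fix t show "n t = n' t" using fun_cong[OF e, of t] by (cases "t = j") auto
    qed
  qed
  ultimately show "finite ?B" by (rule finite_imageD)
qed

section \<open>Dependencies that use no labels\<close>

lemma label_size_mono: "(\<And>s. C s |\<subseteq>| A s) \<Longrightarrow> label_size C \<le> label_size A"
  unfolding label_size_def by (intro sum_mono fcard_mono)

lemma subset_no_labels: "(\<And>s. C s |\<subseteq>| no_labels s) \<Longrightarrow> C = no_labels"
  by (auto simp: no_labels_def fun_eq_iff)

lemma atom_no_labels [simp]: "structs (species_atom z) no_labels = {}"
  by (auto simp: species_atom_def no_labels_def fun_eq_iff)

text \<open>
  The nonzero entries of the Jacobian at \<open>(0, S(0))\<close>, where \<open>Z\<close> is the set of nonzero coordinates of \<open>S(0)\<close>.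
\<close>

definition zero_dependency :: "('z, 'm) system \<Rightarrow> 'm set \<Rightarrow> ('m \<times> 'm) set" where
  "zero_dependency H Z = {(i, j). \<exists>n. structs (species_deriv (Inr j) (H i)) (standard_labels n) \<noteq> {} \<and>
     (\<forall>z. n (Inl z) = 0) \<and> (\<forall>l. n (Inr l) > 0 \<longrightarrow> l \<in> Z)}"

text \<open>Only the set of coordinates that are nonzero on the empty label set matters, because one
  structure may be repeated in all blocks of a sort. Two solutions with the same nonzero coordinates
  there thus have the same dependencies.\<close>

lemma zero_dependency_iff:
  fixes H :: "('z::finite, 'm::finite) system"
  shows "(i, j) \<in> zero_dependency H {l. structs (Y l) no_labels \<noteq> {}} \<longleftrightarrow>
    assemblies (species_deriv (Inr j) (H i)) (at_ZY Y) no_labels \<noteq> {}"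
proof
  assume "(i, j) \<in> zero_dependency H {l. structs (Y l) no_labels \<noteq> {}}"
  then obtain n f where n: "f \<in> structs (species_deriv (Inr j) (H i)) (standard_labels n)"
    "\<And>z. n (Inl z) = 0" "\<And>l. n (Inr l) > 0 \<Longrightarrow> structs (Y l) no_labels \<noteq> {}"
    by (auto simp: zero_dependency_def)
  \<comment> \<open>All blocks of a sort are empty and carry the same chosen structure. For sorts
    without blocks the choice is an irrelevant default.\<close>
  define bl where "bl = (\<lambda>t. replicate (n t) (no_labels :: 'z labels, SOME g. g \<in> structs (at_ZY Y t) no_labels))"
  have "block_labels bl = standard_labels n" by (simp add: block_labels_def bl_def)
  moreover have "g \<in> structs (at_ZY Y t) B" "\<forall>s. B s |\<subseteq>| no_labels s" if b: "(B, g) \<in> set (bl t)" for t B g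
  proof -
    have e: "B = no_labels" "g = (SOME g. g \<in> structs (at_ZY Y t) no_labels)" "n t > 0" using b by (auto simp: bl_def)
    then show "\<forall>s. B s |\<subseteq>| no_labels s" by simp
    have "structs (at_ZY Y t) no_labels \<noteq> {}" using e(3) n(2,3) by (cases t) (auto simp: at_ZY_def)
    then show "g \<in> structs (at_ZY Y t) B" using e by (simp add: some_in_eq)
  qed
  ultimately have "(f, bl) \<in> assemblies (species_deriv (Inr j) (H i)) (at_ZY Y) no_labels"
    using n(1) unfolding assemblies_iff by (simp add: no_labels_def[THEN fun_cong])
  then show "assemblies (species_deriv (Inr j) (H i)) (at_ZY Y) no_labels \<noteq> {}" by blast
next
  assume "assemblies (species_deriv (Inr j) (H i)) (at_ZY Y) no_labels \<noteq> {}"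
  then obtain f bl where p: "(f, bl) \<in> assemblies (species_deriv (Inr j) (H i)) (at_ZY Y) no_labels" by auto
  have ne: "structs (at_ZY Y t) no_labels \<noteq> {}" if bt: "bl t \<noteq> []" for t
  proof -
    obtain B g where b: "(B, g) \<in> set (bl t)" using bt by (metis list.set_intros(1) neq_Nil_conv surj_pair)
    have "B = no_labels" by (rule subset_no_labels) (rule block_subset[OF p b])
    then show ?thesis using block_struct[OF p b] by auto
  qed
  have "\<forall>z. length (bl (Inl z)) = 0" using ne[of "Inl _"] by (auto simp: at_ZY_def)
  moreover have "\<forall>l. length (bl (Inr l)) > 0 \<longrightarrow> structs (Y l) no_labels \<noteq> {}" using ne[of "Inr _"] by (auto simp: at_ZY_def)
  moreover have "f \<in> structs (species_deriv (Inr j) (H i)) (standard_labels (\<lambda>t. length (bl t)))"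
    using p by (simp add: assemblies_iff block_labels_def)
  ultimately show "(i, j) \<in> zero_dependency H {l. structs (Y l) no_labels \<noteq> {}}"
    unfolding zero_dependency_def by blast
qed

context tree_algebra
begin

abbreviation full :: "'m \<Rightarrow> 'z labels \<Rightarrow> nat set" where
  "full \<equiv> (\<lambda>i U. structs (S i) U)"

section \<open>The children of a node\<close>

lemma invariant_full: "invariant full"
  unfolding invariant_def using functorial_closed[OF functorial_S] by blast

lemma assemblies_sub_full: "assemblies F (at_ZY (sub full)) U = assemblies F (at_ZY S) U"
proof -
  have "structs (at_ZY (sub full) t) B = structs (at_ZY S t) B" for t B by (cases t) (auto simp: at_ZY_def)
  then show ?thesis by (intro subset_antisym assemblies_mono) auto
qed

lemma trees_subset: "trees n i U \<subseteq> structs (S i) U"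
  using invariant_subset[OF invariant_trees] by blast

abbreviation "dependency \<equiv> zero_dependency H {l. structs (S l) no_labels \<noteq> {}}"

text \<open>The block is brought to the front and detached. The node does not change, because
  \<open>node\<close> identifies reorderings of an assembly.\<close>

lemma distinguished_block:
  assumes p: "p \<in> assemblies_in X i U" and X: "invariant X"
    and b: "(B, y) \<in> set (snd p (Inr j))"
  obtains A q where "label_split U A B" "q \<in> contexts X i j A"
    "node i U p = node i U (add_block (Inr j) (B, y) q)" "y \<in> X j B"
proof -
  obtain q where q: "add_block (Inr j) (B, y) q \<in> reorderings (H i) p" using bring_to_front[OF b] by blast
  have qa: "add_block (Inr j) (B, y) q \<in> assemblies_in X i U"
    by (rule reorderings_closed[OF functorial_H p q])
  have "g \<in> structs (at_ZY (sub X) t) C" if "(C, g) \<in> set (snd q t)" for t C g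
  proof -
    have "(C, g) \<in> set (snd (add_block (Inr j) (B, y) q) t)" using that by (auto simp: snd_add_block)
    then show ?thesis using qa by (metis block_struct prod.collapse)
  qed
  then obtain A where A: "label_split U A B" "q \<in> contexts X i j A"
    using remove_block[OF qa, of "at_ZY (sub X)"] by blast
  moreover have "node i U p = node i U (add_block (Inr j) (B, y) q)"
    using node_eq_iff q assemblies_sub_subset[OF X p] assemblies_sub_subset[OF X qa] by blast
  moreover have "y \<in> X j B" using p b assemblies_sub_iff[OF assemblies_sub_subset[OF X p], of X] by blast
  ultimately show thesis by (rule that)
qed

text \<open>Nothing is left for the rest of the node, which is then an assembly of the derivative on
  the empty label set, and that is what a dependency records.\<close>

lemma full_size_block:
  assumes p: "p \<in> all_assemblies i U" and b: "(B, y) \<in> set (snd p (Inr j))" and B: "label_size B = label_size U"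
  shows "B = U" "(i, j) \<in> dependency"
proof -
  obtain A q where A: "label_split U A B" "q \<in> contexts full i j A"
    using distinguished_block[OF _ invariant_full b] p assemblies_sub_full by metis
  have "label_size A = 0" using label_size_split[OF A(1)] B by simp
  then have A0: "A = no_labels" by (simp add: label_size_eq_0_iff)
  then show "B = U" using A(1) by simp
  show "(i, j) \<in> dependency" unfolding zero_dependency_iff using A(2) A0 assemblies_sub_full by blast
qed

text \<open>A node has finitely many children, so their heights have a common bound, and
  \<open>trees\<close> increases with the height.\<close>

lemma assemblies_in_trees:
  assumes p: "p \<in> all_assemblies i U"
    and b: "\<And>j B g. (B, g) \<in> set (snd p (Inr j)) \<Longrightarrow> \<exists>n. g \<in> trees n j B"
  shows "\<exists>n. p \<in> assemblies_in (trees n) i U"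
proof -
  let ?B = "SIGMA j:UNIV. set (snd p (Inr j))"
  have "\<forall>x\<in>?B. \<exists>n. snd (snd x) \<in> trees n (fst x) (fst (snd x))" using b by auto
  then obtain h where h: "\<And>x. x \<in> ?B \<Longrightarrow> snd (snd x) \<in> trees (h x) (fst x) (fst (snd x))" by metis
  have "finite (h ` ?B)" by auto
  then obtain N where N: "\<And>x. x \<in> ?B \<Longrightarrow> h x \<le> N" by (auto simp: finite_nat_set_iff_bounded_le)
  have "g \<in> trees N j B" if "(B, g) \<in> set (snd p (Inr j))" for j B g
    using h[of "(j, (B, g))"] N[of "(j, (B, g))"] trees_mono[of "h (j, (B, g))" N j B] that by auto
  then show ?thesis using assemblies_sub_iff[OF p] by blast
qed

text \<open>
  A structure that is not a tree has a child that is not a tree; by induction on the size this child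
  carries all the labels, so zero dependencies lead to it, and they are acyclic.
\<close>

lemma all_structures_trees:
  assumes init: "\<And>i. structs (S i) no_labels \<subseteq> (\<Union>n. trees n i no_labels)"
    and acyc: "acyclic dependency"
  shows "structs (S i) U \<subseteq> (\<Union>n. trees n i U)"
proof (induction "label_size U" arbitrary: i U rule: less_induct)
  case less
  have wf: "wf (dependency\<inverse>)" by (rule finite_acyclic_wf_converse[OF _ acyc]) simp
  show ?case
  proof (cases "U = no_labels")
    case False
    show ?thesis
      using wf
    proof (induction i rule: wf_induct_rule)
      case IH: (less i)
      show ?case
      proof
        fix x assume "x \<in> structs (S i) U"
        then obtain p where p: "p \<in> all_assemblies i U" "x = node i U p"
          using node_image by blast
        have "\<exists>n. g \<in> trees n j B" if b: "(B, g) \<in> set (snd p (Inr j))" for j B g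
        proof -
          have BU: "\<And>s. B s |\<subseteq>| U s" and g: "g \<in> structs (S j) B"
            using p(1) b by (cases p, force dest: block_subset block_struct simp: at_ZY_def)+
          show ?thesis
          proof (cases "label_size B < label_size U")
            case True
            then show ?thesis using less g by blast
          next
            case False
            then have "label_size B = label_size U" using label_size_mono[of B U] BU by simp
            from full_size_block[OF p(1) b this] show ?thesis using IH[of j] g by auto
          qed
        qed
        then obtain n where "p \<in> assemblies_in (trees n) i U" using assemblies_in_trees[OF p(1)] by blast
        then have "x \<in> trees (Suc n) i U" by (simp add: trees_Suc step_def p(2))
        then show "x \<in> (\<Union>n. trees n i U)" by blast
      qed
    qed
  qed (simp add: init)
qed

text \<open>The terms with exponent 0 already give the ordinary iteration step; Newton's iterates
  therefore dominate \<open>trees\<close>, from which plain convergence follows.\<close>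

lemma step_subset_newton_set: "step P i U \<subseteq> newton_set P i U"
proof
  fix x assume "x \<in> step P i U"
  then have "x \<in> P i U \<or> x \<in> level P 0 i U" by (simp add: level_0)
  then show "x \<in> newton_set P i U" unfolding newton_set_def by blast
qed

text \<open>This propagates the condition that makes the next subtraction defined: the marked child
  of a new tree is in the preceding level and its other children are in \<open>P\<close>, hence all
  are in the new set.\<close>

lemma newton_set_subset_step:
  assumes P: "invariant P" and PH: "\<And>i U. P i U \<subseteq> step P i U"
  shows "newton_set P i U \<subseteq> step (newton_set P) i U"
proof
  have mono: "P k C \<subseteq> newton_set P k C" for k C by (auto simp: newton_set_def)
  have mono': "step P i U \<subseteq> step (newton_set P) i U" by (rule step_mono) (rule mono)
  fix x assume "x \<in> newton_set P i U"
  then consider "x \<in> P i U" | k where "x \<in> level P k i U" by (auto simp: newton_set_def)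
  then show "x \<in> step (newton_set P) i U"
  proof cases
    case 1
    then show ?thesis using PH mono' by blast
  next
    case (2 k)
    show ?thesis
    proof (cases k)
      case 0
      then show ?thesis using 2 mono' by (auto simp: level_0)
    next
      case (Suc k')
      then have "x \<in> plug P (level P k') i U" using 2 by (simp add: level_Suc)
      then obtain j A B y p where x: "x = node i U (add_block (Inr j) (B, y) p)" "label_split U A B"
        "p \<in> contexts P i j A" "y \<in> level P k' j B"
        unfolding plug_def by blast
      have "y \<in> newton_set P j B" using x(4) by (auto simp: newton_set_def)
      then show ?thesis
        using add_block_in_assemblies[OF x(3,2) _ mono] x(1) by (simp add: step_def)
    qed
  qed
qed

text \<open>
  Of the children of a tree of size at most \<open>2k + 1\<close>, at most one has size greater than \<open>k\<close>.
\<close>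

lemma newton_set_doubles:
  assumes P: "invariant P" and PH: "\<And>i U. P i U \<subseteq> step P i U"
    and small: "\<And>i U. label_size U \<le> k \<Longrightarrow> structs (S i) U \<subseteq> P i U"
  shows "label_size U \<le> 2 * k + 1 \<Longrightarrow> trees n i U \<subseteq> newton_set P i U"
proof (induction n arbitrary: i U)
  case (Suc n)
  show ?case
  proof
    fix x assume "x \<in> trees (Suc n) i U"
    then obtain p where p: "p \<in> assemblies_in (trees n) i U" "x = node i U p"
      by (auto simp: trees_Suc step_def)
    have pS: "p \<in> all_assemblies i U" by (rule assemblies_sub_subset[OF invariant_trees p(1)])
    show "x \<in> newton_set P i U"
    proof (cases "p \<in> assemblies_in P i U")
      case True
      then have "x \<in> step P i U" using p(2) by (simp add: step_def)
      then show ?thesis using step_subset_newton_set by blast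
    next
      case False
      then obtain j B y where b: "(B, y) \<in> set (snd p (Inr j))" "y \<notin> P j B" using assemblies_sub_iff[OF pS] by blast
      obtain A q where A: "label_split U A B" "q \<in> contexts (trees n) i j A"
        "node i U p = node i U (add_block (Inr j) (B, y) q)" "y \<in> trees n j B"
        using distinguished_block[OF p(1) invariant_trees b(1)] .
      have size: "label_size U = label_size A + label_size B" by (rule label_size_split[OF A(1)])
      have "label_size B > k" using small[of B j] b(2) A(4) trees_subset by fastforce
      \<comment> \<open>The remainder \<open>(2 * k + 1) - (k + 1)\<close> is \<open>k\<close>, so
        the rest of the node is small enough for its children to be in \<open>P\<close>.\<close>
      then have Ak: "label_size A \<le> k" using size Suc.prems by simp
      have qS: "q \<in> assemblies (species_deriv (Inr j) (H i)) (at_ZY S) A"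
        by (rule assemblies_sub_subset[OF invariant_trees A(2)])
      have "g \<in> P l C" if c: "(C, g) \<in> set (snd q (Inr l))" for l C g
      proof -
        have CA: "\<And>s. C s |\<subseteq>| A s" and g: "g \<in> structs (S l) C"
          using qS c by (cases q, force dest: block_subset block_struct simp: at_ZY_def)+
        have "label_size C \<le> k" using label_size_mono[of C A, OF CA] Ak by simp
        then show ?thesis using small g by blast
      qed
      then have q: "q \<in> contexts P i j A"
        using assemblies_sub_iff[OF qS] by blast
      \<comment> \<open>The induction is on the height because \<open>A\<close> may be empty, and
        then \<open>y\<close> is no smaller than the whole tree.\<close>
      have "y \<in> newton_set P j B" using Suc.IH[of B j] A(4) size Suc.prems by auto
      then obtain l where "y \<in> level P l j B" using b(2) by (auto simp: newton_set_def)
      then have "x \<in> level P (Suc l) i U"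
        unfolding level_Suc plug_def using A(1,3) q p(2) by blast
      then show ?thesis by (auto simp: newton_set_def)
    qed
  qed
qed simp

definition newton_sets :: "nat \<Rightarrow> 'm \<Rightarrow> 'z labels \<Rightarrow> nat set" where
  "newton_sets n = (newton_set ^^ n) (\<lambda>i U. {})"

lemma newton_sets_Suc: "newton_sets (Suc n) = newton_set (newton_sets n)"
  by (simp add: newton_sets_def)

lemma newton_sets_invariants:
  "invariant (newton_sets n)" "newton_sets n i U \<subseteq> step (newton_sets n) i U" "trees n i U \<subseteq> newton_sets n i U"
proof (induction n arbitrary: i U)
  case 0
  show "invariant (newton_sets 0)" "newton_sets 0 i U \<subseteq> step (newton_sets 0) i U" "trees 0 i U \<subseteq> newton_sets 0 i U" for i U
    by (simp_all add: newton_sets_def invariant_def)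
next
  case (Suc n)
  show "invariant (newton_sets (Suc n))"
    unfolding newton_sets_Suc by (rule invariant_newton_set[OF Suc(1)])
  show "newton_sets (Suc n) i U \<subseteq> step (newton_sets (Suc n)) i U" for i U
    unfolding newton_sets_Suc by (rule newton_set_subset_step[OF Suc(1,2)])
  show "trees (Suc n) i U \<subseteq> newton_sets (Suc n) i U" for i U
    unfolding newton_sets_Suc trees_Suc
    using step_mono[of "trees n" "newton_sets n" i U, OF Suc(3)] step_subset_newton_set by blast
qed

lemma newton_iterate_iso:
  "is_species (newton_iterate H n i)" "species_iso (newton_iterate H n i) (sub (newton_sets n) i)"
proof (induction n arbitrary: i)
  case 0
  show "is_species (newton_iterate H 0 i)" for i
    by (simp add: newton_iterate_def vec_zero_def is_species_iff_functorial functorial_zero) (simp add: species_zero_def)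
  show "species_iso (newton_iterate H 0 i) (sub (newton_sets 0) i)" for i
    by (rule species_iso_identity) (auto simp: newton_iterate_def newton_sets_def vec_zero_def species_zero_def)
next
  case (Suc n)
  have N: "newton_iterate H (Suc n) = newton H (newton_iterate H n)" by (simp add: newton_iterate_def)
  show "is_species (newton_iterate H (Suc n) i)" for i
    unfolding N by (rule is_species_newton[OF newton_sets_invariants(1,2) Suc])
  show "species_iso (newton_iterate H (Suc n) i) (sub (newton_sets (Suc n)) i)" for i
    unfolding N newton_sets_Suc by (rule newton_iso[OF newton_sets_invariants(1,2) Suc])
qed

lemma contact_subI:
  assumes "\<And>i. species_iso (Y i) (sub P i)" "\<And>i U. label_size U \<le> p \<Longrightarrow> P i U = structs (S i) U"
  shows "contact p Y S"
  unfolding contact_def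
proof
  fix i
  have "species_iso (species_restrict p (Y i)) (species_restrict p (sub P i))"
    by (rule species_iso_restrict[OF assms(1)])
  also have "species_iso \<dots> (species_restrict p (S i))"
    by (rule species_iso_identity) (use assms(2) in \<open>auto simp: species_restrict_def split: if_splits\<close>)
  finally show "species_iso (species_restrict p (Y i)) (species_restrict p (S i))" .
qed

end

text \<open>Convergence in the form in which it is used: on all label sets of bounded size one
  height suffices. \<open>nonzero\<close> provides the trees with which paths are completed.\<close>

locale complete_tree_algebra = tree_algebra H S node
  for H :: "('z::finite, 'm::finite) system" and S :: "('z, 'm) species_vec" and node +
  assumes complete: "\<And>p. \<exists>N. \<forall>i U. label_size U \<le> p \<longrightarrow> structs (S i) U \<subseteq> trees N i U"
    and nonzero: "\<And>i. \<exists>U. structs (S i) U \<noteq> {}"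
begin

section \<open>Quadratic convergence and summability\<close>

lemma newton_converges: "converges_quadratically_to (newton_iterate H) S"
  unfolding converges_quadratically_to_def converges_to_def
proof (intro conjI allI impI)
  fix p
  obtain N where N: "\<And>i U. label_size U \<le> p \<Longrightarrow> structs (S i) U \<subseteq> trees N i U" using complete by metis
  have "contact p (newton_iterate H n) S" if n: "n \<ge> N" for n
  proof (rule contact_subI[OF newton_iterate_iso(2)])
    fix i and U :: "'z labels" assume "label_size U \<le> p"
    then have "structs (S i) U \<subseteq> newton_sets n i U"
      using N trees_mono[OF n] newton_sets_invariants(3) by (meson order_trans)
    then show "newton_sets n i U = structs (S i) U"
      using invariant_subset[OF newton_sets_invariants(1)] by blast
  qed
  then show "\<exists>N. \<forall>n\<ge>N. contact p (newton_iterate H n) S" by blast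
next
  fix n k assume c: "contact k (newton_iterate H n) S"
  have small: "structs (S i) U \<subseteq> newton_sets n i U" if U: "label_size U \<le> k" for i U
  proof -
    \<comment> \<open>Contact yields some isomorphism, not equality of sets; but a subset of a
      finite set with the same cardinality is the whole set.\<close>
    have "card (newton_sets n i U) = card (structs (S i) U)"
      using contact_card[OF c U, of i] species_iso_card[OF newton_iterate_iso(2), of n i U] by simp
    moreover have "newton_sets n i U \<subseteq> structs (S i) U" using invariant_subset[OF newton_sets_invariants(1)] by blast
    ultimately show ?thesis using card_subset_eq[OF finite_S] by blast
  qed
  show "contact (2 * k + 1) (newton_iterate H (Suc n)) S"
  proof (rule contact_subI[OF newton_iterate_iso(2)])
    fix i and U :: "'z labels" assume U: "label_size U \<le> 2 * k + 1"
    obtain N where "structs (S i) U \<subseteq> trees N i U" using complete by blast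
    also have "\<dots> \<subseteq> newton_sets (Suc n) i U"
      unfolding newton_sets_Suc by (rule newton_set_doubles[OF newton_sets_invariants(1,2) small U])
    finally show "newton_sets (Suc n) i U = structs (S i) U"
      using invariant_subset[OF newton_sets_invariants(1)] by blast
  qed
qed

lemma jacobian_powers_summable:
  assumes P: "invariant P" and PH: "\<And>i U. P i U \<subseteq> step P i U"
    and Y: "\<And>i. is_species (Y i)" and YP: "\<And>i. species_iso (Y i) (sub P i)"
  shows "species_summable (\<lambda>k. mat_power (jacobian H Y) k i j)"
  unfolding species_summable_def
proof
  fix A :: "'z labels"
  obtain B y where y: "y \<in> structs (S j) B" using nonzero by blast
  have "finite (\<Union>s. fset (A s))" by simp
  then obtain N where N: "\<And>s a. a |\<in>| A s \<Longrightarrow> a < N" by (auto simp: finite_nat_set_iff_bounded)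
  \<comment> \<open>The shift moves the labels of \<open>B\<close> beyond those of \<open>A\<close>,
    so that the two label sets can be united for every \<open>k\<close> alike.\<close>
  define \<sigma> where "\<sigma> = (\<lambda>(s::'z) a. a + N)"
  have \<sigma>: "relabelling \<sigma> B" by (auto simp: relabelling_def \<sigma>_def inj_on_def)
  let ?B = "relabel \<sigma> B" and ?U = "\<lambda>s. A s |\<union>| relabel \<sigma> B s"
  have "label_split ?U A ?B"
    using N by (fastforce simp: label_split_iff relabel_def \<sigma>_def)
  note pump = mat_power_pump[OF P PH Y YP _ this functorial_closed[OF functorial_S \<sigma> y]]
  obtain M where M: "structs (S i) ?U \<subseteq> trees M i ?U" using complete by blast
  have "{k. structs (mat_power (jacobian H Y) k i j) A \<noteq> {}} \<subseteq> {..<M}"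
  proof
    fix k assume "k \<in> {k. structs (mat_power (jacobian H Y) k i j) A \<noteq> {}}"
    then obtain x where "x \<in> structs (S i) ?U" "x \<notin> trees k i ?U" using pump by blast
    \<comment> \<open>A bound \<open>k\<close> of at least \<open>M\<close> would admit all
      structures on this label set, and \<open>x\<close> exceeds it.\<close>
    then have "\<not> M \<le> k" using M trees_mono by blast
    then show "k \<in> {..<M}" by simp
  qed
  then show "finite {k. structs (mat_power (jacobian H Y) k i j) A \<noteq> {}}" by (rule finite_subset) simp
qed

text \<open>A context on the empty label set raises the height of a tree without adding a
  label.\<close>

lemma dependency_pump:
  assumes "(i, j) \<in> dependency" "y \<in> structs (S j) U" "y \<notin> trees n j U"
  shows "\<exists>x\<in>structs (S i) U. x \<notin> trees (Suc n) i U"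
proof -
  obtain p where p: "p \<in> contexts full i j no_labels"
    using assms(1) unfolding zero_dependency_iff assemblies_sub_full by blast
  have sp: "label_split U no_labels U" by simp
  show ?thesis
    using node_add_block_notin_step[OF invariant_full invariant_trees p sp assms(2,3)]
      add_block_in_assemblies_S[OF invariant_full p sp assms(2)] node_image unfolding trees_Suc by blast
qed

text \<open>Going round a cycle again and again would produce trees of unbounded height on one label
  set, against \<open>complete\<close>.\<close>

lemma acyclic_dependency: "acyclic dependency"
  unfolding acyclic_def
proof (intro allI notI)
  fix i assume cyc: "(i, i) \<in> dependency\<^sup>+"
  have pump: "\<exists>x\<in>structs (S i) U. x \<notin> trees (Suc n) i U"
    if "(i, j) \<in> dependency\<^sup>+" "\<exists>y\<in>structs (S j) U. y \<notin> trees n j U" for i j U n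
    using that
  proof (induction arbitrary: rule: trancl_induct)
    case (step j k)
    then obtain y where "y \<in> structs (S j) U" "y \<notin> trees (Suc n) j U" using dependency_pump by blast
    \<comment> \<open>A longer path gains several levels; keeping a single one is enough and makes
      the induction uniform.\<close>
    then have "y \<in> structs (S j) U" "y \<notin> trees n j U" using trees_Suc_mono by blast+
    then show ?case using step.IH by blast
  qed (use dependency_pump in blast)
  obtain U where U: "structs (S i) U \<noteq> {}" using nonzero by blast
  have "\<exists>y\<in>structs (S i) U. y \<notin> trees n i U" for n
    by (induction n) (use U pump[OF cyc] in auto)
  moreover obtain N where "structs (S i) U \<subseteq> trees N i U" using complete by blast
  ultimately show False by blast
qed

text \<open>This is where the exponent \<open>CARD('m)\<close> comes from. On the empty label set
  each step to a child follows a dependency, and by acyclicity no coordinate repeats along a branch.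
  The measure is the number of coordinates that can be reached, the starting one included.\<close>

lemma no_labels_height: "structs (S i) no_labels \<subseteq> trees CARD('m) i no_labels"
proof -
  have fin: "finite (dependency\<^sup>* `` {i})" for i by simp
  have "structs (S i) no_labels \<subseteq> trees (card (dependency\<^sup>* `` {i})) i no_labels"
    using finite_acyclic_wf_converse[OF _ acyclic_dependency, simplified]
  proof (induction i rule: wf_induct_rule)
    case (less i)
    show ?case
    proof
      fix x assume "x \<in> structs (S i) no_labels"
      then obtain p where p: "p \<in> all_assemblies i no_labels" "x = node i no_labels p"
        using node_image by blast
      let ?r = "\<lambda>i. card (dependency\<^sup>* `` {i})"
      have "i \<in> dependency\<^sup>* `` {i}" by simp
      then have pos: "?r i > 0" using card_gt_0_iff by (metis empty_iff fin)
      have "g \<in> trees (?r i - 1) j B" if b: "(B, g) \<in> set (snd p (Inr j))" for j B g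
      proof -
        have "\<And>s. B s |\<subseteq>| no_labels s" and g: "g \<in> structs (S j) B"
          using p(1) b by (cases p, force dest: block_subset block_struct simp: at_ZY_def)+
        then have B: "B = no_labels" by (intro subset_no_labels)
        then have dep: "(i, j) \<in> dependency" using full_size_block(2)[OF p(1) b] by simp
        \<comment> \<open>If \<open>i\<close> could be reached from \<open>j\<close>, the dependency
          of \<open>i\<close> on \<open>j\<close> would close a cycle; so the count drops
          strictly.\<close>
        have "dependency\<^sup>* `` {j} \<subseteq> dependency\<^sup>* `` {i} - {i}"
        proof
          fix k assume "k \<in> dependency\<^sup>* `` {j}"
          then have jk: "(j, k) \<in> dependency\<^sup>*" by simp
          then have "(i, k) \<in> dependency\<^sup>+" using dep by (rule rtrancl_into_trancl2[rotated])
          then show "k \<in> dependency\<^sup>* `` {i} - {i}"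
            using acyclic_dependency by (auto simp: acyclic_def dest: trancl_into_rtrancl)
        qed
        then have "?r j \<le> ?r i - 1"
          using card_mono[of "dependency\<^sup>* `` {i} - {i}" "dependency\<^sup>* `` {j}"] fin by simp
        moreover have "g \<in> trees (?r j) j no_labels" using less[of j] dep g B by auto
        ultimately show ?thesis using trees_mono B by blast
      qed
      then have "p \<in> assemblies_in (trees (?r i - 1)) i no_labels"
        using assemblies_sub_iff[OF p(1)] by blast
      then have "x \<in> trees (Suc (?r i - 1)) i no_labels" using p(2) by (simp add: trees_Suc step_def)
      then show "x \<in> trees (?r i) i no_labels" using pos by simp
    qed
  qed
  moreover have "card (dependency\<^sup>* `` {i}) \<le> CARD('m)" by (rule card_mono) auto
  ultimately show ?thesis using trees_mono by blast
qed

end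

section \<open>Initial values\<close>

lemma not_in_no_labels [simp]: "a |\<notin>| no_labels s"
  by (simp add: no_labels_def)

lemma nonempty_labels: "U \<noteq> no_labels \<Longrightarrow> \<exists>s a. a |\<in>| U s"
  by (auto simp: no_labels_def fun_eq_iff)

text \<open>Every label lies in some block, so blocks without labels force an empty label set, and
  there an assembly sees only the values of \<open>G\<close> on the empty set.\<close>

lemma assemblies_without_labels:
  fixes F :: "('t::finite, 'a) species"
  assumes "\<And>t B. B \<noteq> no_labels \<Longrightarrow> structs (G t) B = {}" "\<And>t. structs (G t) no_labels = structs (G' t) no_labels"
  shows "assemblies F G U = (if U = no_labels then assemblies F G' no_labels else {})"
proof -
  have "p \<notin> assemblies F G U" if U: "U \<noteq> no_labels" for p
  proof
    assume p: "p \<in> assemblies F G U"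
    obtain f bl where pe: "p = (f, bl)" by (metis surj_pair)
    obtain s a where a: "a |\<in>| U s" using nonempty_labels[OF U] by blast
    then have "label_count bl s a \<noteq> 0" using p by (simp add: pe assemblies_iff)
    then obtain t b where b: "b \<in> set (bl t)" "a |\<in>| fst b s" by (auto simp: label_count_eq_0_iff)
    obtain B g where "b = (B, g)" by (metis surj_pair)
    then have "structs (G t) B \<noteq> {}" "B \<noteq> no_labels" using b p by (auto simp: pe dest: block_struct)
    then show False using assms(1) by blast
  qed
  moreover have "p \<in> assemblies F G no_labels \<longleftrightarrow> p \<in> assemblies F G' no_labels" for p
  proof -
    obtain f bl where pe: "p = (f, bl)" by (metis surj_pair)
    have "g \<in> structs (G t) B \<and> (\<forall>s. B s |\<subseteq>| no_labels s) \<longleftrightarrow> g \<in> structs (G' t) B \<and> (\<forall>s. B s |\<subseteq>| no_labels s)" for t B g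
      using assms(2)[of t] subset_no_labels[of B] by metis
    then show ?thesis by (simp add: pe assemblies_iff)
  qed
  ultimately show ?thesis by auto
qed

lemma functorial_apply0_iterate:
  fixes H :: "('z::finite, 'm::finite) system"
  assumes "\<And>i. is_species (H i)" shows "functorial ((system_apply0 H ^^ n) vec_zero i)"
proof (induction n arbitrary: i)
  case (Suc n)
  have "functorial (at_0Y ((system_apply0 H ^^ n) vec_zero) t)" for t
    using Suc by (cases t) (auto simp: at_0Y_def functorial_zero)
  then show ?case unfolding funpow.simps o_apply system_apply0_def
    by (intro functorial_coded functorial_species_comp assms)
qed (simp add: vec_zero_def functorial_zero)

lemma structs_system_apply0:
  "structs (system_apply0 H Y i) U = (\<lambda>p. to_nat (assembly_class (H i) p)) ` assemblies (H i) (at_0Y Y) U"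
  by (simp add: system_apply0_def coded_def structs_comp image_image)

lemma structs_system_apply:
  "structs (system_apply H Y i) U = (\<lambda>p. to_nat (assembly_class (H i) p)) ` assemblies (H i) (at_ZY Y) U"
  by (simp add: system_apply_def coded_def structs_comp image_image)

text \<open>The equality is literal: the code of a class is computed from \<open>H i\<close> and the
  assembly, and on the empty label set both substitutions admit the same assemblies.\<close>

lemma structs_apply0_iterate:
  fixes H :: "('z::finite, 'm::finite) system"
  shows "structs ((system_apply0 H ^^ n) vec_zero i) U = (if U = no_labels then structs (iterate H n i) no_labels else {})"
proof (induction n arbitrary: i U)
  case (Suc n)
  let ?Y = "(system_apply0 H ^^ n) vec_zero"
  have "assemblies (H i) (at_0Y ?Y) U
      = (if U = no_labels then assemblies (H i) (at_ZY (iterate H n)) no_labels else {})"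
  proof (rule assemblies_without_labels)
    show "structs (at_0Y ?Y t) B = {}" if "B \<noteq> no_labels" for t B
      using Suc that by (cases t) (auto simp: at_0Y_def species_zero_def)
    show "structs (at_0Y ?Y t) no_labels = structs (at_ZY (iterate H n) t) no_labels" for t
      using Suc by (cases t) (auto simp: at_0Y_def at_ZY_def species_zero_def)
  qed
  then show ?case
    by (simp add: iterate_Suc structs_system_apply structs_system_apply0)
qed (simp add: vec_zero_def species_zero_def)

text \<open>Composition with zero leaves only the assembly without blocks, so evaluation at 0 is the
  restriction to the empty label set.\<close>

lemma comp_zero_bij:
  fixes F :: "('t::finite, 'a) species" and G :: "'t \<Rightarrow> ('s, 'b) species"
  assumes F: "is_species F" and G: "\<And>t B. structs (G t) B = {}"
  shows "bij_betw (\<lambda>f. assembly_class F (f, \<lambda>t. [])) (structs F no_labels) (structs (species_comp F G) no_labels)"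
    and "U \<noteq> no_labels \<Longrightarrow> structs (species_comp F G) U = {}"
proof -
  have lab: "block_labels (\<lambda>t::'t. [] :: ('s labels \<times> 'b) list) = no_labels"
    by (simp add: block_labels_def standard_labels_def no_labels_def)
  show "structs (species_comp F G) U = {}" if "U \<noteq> no_labels"
    using assemblies_without_labels[of G G F U] G that by (simp add: structs_comp)
  have a: "assemblies F G no_labels = (\<lambda>f. (f, \<lambda>t. [])) ` structs F no_labels"
  proof (intro subset_antisym subsetI)
    fix p assume p: "p \<in> assemblies F G no_labels"
    obtain f bl where pe: "p = (f, bl)" by (metis surj_pair)
    have "bl t = []" for t
    proof (rule ccontr)
      assume "bl t \<noteq> []"
      then obtain B g where "(B, g) \<in> set (bl t)" by (metis list.set_intros(1) neq_Nil_conv surj_pair)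
      from block_struct[OF p[unfolded pe] this] show False using G by simp
    qed
    then have "bl = (\<lambda>t. [])" by auto
    then show "p \<in> (\<lambda>f. (f, \<lambda>t. [])) ` structs F no_labels" using p by (auto simp: pe assemblies_iff lab)
  qed (auto simp: assemblies_iff lab)
  have fF: "functorial F" by (rule is_species_functorial[OF F])
  have "inj_on (\<lambda>f. assembly_class F (f, (\<lambda>t. []) :: 't \<Rightarrow> ('s labels \<times> 'b) list)) (structs F no_labels)"
  proof (rule inj_onI)
    let ?e = "(\<lambda>t. []) :: 't \<Rightarrow> ('s labels \<times> 'b) list"
    fix f f' assume f: "f \<in> structs F no_labels" "f' \<in> structs F no_labels"
      and "assembly_class F (f, ?e) = assembly_class F (f', ?e)"
    then have "(f', ?e) \<in> reorderings F (f, ?e)"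
      by (subst (asm) assembly_class_eq_iff[OF F]) (auto simp: well_labelled_def lab)
    then show "f = f'" using transport_no_labels[OF fF f(1)] by (auto simp: mem_reorderings lab)
  qed
  then show "bij_betw (\<lambda>f. assembly_class F (f, \<lambda>t. [])) (structs F no_labels) (structs (species_comp F G) no_labels)"
    by (simp add: bij_betw_def structs_comp a image_image)
qed

text \<open>Transport on the empty label set is the identity, so any bijection there is
  natural.\<close>

lemma species_iso_no_labelsI:
  assumes F: "functorial F" and G: "functorial G" and b: "bij_betw \<phi> (structs F no_labels) (structs G no_labels)"
    and e: "\<And>U. U \<noteq> no_labels \<Longrightarrow> structs F U = {} \<and> structs G U = {}"
  shows "species_iso F G"
proof (rule species_isoI[where \<phi> = "\<lambda>U. \<phi>"])
  show "bij_betw \<phi> (structs F U) (structs G U)" for U using b e[of U] by (cases "U = no_labels") (auto simp: bij_betw_def)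
  fix U \<sigma> x assume x: "x \<in> structs F U"
  then have "U = no_labels" using e by blast
  then show "\<phi> (transport F U \<sigma> x) = transport G U \<sigma> (\<phi> x)"
    using transport_no_labels[OF F, of x] transport_no_labels[OF G, of "\<phi> x"] x bij_betwE[OF b] by simp
qed

text \<open>Both sides of the condition live on the empty label set, where naturality is automatic;
  the initial value is thus a matter of the number of structures.\<close>

lemma has_initial_value_iff:
  fixes H :: "('z::finite, 'm::finite) system"
  assumes H: "\<And>i. is_species (H i)" and S: "\<And>i. is_species (S i)"
  shows "has_initial_value H S \<longleftrightarrow>
    (\<forall>i. \<exists>\<phi>. bij_betw \<phi> (structs (S i) no_labels) (structs (iterate H CARD('m) i) no_labels))"
proof -
  let ?C = "\<lambda>i. species_comp (S i) (\<lambda>z. species_zero :: ('z, nat) species)"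
  let ?V = "\<lambda>i. (system_apply0 H ^^ CARD('m)) vec_zero i"
  have z: "structs (species_zero :: ('z, nat) species) B = {}" for B by (simp add: species_zero_def)
  have V: "structs (?V i) no_labels = structs (iterate H CARD('m) i) no_labels" for i
    by (simp add: structs_apply0_iterate)
  have "species_iso (?C i) (?V i) \<longleftrightarrow> (\<exists>\<phi>. bij_betw \<phi> (structs (S i) no_labels) (structs (?V i) no_labels))" for i
  proof
    note c = comp_zero_bij(1)[OF S[of i] z]
    show "\<exists>\<phi>. bij_betw \<phi> (structs (S i) no_labels) (structs (?V i) no_labels)" if "species_iso (?C i) (?V i)"
      using species_iso_bij[OF that, of no_labels] bij_betw_trans[OF c] by blast
    assume "\<exists>\<phi>. bij_betw \<phi> (structs (S i) no_labels) (structs (?V i) no_labels)"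
    then obtain \<phi> where "bij_betw \<phi> (structs (?C i) no_labels) (structs (?V i) no_labels)"
      using bij_betw_trans[OF bij_betw_inv_into[OF c]] by blast
    then show "species_iso (?C i) (?V i)"
    proof (rule species_iso_no_labelsI[rotated 2])
      show "functorial (?C i)" by (intro functorial_species_comp S functorial_zero)
      show "functorial (?V i)" by (rule functorial_apply0_iterate[OF H])
      show "structs (?C i) U = {} \<and> structs (?V i) U = {}" if "U \<noteq> no_labels" for U
        using comp_zero_bij(2)[OF S[of i] z that] that by (simp add: structs_apply0_iterate)
    qed
  qed
  then show ?thesis by (simp add: has_initial_value_def V)
qed

section \<open>The limit of the iteration\<close>

lemma transport_system_apply:
  assumes "is_species (H i)" "p \<in> assemblies (H i) (at_ZY Y) U"
  shows "transport (system_apply H Y i) U \<sigma> (to_nat (assembly_class (H i) p))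
    = to_nat (assembly_class (H i) (assembly_relabel (at_ZY Y) \<sigma> p))"
  using transport_comp[OF assms] by (simp add: system_apply_def coded_def)

lemma assembly_relabel_cong:
  assumes "p \<in> assemblies F G U"
    "\<And>t B g. g \<in> structs (G t) B \<Longrightarrow> transport (G t) B \<sigma> g = transport (G' t) B \<sigma> g"
  shows "assembly_relabel G \<sigma> p = assembly_relabel G' \<sigma> p"
  unfolding assembly_relabel_eq_map_blocks
  by (rule map_blocks_cong) (use assms in \<open>cases p; auto dest!: block_struct\<close>)

lemma transport_at_ZY_cong:
  assumes "\<And>i U x. x \<in> structs (Y i) U \<Longrightarrow> transport (Y i) U \<sigma> x = transport (Y' i) U \<sigma> x"
    and "g \<in> structs (at_ZY Y t) B"
  shows "transport (at_ZY Y t) B \<sigma> g = transport (at_ZY Y' t) B \<sigma> g"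
  using assms by (cases t) (auto simp: at_ZY_def)

text \<open>The iterates are nested as sets and their transports agree wherever they overlap, so a
  plain union serves as the limit; \<open>LEAST\<close> merely selects one of the iterates that
  contain \<open>x\<close>.\<close>

definition limit_species :: "('z::finite, 'm::finite) system \<Rightarrow> ('z, 'm) species_vec" where
  "limit_species H i = \<lparr>structs = (\<lambda>U. \<Union>n. structs (iterate H n i) U),
     transport = (\<lambda>U \<sigma> x. transport (iterate H (LEAST n. x \<in> structs (iterate H n i) U) i) U \<sigma> x)\<rparr>"

lemma structs_limit: "structs (limit_species H i) U = (\<Union>n. structs (iterate H n i) U)"
  by (simp add: limit_species_def)

context
  fixes H :: "('z::finite, 'm::finite) system"
  assumes H: "\<And>i. is_species (H i)"
begin

text \<open>The inclusion requires no embedding: the code of a class depends on \<open>H i\<close>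
  and on the assembly, and assemblies with blocks from one iterate are assemblies with blocks from
  the next.\<close>

lemma iterate_Suc_extends:
  "structs (iterate H n i) U \<subseteq> structs (iterate H (Suc n) i) U \<and>
    (\<forall>x\<in>structs (iterate H n i) U. transport (iterate H n i) U \<sigma> x = transport (iterate H (Suc n) i) U \<sigma> x)"
proof (induction n arbitrary: i U)
  case (Suc n)
  let ?Y = "iterate H n" and ?Y' = "iterate H (Suc n)"
  have sub: "structs (at_ZY ?Y t) B \<subseteq> structs (at_ZY ?Y' t) B" for t B
    using Suc by (cases t) (auto simp: at_ZY_def)
  have "transport (system_apply H ?Y i) U \<sigma> x = transport (system_apply H ?Y' i) U \<sigma> x"
    if x: "x \<in> structs (system_apply H ?Y i) U" for x
  proof -
    obtain p where p: "p \<in> assemblies (H i) (at_ZY ?Y) U" "x = to_nat (assembly_class (H i) p)"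
      using x by (auto simp: structs_system_apply)
    have "assembly_relabel (at_ZY ?Y) \<sigma> p = assembly_relabel (at_ZY ?Y') \<sigma> p"
      by (rule assembly_relabel_cong[OF p(1)], rule transport_at_ZY_cong) (use Suc in auto)
    moreover have p': "p \<in> assemblies (H i) (at_ZY ?Y') U"
      using assemblies_mono[of "at_ZY ?Y" "at_ZY ?Y'"] sub p(1) by blast
    ultimately show ?thesis
      using p(2) transport_system_apply[where H = H and i = i, OF H p(1), of \<sigma>] transport_system_apply[where H = H and i = i, OF H p', of \<sigma>] by simp
  qed
  moreover have "structs (system_apply H ?Y i) U \<subseteq> structs (system_apply H ?Y' i) U"
    unfolding structs_system_apply by (intro image_mono assemblies_mono sub)
  ultimately show ?case by (simp add: iterate_Suc)
qed (simp add: vec_zero_def species_zero_def)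

lemma iterate_mono: "n \<le> k \<Longrightarrow> structs (iterate H n i) U \<subseteq> structs (iterate H k i) U"
  by (rule lift_Suc_mono_le[where f = "\<lambda>n. structs (iterate H n i) U"])
    (use iterate_Suc_extends in blast)+

lemma iterate_transport:
  assumes "n \<le> k" "x \<in> structs (iterate H n i) U"
  shows "transport (iterate H n i) U \<sigma> x = transport (iterate H k i) U \<sigma> x"
  using assms(1)
proof (induction k rule: dec_induct)
  case (step k)
  have "x \<in> structs (iterate H k i) U" using assms(2) iterate_mono[OF step.hyps(1)] by blast
  then show ?case using step.IH iterate_Suc_extends by simp
qed simp

lemma transport_limit:
  assumes "x \<in> structs (iterate H n i) U"
  shows "transport (limit_species H i) U \<sigma> x = transport (iterate H n i) U \<sigma> x"
proof -
  let ?P = "\<lambda>n. x \<in> structs (iterate H n i) U"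
  have "transport (iterate H (Least ?P) i) U \<sigma> x = transport (iterate H n i) U \<sigma> x"
    using iterate_transport[of "Least ?P" n x i U \<sigma>] Least_le[of ?P n] LeastI[of ?P n] assms by blast
  then show ?thesis by (simp add: limit_species_def)
qed

lemma functorial_limit: "functorial (limit_species H i)"
proof (rule functorialI)
  fix U x assume "x \<in> structs (limit_species H i) U"
  then obtain n where n: "x \<in> structs (iterate H n i) U" by (auto simp: structs_limit)
  note F = functorial_iterate[of H n i, OF H]
  show "transport (limit_species H i) U (\<lambda>s. id) x = x"
    using functorial_id[OF F n] by (simp add: transport_limit[OF n])
  fix \<sigma> assume \<sigma>: "relabelling \<sigma> U"
  note n' = functorial_closed[OF F \<sigma> n]
  show "transport (limit_species H i) U \<sigma> x \<in> structs (limit_species H i) (relabel \<sigma> U)"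
    using n' by (auto simp: transport_limit[OF n] structs_limit)
  show "transport (limit_species H i) U \<sigma> x = transport (limit_species H i) U \<sigma>' x"
    if "\<forall>s a. a |\<in>| U s \<longrightarrow> \<sigma> s a = \<sigma>' s a" for \<sigma>'
    using functorial_cong[OF F \<sigma> that n] by (simp add: transport_limit[OF n])
  show "transport (limit_species H i) U (\<lambda>s. \<tau> s \<circ> \<sigma> s) x
      = transport (limit_species H i) (relabel \<sigma> U) \<tau> (transport (limit_species H i) U \<sigma> x)"
    if "relabelling \<tau> (relabel \<sigma> U)" for \<tau>
    using functorial_comp[OF F \<sigma> that n] by (simp add: transport_limit[OF n] transport_limit[OF n'])
qed

text \<open>An assembly has finitely many blocks, so a single iterate contains all of them:
  composition commutes with the increasing union.\<close>

lemma assemblies_limit: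
  assumes p: "p \<in> assemblies F (at_ZY (limit_species H)) U"
  shows "\<exists>n. p \<in> assemblies F (at_ZY (iterate H n)) U"
proof -
  obtain f bl where pe: "p = (f, bl)" by (metis surj_pair)
  let ?B = "SIGMA j:UNIV. set (bl (Inr j))"
  have "\<forall>x\<in>?B. \<exists>n. snd (snd x) \<in> structs (iterate H n (fst x)) (fst (snd x))"
    using p by (auto simp: pe at_ZY_def structs_limit dest!: block_struct)
  then obtain h where h: "\<And>x. x \<in> ?B \<Longrightarrow> snd (snd x) \<in> structs (iterate H (h x) (fst x)) (fst (snd x))" by metis
  have "finite (h ` ?B)" by auto
  then obtain N where N: "\<And>x. x \<in> ?B \<Longrightarrow> h x \<le> N" by (auto simp: finite_nat_set_iff_bounded_le)
  have "g \<in> structs (at_ZY (iterate H N) t) B" if b: "(B, g) \<in> set (bl t)" for t B g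
  proof (cases t)
    case (Inl z)
    then show ?thesis using block_struct[OF p[unfolded pe] b] by (simp add: at_ZY_def)
  next
    case (Inr j)
    then show ?thesis
      using h[of "(j, (B, g))"] N[of "(j, (B, g))"] iterate_mono[of "h (j, (B, g))" N j B] b
      by (auto simp: at_ZY_def)
  qed
  then have "(f, bl) \<in> assemblies F (at_ZY (iterate H N)) U" using p by (simp add: pe assemblies_iff)
  then show ?thesis unfolding pe by blast
qed

text \<open>The union is a fixed point on the nose, so the coding of classes can itself serve as
  \<open>node\<close>.\<close>

lemma limit_tree_algebra:
  assumes T: "\<And>i. is_species (limit_species H i)"
  shows "tree_algebra H (limit_species H) (\<lambda>i U p. to_nat (assembly_class (H i) p))"
proof
  fix i and U :: "'z labels"
  have sub: "structs (at_ZY (iterate H n) t) B \<subseteq> structs (at_ZY (limit_species H) t) B" for n t B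
    by (cases t) (auto simp: at_ZY_def structs_limit)
  have subA: "p \<in> assemblies F (at_ZY (limit_species H)) U" if "p \<in> assemblies F (at_ZY (iterate H n)) U" for n p F U
    using assemblies_mono[of "at_ZY (iterate H n)" "at_ZY (limit_species H)"] sub that by blast
  show "(\<lambda>p. to_nat (assembly_class (H i) p)) ` assemblies (H i) (at_ZY (limit_species H)) U = structs (limit_species H i) U"
  proof (intro subset_antisym subsetI)
    fix x assume "x \<in> (\<lambda>p. to_nat (assembly_class (H i) p)) ` assemblies (H i) (at_ZY (limit_species H)) U"
    then obtain p where p: "p \<in> assemblies (H i) (at_ZY (limit_species H)) U" "x = to_nat (assembly_class (H i) p)" by blast
    then obtain n where "p \<in> assemblies (H i) (at_ZY (iterate H n)) U" using assemblies_limit by blast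
    then have "x \<in> structs (iterate H (Suc n) i) U" using p(2) by (simp add: iterate_Suc structs_system_apply)
    then show "x \<in> structs (limit_species H i) U" unfolding structs_limit by blast
  next
    fix x assume "x \<in> structs (limit_species H i) U"
    then obtain n where n: "x \<in> structs (iterate H n i) U" by (auto simp: structs_limit)
    then have "x \<in> structs (iterate H (Suc n) i) U" using iterate_Suc_extends by blast
    then obtain p where p: "p \<in> assemblies (H i) (at_ZY (iterate H n)) U" "x = to_nat (assembly_class (H i) p)"
      unfolding iterate_Suc structs_system_apply by blast
    then show "x \<in> (\<lambda>p. to_nat (assembly_class (H i) p)) ` assemblies (H i) (at_ZY (limit_species H)) U"
      using subA[OF p(1)] by blast
  qed
  show "to_nat (assembly_class (H i) p) = to_nat (assembly_class (H i) q) \<longleftrightarrow> q \<in> reorderings (H i) p"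
    if "p \<in> assemblies (H i) (at_ZY (limit_species H)) U" "q \<in> assemblies (H i) (at_ZY (limit_species H)) U" for p q
    using assembly_class_eq_iff[OF H well_labelled_assembly[OF that(1)] well_labelled_assembly[OF that(2)]] by simp
  fix \<sigma> p assume p: "p \<in> assemblies (H i) (at_ZY (limit_species H)) U"
  obtain n where n: "p \<in> assemblies (H i) (at_ZY (iterate H n)) U" using assemblies_limit[OF p] by blast
  have mem: "to_nat (assembly_class (H i) p) \<in> structs (iterate H (Suc n) i) U"
    using n by (simp add: iterate_Suc structs_system_apply)
  have "transport (limit_species H i) U \<sigma> (to_nat (assembly_class (H i) p))
      = to_nat (assembly_class (H i) (assembly_relabel (at_ZY (iterate H n)) \<sigma> p))"
    using transport_system_apply[where H = H and i = i, OF H n] unfolding transport_limit[OF mem] iterate_Suc .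
  also have "assembly_relabel (at_ZY (iterate H n)) \<sigma> p = assembly_relabel (at_ZY (limit_species H)) \<sigma> p"
    by (rule assembly_relabel_cong[OF n], rule transport_at_ZY_cong) (auto simp: transport_limit)
  finally show "transport (limit_species H i) U \<sigma> (to_nat (assembly_class (H i) p))
      = to_nat (assembly_class (H i) (assembly_relabel (at_ZY (limit_species H)) \<sigma> p))" .
qed (simp_all add: H T)

end

section \<open>Solutions of a well-founded system\<close>

context
  fixes H :: "('z::finite, 'm::finite) system" and S\<^sub>0 :: "('z, 'm) species_vec"
  assumes H: "\<And>i. is_species (H i)"
    and S\<^sub>0: "\<And>i. is_species (S\<^sub>0 i)"
    and conv: "converges_to (iterate H) S\<^sub>0"
    and nz: "\<And>i. \<not> species_iso (S\<^sub>0 i) (species_zero :: ('z, nat) species)"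
begin

text \<open>Contact fixes the cardinalities at sizes up to \<open>p\<close> from some index on, and
  an increasing sequence of finite sets of constant cardinality is constant. In this way convergence
  is used without comparing the isomorphisms belonging to different orders.\<close>

lemma iterate_stable:
  obtains N where "\<And>n i U. N \<le> n \<Longrightarrow> label_size U \<le> p \<Longrightarrow> structs (iterate H n i) U = structs (iterate H N i) U"
    "\<And>i U. label_size U \<le> p \<Longrightarrow> finite (structs (iterate H N i) U)"
    "\<And>i U. label_size U \<le> p \<Longrightarrow> card (structs (iterate H N i) U) = card (structs (S\<^sub>0 i) U)"
proof -
  obtain N where N: "\<And>n. N \<le> n \<Longrightarrow> contact p (iterate H n) S\<^sub>0" using conv unfolding converges_to_def by metis
  have fin: "finite (structs (iterate H n i) U)" if "N \<le> n" "label_size U \<le> p" for n i U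
    using contact_finite[OF N[OF that(1)] that(2), of i] S\<^sub>0 by (simp add: is_species_iff_functorial)
  have card: "card (structs (iterate H n i) U) = card (structs (S\<^sub>0 i) U)" if "N \<le> n" "label_size U \<le> p" for n i U
    using contact_card[OF N[OF that(1)] that(2)] .
  show thesis
  proof (rule that)
    show "structs (iterate H n i) U = structs (iterate H N i) U" if n: "N \<le> n" and U: "label_size U \<le> p" for n i U
      using card_subset_eq[OF fin[OF n U] iterate_mono[OF H n]] card[OF n U] card[OF order_refl U] by metis
  qed (use fin card in auto)
qed

lemma limit_stable:
  obtains N where "\<And>i U. label_size U \<le> p \<Longrightarrow> structs (limit_species H i) U = structs (iterate H N i) U"
    "\<And>i U. label_size U \<le> p \<Longrightarrow> finite (structs (limit_species H i) U)"
    "\<And>i U. label_size U \<le> p \<Longrightarrow> card (structs (limit_species H i) U) = card (structs (S\<^sub>0 i) U)"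
proof -
  obtain N where N: "\<And>n i U. N \<le> n \<Longrightarrow> label_size U \<le> p \<Longrightarrow> structs (iterate H n i) U = structs (iterate H N i) U"
    "\<And>i U. label_size U \<le> p \<Longrightarrow> finite (structs (iterate H N i) U)"
    "\<And>i U. label_size U \<le> p \<Longrightarrow> card (structs (iterate H N i) U) = card (structs (S\<^sub>0 i) U)"
    using iterate_stable[of p] by metis
  have eq: "structs (limit_species H i) U = structs (iterate H N i) U" if U: "label_size U \<le> p" for i U
  proof -
    have "structs (iterate H n i) U \<subseteq> structs (iterate H N i) U" for n
      using N(1)[OF _ U, of n i] iterate_mono[where H = H and n = n and k = N and i = i and U = U, OF H] by (cases "N \<le> n") auto
    then show ?thesis unfolding structs_limit by blast
  qed
  show thesis using eq N(2,3) by (intro that[of N]) simp_all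
qed

lemma is_species_limit: "is_species (limit_species H i)"
proof -
  have "finite (structs (limit_species H i) U)" for U
    using limit_stable[of "label_size U"] by (metis order_refl)
  then show ?thesis by (simp add: is_species_iff_functorial functorial_limit[OF H])
qed

lemma limit_trees:
  "tree_algebra.trees H (limit_species H) (\<lambda>i U p. to_nat (assembly_class (H i) p)) n i U = structs (iterate H n i) U"
proof -
  interpret tree_algebra H "limit_species H" "\<lambda>i U p. to_nat (assembly_class (H i) p)"
    by (rule limit_tree_algebra[OF H is_species_limit])
  show ?thesis
  proof (induction n arbitrary: i U)
    case (Suc n)
    have "structs (at_ZY (sub (trees n)) t) B = structs (at_ZY (iterate H n) t) B" for t B
      using Suc by (cases t) (simp_all add: at_ZY_def)
    then have "assemblies (H i) (at_ZY (sub (trees n))) U = assemblies (H i) (at_ZY (iterate H n)) U"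
      by (intro subset_antisym assemblies_mono) auto
    then show ?case by (simp add: trees_Suc step_def iterate_Suc structs_system_apply)
  qed (simp add: vec_zero_def species_zero_def)
qed

lemma limit_complete: "complete_tree_algebra H (limit_species H) (\<lambda>i U p. to_nat (assembly_class (H i) p))"
proof (intro complete_tree_algebra.intro complete_tree_algebra_axioms.intro)
  show "tree_algebra H (limit_species H) (\<lambda>i U p. to_nat (assembly_class (H i) p))"
    by (rule limit_tree_algebra[OF H is_species_limit])
  show "\<exists>N. \<forall>i U. label_size U \<le> p \<longrightarrow> structs (limit_species H i) U \<subseteq>
      tree_algebra.trees H (limit_species H) (\<lambda>i U p. to_nat (assembly_class (H i) p)) N i U" for p
    unfolding limit_trees using limit_stable[of p] by (metis order_refl)
  fix i
  have "\<exists>U. structs (S\<^sub>0 i) U \<noteq> {}"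
  proof (rule ccontr)
    assume "\<not> ?thesis"
    then have "species_iso (S\<^sub>0 i) (species_zero :: ('z, nat) species)"
      by (intro species_isoI[where \<phi> = "\<lambda>U x. 0"]) (auto simp: species_zero_def bij_betw_def)
    then show False using nz by blast
  qed
  then obtain U where U: "structs (S\<^sub>0 i) U \<noteq> {}" by blast
  have "card (structs (limit_species H i) U) = card (structs (S\<^sub>0 i) U)"
    using limit_stable[of "label_size U"] by (metis order_refl)
  moreover have "finite (structs (S\<^sub>0 i) U)" using S\<^sub>0 by (simp add: is_species_iff_functorial)
  ultimately have "structs (limit_species H i) U \<noteq> {}" using U by auto
  then show "\<exists>U. structs (limit_species H i) U \<noteq> {}" by blast
qed

interpretation limit: complete_tree_algebra H "limit_species H" "\<lambda>i U p. to_nat (assembly_class (H i) p)"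
  by (rule limit_complete)

lemma limit_no_labels: "structs (limit_species H i) no_labels = structs (iterate H CARD('m) i) no_labels"
  using limit.no_labels_height[of i] limit.trees_subset[of "CARD('m)" i no_labels] by (simp add: limit_trees)

lemma limit_has_initial_value: "has_initial_value H (limit_species H)"
  unfolding has_initial_value_iff[OF H is_species_limit] limit_no_labels by (metis bij_betw_id)

text \<open>The coordinates of \<open>Y\<close> that are nonempty at size 0 are among those where
  some iterate is, and in these the system is polynomial by assumption.\<close>

lemma composable_limit:
  assumes poly: "iteration_well_defined H"
    and Y: "\<And>j. structs (Y j) no_labels \<noteq> {} \<Longrightarrow> structs (limit_species H j) no_labels \<noteq> {}"
  shows "composable (H i) (at_ZY Y)" "composable (species_deriv s (H i)) (at_ZY Y)"
proof -
  have "{t. structs (at_ZY Y t) no_labels \<noteq> {}} \<subseteq> Inr ` {j. \<exists>n. structs (iterate H n j) no_labels \<noteq> {}}"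
  proof
    fix t assume "t \<in> {t. structs (at_ZY Y t) no_labels \<noteq> {}}"
    then show "t \<in> Inr ` {j. \<exists>n. structs (iterate H n j) no_labels \<noteq> {}}"
      using Y by (cases t) (auto simp: at_ZY_def structs_limit)
  qed
  then have "polynomial_in (H i) {t. structs (at_ZY Y t) no_labels \<noteq> {}}"
    using poly polynomial_in_subset unfolding iteration_well_defined_def by blast
  then show "composable (H i) (at_ZY Y)" "composable (species_deriv s (H i)) (at_ZY Y)"
    by (simp_all add: composable_def polynomial_in_deriv)
qed

lemma limit_is_solution:
  assumes "iteration_well_defined H" shows "is_solution H (limit_species H)"
  unfolding is_solution_def
proof (intro conjI allI)
  fix i
  have "species_iso (system_apply H (limit.sub limit.full) i) (limit.sub (limit.step limit.full) i)"
    by (rule limit.system_apply_sub_iso[OF limit.invariant_full])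
  moreover have "limit.sub limit.full = limit_species H"
    by (simp add: limit.sub_def fun_eq_iff)
  moreover have "limit.step limit.full = limit.full"
    unfolding limit.step_def[abs_def] limit.assemblies_sub_full limit.node_image ..
  ultimately have "species_iso (system_apply H (limit_species H) i) (limit_species H i)" by simp
  then show "species_iso (limit_species H i) (system_apply H (limit_species H) i)"
    by (rule species_iso_sym) (intro functorial_system_apply H functorial_limit)
qed (use is_species_limit composable_limit[OF assms] in auto)

lemma newton_iterate_defined:
  assumes "iteration_well_defined H" shows "newton_defined H (newton_iterate H n)"
  unfolding newton_defined_def
proof (intro conjI allI)
  note inv = limit.newton_sets_invariants[of n] and iso = limit.newton_iterate_iso[of n]
  show "is_species (newton_iterate H n i)" for i by (rule iso(1))
  have ne: "structs (limit_species H j) no_labels \<noteq> {}" if "structs (newton_iterate H n j) no_labels \<noteq> {}" for j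
    using that species_iso_empty[OF iso(2), of j no_labels] limit.invariant_subset[OF inv(1)] by auto
  show "composable (H i) (at_ZY (newton_iterate H n))" for i
    by (rule composable_limit[OF assms ne])
  show "composable (species_deriv (Inr j) (H i)) (at_ZY (newton_iterate H n))" for i j
    by (rule composable_limit[OF assms ne])
  show "species_summable (\<lambda>k. mat_power (jacobian H (newton_iterate H n)) k i j)" for i j
    by (rule limit.jacobian_powers_summable[OF inv(1,2) iso])
  show "subspecies (newton_iterate H n i) (system_apply H (newton_iterate H n) i)" for i
    by (rule limit.subspecies_system_apply[OF inv(1,2) iso])
qed

text \<open>The isomorphism of \<open>S\<close> with the system applied to \<open>S\<close>,
  inverted, assembles a root and its children into a structure of \<open>S\<close>.\<close>

lemma solution_tree_algebra:
  assumes "is_solution H S"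
  obtains node where "tree_algebra H S node"
proof -
  have S: "\<And>i. is_species (S i)" and iso: "\<And>i. species_iso (S i) (system_apply H S i)"
    using assms by (auto simp: is_solution_def)
  have fS: "functorial (S i)" for i by (rule is_species_functorial[OF S])
  have "\<forall>i. \<exists>\<psi>. natural (system_apply H S i) (S i) \<psi> \<and>
      (\<forall>U. bij_betw (\<psi> U) (structs (system_apply H S i) U) (structs (S i) U))"
    using species_iso_sym[OF iso fS] unfolding species_iso_def by blast
  then obtain \<psi> where \<psi>: "\<And>i. natural (system_apply H S i) (S i) (\<psi> i)"
    "\<And>i U. bij_betw (\<psi> i U) (structs (system_apply H S i) U) (structs (S i) U)" by metis
  have "tree_algebra H S (\<lambda>i U p. \<psi> i U (to_nat (assembly_class (H i) p)))"
  proof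
    fix i and U :: "'z labels"
    show "(\<lambda>p. \<psi> i U (to_nat (assembly_class (H i) p))) ` assemblies (H i) (at_ZY S) U = structs (S i) U"
      using \<psi>(2)[of i U] by (simp add: bij_betw_def structs_system_apply image_image)
    have mem: "to_nat (assembly_class (H i) p) \<in> structs (system_apply H S i) U"
      if "p \<in> assemblies (H i) (at_ZY S) U" for p
      using that by (simp add: structs_system_apply)
    show "\<psi> i U (to_nat (assembly_class (H i) p)) = \<psi> i U (to_nat (assembly_class (H i) q)) \<longleftrightarrow> q \<in> reorderings (H i) p"
      if p: "p \<in> assemblies (H i) (at_ZY S) U" and q: "q \<in> assemblies (H i) (at_ZY S) U" for p q
      using assembly_class_eq_iff[OF H well_labelled_assembly[OF p] well_labelled_assembly[OF q]]
        inj_on_eq_iff[OF bij_betw_imp_inj_on[OF \<psi>(2)] mem[OF p] mem[OF q]] by simp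
    fix \<sigma> p assume \<sigma>: "relabelling \<sigma> U" and p: "p \<in> assemblies (H i) (at_ZY S) U"
    show "transport (S i) U \<sigma> (\<psi> i U (to_nat (assembly_class (H i) p)))
        = \<psi> i (relabel \<sigma> U) (to_nat (assembly_class (H i) (assembly_relabel (at_ZY S) \<sigma> p)))"
      using naturalD[OF \<psi>(1) \<sigma> mem[OF p]] transport_system_apply[where H = H and i = i, OF H p, of \<sigma>] by simp
  qed (use H S in auto)
  then show thesis by (rule that)
qed

text \<open>The form in which uniqueness is used: the initial value makes every structure without
  labels a tree, acyclicity extends this to all label sets, and the stable iterates bound the
  heights.\<close>

lemma solution_complete:
  assumes alg: "tree_algebra H S node" and init: "has_initial_value H S"
  shows "complete_tree_algebra H S node"
proof -
  interpret tree_algebra H S node by (rule alg)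
  have card: "card (trees n i U) = card (structs (iterate H n i) U)" for n i U
    using species_iso_card[OF iterate_iso, of n i U] by simp
  have Sm: "structs (S i) no_labels = trees CARD('m) i no_labels" for i
  proof -
    have "\<exists>\<phi>. bij_betw \<phi> (structs (S i) no_labels) (structs (iterate H CARD('m) i) no_labels)"
      using init unfolding has_initial_value_iff[OF H S] by blast
    then have "card (structs (S i) no_labels) = card (trees CARD('m) i no_labels)"
      unfolding card by (auto dest: bij_betw_same_card)
    then show ?thesis using card_subset_eq[OF finite_S trees_subset] by metis
  qed
  \<comment> \<open>The dependencies are determined by the coordinates that are nonzero on the empty
    label set. These are the same as for the limit, whose dependencies are known to be
    acyclic.\<close>
  have "structs (S i) no_labels \<noteq> {} \<longleftrightarrow> structs (limit_species H i) no_labels \<noteq> {}" for i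
    using species_iso_empty[OF iterate_iso, of "CARD('m)" i no_labels] by (simp add: Sm limit_no_labels)
  then have acyc: "acyclic dependency" using limit.acyclic_dependency by simp
  have all: "structs (S i) U \<subseteq> (\<Union>n. trees n i U)" for i U
    by (rule all_structures_trees[OF _ acyc]) (use Sm in blast)
  show ?thesis
  proof (intro complete_tree_algebra.intro complete_tree_algebra_axioms.intro alg)
    fix p
    obtain N where N: "\<And>n i U. N \<le> n \<Longrightarrow> label_size U \<le> p \<Longrightarrow> structs (iterate H n i) U = structs (iterate H N i) U"
      using iterate_stable[of p] by metis
    \<comment> \<open>The iterates are isomorphic to the sets \<open>trees n\<close>, so these also
      have constant cardinality from \<open>N\<close> on; being finite and nested, they are
      constant.\<close>
    have "trees n i U \<subseteq> trees N i U" if U: "label_size U \<le> p" for n i U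
    proof (cases "N \<le> n")
      case True
      have "finite (trees n i U)" by (rule finite_invariant[OF invariant_trees])
      then show ?thesis using card_subset_eq[OF _ trees_mono[OF True]] N[OF True U] card by (metis order_refl)
    qed (simp add: trees_mono)
    then show "\<exists>N. \<forall>i U. label_size U \<le> p \<longrightarrow> structs (S i) U \<subseteq> trees N i U" using all by blast
  next
    fix i
    obtain U n where "structs (iterate H n i) U \<noteq> {}" using limit.nonzero[of i] by (auto simp: structs_limit)
    then have "trees n i U \<noteq> {}" using species_iso_empty[OF iterate_iso, of n i U] by simp
    then show "\<exists>U. structs (S i) U \<noteq> {}" using trees_subset by blast
  qed
qed

end

theorem mainTheorem7:
  fixes H :: "('z::finite, 'm::finite) system"
  assumes "\<forall>i. is_species (H i)"
    and "well_founded H"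
  shows "(\<forall>n. newton_defined H (newton_iterate H n)) \<and>
         (\<exists>S. is_solution H S \<and> has_initial_value H S) \<and>
         (\<forall>S. is_solution H S \<and> has_initial_value H S
              \<longrightarrow> converges_quadratically_to (newton_iterate H) S)"
proof -
  have H: "is_species (H i)" for i using assms(1) by blast
  have wd: "iteration_well_defined H" using assms(2) by (simp add: well_founded_def)
  obtain S\<^sub>0 where "\<forall>i. is_species (S\<^sub>0 i)" "converges_to (iterate H) S\<^sub>0"
    "\<forall>i. \<not> species_iso (S\<^sub>0 i) (species_zero :: ('z, nat) species)"
    using assms(2) unfolding well_founded_def by blast
  then have S\<^sub>0: "\<And>i. is_species (S\<^sub>0 i)" "converges_to (iterate H) S\<^sub>0"
    "\<And>i. \<not> species_iso (S\<^sub>0 i) (species_zero :: ('z, nat) species)" by blast+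
  have "converges_quadratically_to (newton_iterate H) S" if S: "is_solution H S" "has_initial_value H S" for S
  proof -
    obtain node where "tree_algebra H S node" by (rule solution_tree_algebra[OF H S\<^sub>0 S(1)])
    then show ?thesis
      using complete_tree_algebra.newton_converges solution_complete[OF H S\<^sub>0 _ S(2)] by blast
  qed
  then show ?thesis
    using newton_iterate_defined[OF H S\<^sub>0 wd] limit_is_solution[OF H S\<^sub>0 wd] limit_has_initial_value[OF H S\<^sub>0] by blast
qed

end
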